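(* Let $m\ge 1$ and $n=\binom{m}{2}$. Then $\widetilde{H}_{n-3-i}(IN(M^{*}(K_m)),\mathbb{C})$ and $\widetilde{H}_{i}(\Pi_m,\mathbb{C})\otimes\mathrm{sgn}$ are isomorphic as $\mathfrak{S}_m$-modules for every integer $i\ge 0$.
   Context: $K_m$ is the complete graph on $\{1,\dots,m\}$; $M(K_m)$ is its cycle (graphic) matroid, whose ground set is the set of $n=\binom m2$ edges; $M^{*}(K_m)$ is the dual matroid, and $IN(M^{*}(K_m))$ is the simplicial complex of independent sets of $M^{*}(K_m)$. $\Pi_m$ is the lattice of partitions of $\{1,\dots,m\}$ ordered by refinement (isomorphic to the lattice of flats of $M(K_m)$), and $\widetilde{H}_i(\Pi_m,\mathbb{C})$ is the reduced homology of the order complex of $\Pi_m\smallsetminus\{\widehat 0,\widehat 1\}$, where $\widehat 0,\widehat 1$ are the minimum and maximum. The symmetric group $\mathfrak{S}_m$ acts by permuting $\{1,\dots,m\}$, hence on edges, on partitions, on both complexes (on oriented simplices by $g[x_0,\dots,x_k]=[g x_0,\dots,g x_k]$) and on their reduced homology (the empty face has degree $-1$). $\mathrm{sgn}$ is the one-dimensional representation in which $g\in\mathfrak{S}_m$ acts by the sign of the permutation it induces on the $n$ edges of $K_m$, i.e. the pullback along $\mathfrak{S}_m\to\mathfrak{S}_n$ of the sign representation of $\mathfrak{S}_n$. *)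

theory Defs
  imports
    Complex_Main
    "HOL-Algebra.Module"
    "HOL-Algebra.AbelCoset"
    "HOL-Algebra.Sym_Groups"
    "HOL-Combinatorics.Permutations"
    "HOL-Library.Disjoint_Sets"
begin

section \<open>Representations on complex vector spaces\<close>

text \<open>
  A complex vector space is a HOL-Algebra module record with scalars of type \<^typ>\<open>complex\<close>; the
  fields \<open>mult\<close> and \<open>one\<close>, which the record type inherits from rings, play no role and are left
  unspecified.  An action of a group \<open>G\<close> on such a space is a function of a group element and a
  vector.
\<close>

definition quotient_module :: "('r, 'a) module \<Rightarrow> 'a set \<Rightarrow> ('r, 'a set) module" where
  "quotient_module M N =
     \<lparr>carrier = a_rcosets\<^bsub>M\<^esub> N, monoid.mult = undefined, one = undefined, zero = N, add = set_add M,
      smult = (\<lambda>a X. \<Union>x\<in>X. N +>\<^bsub>M\<^esub> (a \<odot>\<^bsub>M\<^esub> x))\<rparr>"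

definition rep_isomorphic ::
  "'g monoid \<Rightarrow> (complex, 'v) module \<Rightarrow> ('g \<Rightarrow> 'v \<Rightarrow> 'v) \<Rightarrow> (complex, 'w) module \<Rightarrow> ('g \<Rightarrow> 'w \<Rightarrow> 'w) \<Rightarrow> bool"
where
  "rep_isomorphic G V \<rho> W \<sigma> \<longleftrightarrow>
     (\<exists>f \<in> iso (add_monoid V) (add_monoid W).
        (\<forall>a. \<forall>x\<in>carrier V. f (a \<odot>\<^bsub>V\<^esub> x) = a \<odot>\<^bsub>W\<^esub> f x) \<and>
        (\<forall>g\<in>carrier G. \<forall>x\<in>carrier V. f (\<rho> g x) = \<sigma> g (f x)))"

text \<open>
  The tensor product of a representation \<open>\<rho>\<close> on \<open>V\<close> with the one-dimensional representation
  afforded by a linear character \<open>\<chi>\<close>: the underlying space \<open>V \<otimes> \<complex>\<close> is identified with \<open>V\<close>.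
\<close>
definition tensor_character ::
  "(complex, 'v) module \<Rightarrow> ('g \<Rightarrow> 'v \<Rightarrow> 'v) \<Rightarrow> ('g \<Rightarrow> complex) \<Rightarrow> 'g \<Rightarrow> 'v \<Rightarrow> 'v" where
  "tensor_character V \<rho> \<chi> = (\<lambda>g x. \<chi> g \<odot>\<^bsub>V\<^esub> \<rho> g x)"


section \<open>Reduced simplicial homology with complex coefficients\<close>

text \<open>
  A simplicial complex is given by its set of faces, including the empty face.  An oriented chain
  of degree \<open>d\<close> is a finitely supported function \<open>c\<close> on the ordered \<open>d\<close>-simplices (lists of \<open>d + 1\<close>
  distinct vertices spanning a face) that is alternating under reordering: \<open>c xs\<close> is the
  coefficient of the oriented simplex \<open>[xs]\<close>.  In degree \<open>-1\<close> the only simplex is the empty list,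
  and in degrees below \<open>-1\<close> only the zero chain exists.
\<close>

definition oriented_chains :: "'a set set \<Rightarrow> int \<Rightarrow> ('a list \<Rightarrow> complex) set" where
  "oriented_chains K d =
     {c. finite {xs. c xs \<noteq> 0} \<and>
         (\<forall>xs. c xs \<noteq> 0 \<longrightarrow> distinct xs \<and> set xs \<in> K \<and> int (length xs) = d + 1) \<and>
         (\<forall>xs \<pi>. \<pi> permutes {..<length xs} \<longrightarrow> c (permute_list \<pi> xs) = of_int (sign \<pi>) * c xs)}"

text \<open>
  The boundary in coordinates: \<open>[ys]\<close> occurs with coefficient \<open>1\<close> in the boundary of \<open>[v # ys]\<close>.
  Lemma \<open>boundary_oriented_simplex\<close> below gives the usual alternating sum.
\<close>
definition boundary :: "('a list \<Rightarrow> complex) \<Rightarrow> 'a list \<Rightarrow> complex" where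
  "boundary c = (\<lambda>ys. \<Sum>v | c (v # ys) \<noteq> 0. c (v # ys))"

definition cycle_module :: "'a set set \<Rightarrow> int \<Rightarrow> (complex, 'a list \<Rightarrow> complex) module" where
  "cycle_module K d =
     \<lparr>carrier = {c \<in> oriented_chains K d. boundary c = (\<lambda>_. 0)}, monoid.mult = undefined, one = undefined,
      zero = (\<lambda>_. 0), add = (\<lambda>c c' xs. c xs + c' xs), smult = (\<lambda>a c xs. a * c xs)\<rparr>"

definition reduced_homology :: "'a set set \<Rightarrow> int \<Rightarrow> (complex, ('a list \<Rightarrow> complex) set) module" where
  "reduced_homology K d = quotient_module (cycle_module K d) (boundary ` oriented_chains K (d + 1))"

text \<open>
  The map on chains induced by a bijection \<open>\<phi>\<close> of the vertices, \<open>[x\<^sub>0, \<dots>, x\<^sub>k] \<mapsto> [\<phi> x\<^sub>0, \<dots>, \<phi> x\<^sub>k]\<close>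
  (lemma \<open>chain_map_oriented_simplex\<close> below).
\<close>
definition chain_map :: "('a \<Rightarrow> 'a) \<Rightarrow> ('a list \<Rightarrow> complex) \<Rightarrow> 'a list \<Rightarrow> complex" where
  "chain_map \<phi> c = (\<lambda>xs. c (map (inv_into UNIV \<phi>) xs))"

definition homology_action ::
  "('g \<Rightarrow> 'a \<Rightarrow> 'a) \<Rightarrow> 'g \<Rightarrow> ('a list \<Rightarrow> complex) set \<Rightarrow> ('a list \<Rightarrow> complex) set" where
  "homology_action act = (\<lambda>g X. chain_map (act g) ` X)"


subsection \<open>The boundary and the induced map on oriented simplices\<close>

definition oriented_simplex :: "'a list \<Rightarrow> 'a list \<Rightarrow> complex" where
  "oriented_simplex xs = (\<lambda>ys. \<Sum>\<pi> | \<pi> permutes {..<length xs} \<and> ys = permute_list \<pi> xs. of_int (sign \<pi>))"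

lemma permute_list_inj:
  assumes "distinct xs" "\<pi> permutes {..<length xs}" "\<tau> permutes {..<length xs}"
    "permute_list \<pi> xs = permute_list \<tau> xs"
  shows "\<pi> = \<tau>"
proof
  fix i
  show "\<pi> i = \<tau> i"
  proof (cases "i < length xs")
    case True
    then have "xs ! \<pi> i = xs ! \<tau> i"
      using assms(2-4) by (metis permute_list_nth)
    moreover have "\<pi> i < length xs" "\<tau> i < length xs"
      using True assms(2,3) by (auto simp: permutes_in_image dest: permutes_in_image[of _ _ i])
    ultimately show ?thesis
      using assms(1) by (simp add: nth_eq_iff_index_eq)
  next
    case False
    then show ?thesis
      using assms(2,3) by (simp add: permutes_not_in)
  qed
qed

lemma oriented_simplex_permute:
  assumes "distinct xs" "\<pi> permutes {..<length xs}"
  shows "oriented_simplex xs (permute_list \<pi> xs) = of_int (sign \<pi>)"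
proof -
  have "{\<tau>. \<tau> permutes {..<length xs} \<and> permute_list \<pi> xs = permute_list \<tau> xs} = {\<pi>}"
    using permute_list_inj[OF assms(1)] assms(2) by auto
  then show ?thesis
    by (simp add: oriented_simplex_def)
qed

lemma oriented_simplex_eq_0:
  assumes "mset ys \<noteq> mset xs"
  shows "oriented_simplex xs ys = 0"
proof -
  have none: "{\<pi>. \<pi> permutes {..<length xs} \<and> ys = permute_list \<pi> xs} = {}"
    using assms by auto
  show ?thesis
    unfolding oriented_simplex_def none by simp
qed

lemma oriented_simplex_alternating:
  assumes "distinct xs" "\<sigma> permutes {..<length ys}"
  shows "oriented_simplex xs (permute_list \<sigma> ys) = of_int (sign \<sigma>) * oriented_simplex xs ys"
proof (cases "mset ys = mset xs")
  case True
  then obtain \<pi> where \<pi>: "\<pi> permutes {..<length xs}" "permute_list \<pi> xs = ys"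
    by (rule mset_eq_permutation)
  have len: "length ys = length xs"
    using True by (rule mset_eq_length)
  have \<sigma>: "\<sigma> permutes {..<length xs}"
    using assms(2) len by simp
  have "permute_list \<sigma> ys = permute_list (\<pi> \<circ> \<sigma>) xs"
    using \<pi> \<sigma> permute_list_compose by metis
  moreover have "sign (\<pi> \<circ> \<sigma>) = sign \<pi> * sign \<sigma>"
    using \<pi>(1) \<sigma> by (intro sign_compose) (auto intro: permutes_imp_permutation[OF finite_lessThan])
  ultimately show ?thesis
    using oriented_simplex_permute[OF assms(1) permutes_compose[OF \<sigma> \<pi>(1)]]
      oriented_simplex_permute[OF assms(1) \<pi>(1)] \<pi>(2)
    by (simp add: mult.commute)
next
  case False
  then show ?thesis
    using assms(2) by (simp add: oriented_simplex_eq_0)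
qed

lemma oriented_simplex_chain:
  assumes "distinct xs" "set xs \<in> K"
  shows "oriented_simplex xs \<in> oriented_chains K (int (length xs) - 1)"
proof -
  have supp: "oriented_simplex xs ys \<noteq> 0 \<Longrightarrow> mset ys = mset xs" for ys
    using oriented_simplex_eq_0 by blast
  have "finite {ys. mset ys = mset xs}"
    by (rule finite_subset[OF _ finite_lists_length_eq[of "set xs" "length xs"]])
      (auto dest: mset_eq_setD mset_eq_length)
  then have "finite {ys. oriented_simplex xs ys \<noteq> 0}"
    by (rule rev_finite_subset) (use supp in auto)
  moreover have "distinct ys \<and> set ys \<in> K \<and> length ys = length xs"
    if "oriented_simplex xs ys \<noteq> 0" for ys
    using supp[OF that] assms by (metis mset_eq_imp_distinct_iff mset_eq_length mset_eq_setD)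
  ultimately show ?thesis
    using oriented_simplex_alternating[OF assms(1)] by (auto simp: oriented_chains_def)
qed

lemma chain_map_oriented_simplex:
  assumes "bij \<phi>"
  shows "chain_map \<phi> (oriented_simplex xs) = oriented_simplex (map \<phi> xs)"
proof
  fix ys
  have "map (inv_into UNIV \<phi>) ys = permute_list \<pi> xs \<longleftrightarrow> ys = permute_list \<pi> (map \<phi> xs)"
    if "\<pi> permutes {..<length xs}" for \<pi>
  proof -
    have eq: "permute_list \<pi> (map \<phi> xs) = map \<phi> (permute_list \<pi> xs)"
      using that by (rule permute_list_map)
    have "map \<phi> (map (inv_into UNIV \<phi>) ys) = ys" for ys
      using assms by (simp add: bij_is_surj surj_f_inv_f map_idI)
    moreover have "map (inv_into UNIV \<phi>) (map \<phi> zs) = zs" for zs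
      using assms by (simp add: bij_is_inj map_idI)
    ultimately show ?thesis
      unfolding eq by metis
  qed
  then have sets: "{\<pi>. \<pi> permutes {..<length xs} \<and> map (inv_into UNIV \<phi>) ys = permute_list \<pi> xs} =
      {\<pi>. \<pi> permutes {..<length (map \<phi> xs)} \<and> ys = permute_list \<pi> (map \<phi> xs)}"
    by auto
  show "chain_map \<phi> (oriented_simplex xs) ys = oriented_simplex (map \<phi> xs) ys"
    unfolding chain_map_def oriented_simplex_def sets ..
qed

lemma oriented_simplex_move_to_front:
  assumes "distinct xs" "i < length xs"
  shows "oriented_simplex xs (xs ! i # take i xs @ drop (Suc i) xs) = (-1) ^ i"
proof -
  define r :: "nat \<Rightarrow> nat \<Rightarrow> nat"
    where "r i = (\<lambda>j. if j = 0 then i else if j \<le> i then j - 1 else j)" for i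
  have r_Suc: "r (Suc i) = transpose i (Suc i) \<circ> r i" for i
    by (auto simp: r_def fun_eq_iff transpose_def)
  have r: "r i permutes {..i} \<and> sign (r i) = (-1) ^ i" for i
  proof (induction i)
    case 0
    have "r 0 = id"
      by (auto simp: r_def fun_eq_iff)
    then show ?case
      using permutes_id[of "{..0}"] by (metis power_0 sign_id)
  next
    case (Suc i)
    then have "r i permutes {..Suc i}"
      using permutes_subset by force
    moreover have "transpose i (Suc i) permutes {..Suc i}"
      by (rule permutes_swap_id) auto
    ultimately have "r (Suc i) permutes {..Suc i}"
      unfolding r_Suc by (rule permutes_compose)
    moreover have "sign (r (Suc i)) = sign (transpose i (Suc i)) * sign (r i)"
      unfolding r_Suc
      by (intro sign_compose permutation_swap_id permutes_imp_permutation[OF finite_atMost])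
        (use Suc in blast)
    ultimately show ?case
      using Suc by (simp add: sign_swap_id)
  qed
  have perm: "r i permutes {..<length xs}"
    by (rule permutes_subset[of _ "{..i}"]) (use r[of i] assms(2) in auto)
  have "xs ! i # take i xs @ drop (Suc i) xs = permute_list (r i) xs"
    using assms(2) perm
    by (intro nth_equalityI) (auto simp: permute_list_nth r_def nth_Cons' nth_append min_def)
  then show ?thesis
    using oriented_simplex_permute[OF assms(1) perm] r[of i] by simp
qed

lemma oriented_simplex_permute_tail:
  assumes "distinct xs" "\<tau> permutes {..<length zs}"
  shows "oriented_simplex xs (v # permute_list \<tau> zs) = of_int (sign \<tau>) * oriented_simplex xs (v # zs)"
proof -
  define t where "t = map_permutation {..<length zs} Suc \<tau>"
  have t: "t permutes Suc ` {..<length zs}"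
    unfolding t_def using assms(2) by (intro map_permutation_permutes) (auto simp: bij_betw_def)
  then have t': "t permutes {..<length (v # zs)}"
    by (rule permutes_subset) auto
  have "t 0 = 0"
    using t by (rule permutes_not_in) auto
  moreover have "t (Suc j) = Suc (\<tau> j)" if "j < length zs" for j
    unfolding t_def using that by (subst map_permutation_apply) auto
  ultimately have "v # permute_list \<tau> zs = permute_list t (v # zs)"
    using assms(2) t'
    by (intro nth_equalityI) (auto simp: permute_list_nth nth_Cons split: nat.splits)
  moreover have "sign t = sign \<tau>"
    unfolding t_def using assms(2) by (intro sign_map_permutation) auto
  ultimately show ?thesis
    using oriented_simplex_alternating[OF assms(1) t'] by simp
qed

lemma boundary_oriented_simplex:
  assumes "distinct xs"
  shows "boundary (oriented_simplex xs) =
    (\<lambda>ys. \<Sum>i<length xs. (-1) ^ i * oriented_simplex (take i xs @ drop (Suc i) xs) ys)"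
proof
  fix ys
  have "boundary (oriented_simplex xs) ys = (\<Sum>v\<in>set xs. oriented_simplex xs (v # ys))"
    unfolding boundary_def
  proof (rule sum.mono_neutral_left)
    show "{v. oriented_simplex xs (v # ys) \<noteq> 0} \<subseteq> set xs"
      using oriented_simplex_eq_0[of "_ # ys" xs]
      by (metis (mono_tags, lifting) list.set_intros(1) mem_Collect_eq mset_eq_setD subsetI)
  qed auto
  also have "\<dots> = (\<Sum>i<length xs. oriented_simplex xs (xs ! i # ys))"
    using bij_betw_nth[OF assms, of "{..<length xs}" "set xs"]
    by (intro sum.reindex_bij_betw[symmetric]) auto
  also have "\<dots> = (\<Sum>i<length xs. (-1) ^ i * oriented_simplex (take i xs @ drop (Suc i) xs) ys)"
  proof (rule sum.cong[OF refl])
    fix i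
    assume "i \<in> {..<length xs}"
    then have i: "i < length xs"
      by simp
    let ?zs = "take i xs @ drop (Suc i) xs"
    have xs: "mset xs = mset (xs ! i # ?zs)"
      using id_take_nth_drop[OF i] by (metis mset.simps(2) mset_append union_mset_add_mset_right)
    then have dist: "distinct ?zs"
      using assms by (metis distinct.simps(2) mset_eq_imp_distinct_iff)
    show "oriented_simplex xs (xs ! i # ys) = (-1) ^ i * oriented_simplex ?zs ys"
    proof (cases "mset ys = mset ?zs")
      case True
      then obtain \<tau> where \<tau>: "\<tau> permutes {..<length ?zs}" "permute_list \<tau> ?zs = ys"
        by (rule mset_eq_permutation)
      show ?thesis
        using oriented_simplex_permute_tail[OF assms \<tau>(1), of "xs ! i"] \<tau>(2)
          oriented_simplex_move_to_front[OF assms i] oriented_simplex_permute[OF dist \<tau>(1)]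
        by simp
    next
      case False
      then have "mset (xs ! i # ys) \<noteq> mset xs"
        unfolding xs by simp
      then show ?thesis
        using False by (simp add: oriented_simplex_eq_0)
    qed
  qed
  finally show "boundary (oriented_simplex xs) ys =
    (\<Sum>i<length xs. (-1) ^ i * oriented_simplex (take i xs @ drop (Suc i) xs) ys)" .
qed


section \<open>The dual of the cycle matroid of a complete graph\<close>

text \<open>
  A matroid is represented by its ground set and its family of independent sets; the latter is also
  its independence complex.
\<close>

definition complete_graph_edges :: "nat \<Rightarrow> nat set set" where
  "complete_graph_edges m = {e. e \<subseteq> {1..m} \<and> card e = 2}"

definition cycle_edges :: "'v list \<Rightarrow> 'v set set" where
  "cycle_edges vs = {{vs ! i, vs ! (Suc i mod length vs)} | i. i < length vs}"

definition cycle_matroid_indep :: "'v set set \<Rightarrow> 'v set set set" where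
  "cycle_matroid_indep E =
     {A. A \<subseteq> E \<and> (\<nexists>vs. 3 \<le> length vs \<and> distinct vs \<and> cycle_edges vs \<subseteq> A)}"

definition matroid_bases :: "'e set set \<Rightarrow> 'e set set" where
  "matroid_bases I = {B \<in> I. \<forall>B'\<in>I. B \<subseteq> B' \<longrightarrow> B' = B}"

definition dual_matroid_indep :: "'e set \<Rightarrow> 'e set set \<Rightarrow> 'e set set" where
  "dual_matroid_indep E I = {A. \<exists>B\<in>matroid_bases I. A \<subseteq> E - B}"

definition IN_dual_complete :: "nat \<Rightarrow> nat set set set" where
  "IN_dual_complete m =
     dual_matroid_indep (complete_graph_edges m) (cycle_matroid_indep (complete_graph_edges m))"

definition edge_action :: "(nat \<Rightarrow> nat) \<Rightarrow> nat set \<Rightarrow> nat set" where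
  "edge_action g e = g ` e"

definition edge_sgn :: "nat \<Rightarrow> (nat \<Rightarrow> nat) \<Rightarrow> complex" where
  "edge_sgn m g = of_int (sign_on (complete_graph_edges m) (edge_action g))"


section \<open>The partition lattice\<close>

definition partition_lattice :: "nat \<Rightarrow> nat set set set" where
  "partition_lattice m = {P. partition_on {1..m} P}"

definition partition_bot :: "nat \<Rightarrow> nat set set" where
  "partition_bot m = (\<lambda>x. {x}) ` {1..m}"

definition partition_top :: "nat \<Rightarrow> nat set set" where
  "partition_top m = {{1..m}}"

lemma partition_bot_least:
  "partition_bot m \<in> partition_lattice m"
  "P \<in> partition_lattice m \<Longrightarrow> refines {1..m} (partition_bot m) P"
proof -
  show bot: "partition_bot m \<in> partition_lattice m"
    by (auto simp: partition_lattice_def partition_bot_def partition_on_def disjoint_def)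
  show "refines {1..m} (partition_bot m) P" if "P \<in> partition_lattice m"
    using bot that
    by (fastforce simp: refines_def partition_lattice_def partition_bot_def partition_on_def)
qed

lemma partition_top_greatest:
  assumes "m \<ge> 1"
  shows "partition_top m \<in> partition_lattice m"
    and "P \<in> partition_lattice m \<Longrightarrow> refines {1..m} P (partition_top m)"
  using assms
  by (auto simp: refines_def partition_lattice_def partition_top_def partition_on_def)

definition order_complex :: "'a set \<Rightarrow> ('a \<Rightarrow> 'a \<Rightarrow> bool) \<Rightarrow> 'a set set" where
  "order_complex X R = {C. finite C \<and> C \<subseteq> X \<and> (\<forall>x\<in>C. \<forall>y\<in>C. R x y \<or> R y x)}"

definition partition_complex :: "nat \<Rightarrow> nat set set set set" where
  "partition_complex m =
     order_complex (partition_lattice m - {partition_bot m, partition_top m}) (refines {1..m})"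

definition partition_action :: "(nat \<Rightarrow> nat) \<Rightarrow> nat set set \<Rightarrow> nat set set" where
  "partition_action g P = (\<lambda>B. g ` B) ` P"

end

theory Submission
  imports
    Defs
    "HOL-Combinatorics.Multiset_Permutations"
    "HOL-Library.Function_Algebras"
    "HOL-Library.Transitive_Closure_Table"
begin

text \<open>
  Let \<open>E\<close> be the edge set of \<open>K\<^sub>m\<close>, and write \<open>IN\<close> for the independence complex of the dual matroid.
  An edge set is in \<open>IN\<close> exactly if its complement is connected, so the combinatorial Alexander dual
  \<open>N\<close> of \<open>IN\<close> (the sets whose complement is not in \<open>IN\<close>) consists of the disconnected edge sets.  The
  isomorphism is the composition of an Alexander duality between \<open>IN\<close> and \<open>N\<close>, which produces the
  sign, with a homology equivalence between \<open>N\<close> and the order complex of the partition lattice.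

  \<^emph>\<open>Alexander duality.\<close>  Complementation, signed by the orientation of \<open>E\<close>, is a star operator that
  maps the chains of \<open>IN\<close> to the chains of the full simplex on \<open>E\<close> whose support avoids \<open>N\<close>.  It
  exchanges boundary and coboundary (\<open>boundary_star\<close>), and a permutation of the edges commutes with it
  up to the sign of that permutation (\<open>star_push\<close>).  By itself this identifies homology of \<open>IN\<close> with
  relative cohomology of the pair of the simplex and \<open>N\<close>.  Over the complex numbers cohomology can be
  replaced by homology without losing equivariance: by orthogonal projection every homology class has
  a unique harmonic representative, a cycle \<open>h\<close> orthogonal to all boundaries, and the star operator
  preserves harmonicity.  Hence the star of \<open>h\<close> is a relative cycle, and since the full simplex is
  acyclic, sending \<open>h\<close> to the boundary of its star, a cycle of \<open>N\<close>, is an isomorphism on homology.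

  \<^emph>\<open>From edge sets to partitions.\<close>  For \<open>m \<ge> 2\<close>, both \<open>N\<close> and the order complex embed into the complex \<open>J\<close> of all
  unions \<open>A \<union> C\<close> of a disconnected edge set \<open>A\<close> and a chain \<open>C\<close> of proper partitions such that every
  edge of \<open>A\<close> lies inside a block of each member of \<open>C\<close>.  If \<open>C\<close> is nonempty, an edge inside a block
  of its least member can be inserted into or removed from \<open>A\<close> freely; if \<open>A\<close> is nonempty, the
  partition of the vertices into the components of \<open>A\<close> can be inserted into or removed from \<open>C\<close>
  freely.  So \<open>J\<close> is acyclic relative to each of the two subcomplexes (\<open>relative_acyclic\<close>).

  The two steps together define an equivariant linear relation: a cycle of \<open>IN\<close> is related to a cycle
  of the order complex if the cycle of \<open>N\<close> obtained from the harmonic representative of the former is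
  homologous in \<open>J\<close> to the latter.  In \<open>homology_duality\<close> this relation is shown to induce a
  bijection between homology classes.
\<close>

section \<open>Alternating functions on lists\<close>

definition alternating :: "('a list \<Rightarrow> complex) \<Rightarrow> bool" where
  "alternating c \<longleftrightarrow>
     (\<forall>xs \<pi>. \<pi> permutes {..<length xs} \<longrightarrow> c (permute_list \<pi> xs) = of_int (sign \<pi>) * c xs)"

lemma alternatingD:
  assumes "alternating c" "\<pi> permutes {..<length xs}"
  shows "c (permute_list \<pi> xs) = of_int (sign \<pi>) * c xs"
  using assms by (simp add: alternating_def)

lemma alternating_oriented_simplex: "distinct xs \<Longrightarrow> alternating (oriented_simplex xs)"
  unfolding alternating_def using oriented_simplex_alternating by blast

lemma alternating_Cons:
  assumes "alternating c"
  shows "alternating (\<lambda>xs. c (v # xs))"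
  unfolding alternating_def
proof (intro allI impI)
  fix zs :: "'a list" and \<tau>
  assume \<tau>: "\<tau> permutes {..<length zs}"
  define t where "t = map_permutation {..<length zs} Suc \<tau>"
  have t: "t permutes Suc ` {..<length zs}"
    unfolding t_def using \<tau> by (intro map_permutation_permutes) (auto simp: bij_betw_def)
  then have t': "t permutes {..<length (v # zs)}"
    by (rule permutes_subset) auto
  have "t 0 = 0"
    using t by (rule permutes_not_in) auto
  moreover have "t (Suc j) = Suc (\<tau> j)" if "j < length zs" for j
    unfolding t_def using that by (subst map_permutation_apply) auto
  ultimately have "v # permute_list \<tau> zs = permute_list t (v # zs)"
    using \<tau> t' by (intro nth_equalityI) (auto simp: permute_list_nth nth_Cons split: nat.splits)
  moreover have "sign t = sign \<tau>"
    unfolding t_def using \<tau> by (intro sign_map_permutation) auto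
  ultimately show "c (v # permute_list \<tau> zs) = of_int (sign \<tau>) * c (v # zs)"
    using alternatingD[OF assms t'] by simp
qed

lemma alternating_append:
  assumes "alternating c"
  shows "alternating (\<lambda>ys. c (xs @ ys))"
  using assms
proof (induction xs arbitrary: c)
  case (Cons x xs)
  then show ?case
    using Cons.IH[OF alternating_Cons[OF Cons.prems, of x]] by simp
qed simp

lemma alternating_swap:
  assumes "alternating c"
  shows "c (x # y # zs) = - c (y # x # zs)"
proof -
  let ?t = "transpose 0 (1::nat)"
  have t: "?t permutes {..<length (y # x # zs)}"
    by (rule permutes_swap_id) auto
  have "permute_list ?t (y # x # zs) = x # y # zs"
    using t by (intro nth_equalityI)
      (auto simp: permute_list_nth nth_Cons transpose_def split: nat.splits)
  then show ?thesis
    using alternatingD[OF assms t] by (simp add: sign_swap_id)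
qed

lemma alternating_move_to_front:
  assumes "alternating c"
  shows "c (xs @ v # ys) = (- 1) ^ length xs * c (v # xs @ ys)"
  using assms
proof (induction xs arbitrary: c)
  case (Cons x xs)
  have "c (x # xs @ v # ys) = (- 1) ^ length xs * c (x # v # xs @ ys)"
    using Cons.IH[OF alternating_Cons[OF Cons.prems, of x]] by simp
  then show ?case
    using alternating_swap[OF Cons.prems, of x v] by simp
qed simp

text \<open>
  Moving two equal entries next to each other and exchanging them shows that the value equals its own
  negative.
\<close>

lemma alternating_imp_distinct:
  assumes "alternating c" "c xs \<noteq> 0"
  shows "distinct xs"
proof (rule ccontr)
  assume "\<not> distinct xs"
  then obtain as bs cs y where xs: "xs = as @ [y] @ bs @ [y] @ cs"
    using not_distinct_decomp by blast
  have "c (as @ y # y # bs @ cs) = 0"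
    using alternating_swap[OF alternating_append[OF assms(1), of as], of y y "bs @ cs"] by simp
  then have "c (y # as @ y # bs @ cs) = 0"
    using alternating_move_to_front[OF assms(1), of as y "y # bs @ cs"] by simp
  then have "c xs = 0"
    using alternating_move_to_front[OF assms(1), of as y "bs @ y # cs"]
      alternating_move_to_front[OF alternating_append[OF alternating_Cons[OF assms(1), of y], of as],
        of bs y cs]
    unfolding xs by simp
  then show False
    using assms(2) by simp
qed

text \<open>
  Up to reordering, an alternating function is determined by one ordering of each vertex set.  This
  reduces most identities between chains to one conveniently chosen ordering.
\<close>

lemma alternating_eq_oriented_simplex:
  assumes "alternating c" "distinct xs" "mset ys = mset xs"
  shows "c ys = oriented_simplex xs ys * c xs"
proof -
  obtain \<pi> where "\<pi> permutes {..<length xs}" "permute_list \<pi> xs = ys"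
    using assms(3) by (rule mset_eq_permutation)
  then show ?thesis
    using alternatingD[OF assms(1)] oriented_simplex_permute[OF assms(2)] by metis
qed

lemma oriented_simplex_self [simp]: "distinct xs \<Longrightarrow> oriented_simplex xs xs = 1"
  using oriented_simplex_permute[of xs id] permutes_id by (metis of_int_1 permute_list_id sign_id)

lemma alternating_eqI_mset:
  assumes "alternating c" "alternating c'" "mset ys = mset xs" "c xs = c' xs"
  shows "c ys = c' ys"
proof -
  obtain \<pi> where \<pi>: "\<pi> permutes {..<length xs}" "permute_list \<pi> xs = ys"
    using assms(3) by (rule mset_eq_permutation)
  then show ?thesis
    using alternatingD[OF assms(1) \<pi>(1)] alternatingD[OF assms(2) \<pi>(1)] assms(4) by simp
qed

lemma alternating_0 [simp]: "alternating 0"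
  by (simp add: alternating_def)

lemma alternating_add: "alternating c \<Longrightarrow> alternating c' \<Longrightarrow> alternating (c + c')"
  by (simp add: alternating_def algebra_simps)

lemma alternating_diff: "alternating c \<Longrightarrow> alternating c' \<Longrightarrow> alternating (c - c')"
  by (simp add: alternating_def algebra_simps)

definition scale :: "complex \<Rightarrow> ('a \<Rightarrow> complex) \<Rightarrow> 'a \<Rightarrow> complex" where
  "scale a c = (\<lambda>x. a * c x)"

lemma scale_apply [simp]: "scale a c x = a * c x"
  by (simp add: scale_def)

lemma scale_scale [simp]: "scale a (scale b c) = scale (a * b) c"
  by (simp add: scale_def mult.assoc)

lemma scale_one [simp]: "scale 1 c = c"
  by (simp add: scale_def)

lemma scale_zero_right [simp]: "scale a 0 = 0"
  by (simp add: fun_eq_iff)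

lemma scale_diff_right: "scale a (c - c') = scale a c - scale a c'"
  by (simp add: fun_eq_iff algebra_simps)

lemma alternating_scale: "alternating c \<Longrightarrow> alternating (scale a c)"
  by (simp add: alternating_def algebra_simps)


section \<open>Chains of a finite simplicial complex\<close>

text \<open>
  Constructions that depend only on the set of vertices of a simplex use this ordering.
\<close>

definition enum :: "'a set \<Rightarrow> 'a list" where
  "enum S = (SOME xs. distinct xs \<and> set xs = S)"

lemma enum:
  assumes "finite S"
  shows distinct_enum: "distinct (enum S)" and set_enum: "set (enum S) = S"
proof -
  have "\<exists>xs. distinct xs \<and> set xs = S"
    using finite_distinct_list[OF assms] by blast
  then have "distinct (enum S) \<and> set (enum S) = S"
    unfolding enum_def by (rule someI_ex)
  then show "distinct (enum S)" "set (enum S) = S"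
    by auto
qed

lemma length_enum: "finite S \<Longrightarrow> length (enum S) = card S"
  using distinct_card[OF distinct_enum] set_enum by metis

lemma mset_enum: "distinct xs \<Longrightarrow> mset (enum (set xs)) = mset xs"
  using distinct_enum[of "set xs"] set_enum[of "set xs"] by (simp add: set_eq_iff_mset_eq_distinct)

locale finite_complex =
  fixes V :: "'a set" and K :: "'a set set"
  assumes finite_V: "finite V"
    and face_subset: "S \<in> K \<Longrightarrow> S \<subseteq> V"
    and face_down: "S \<in> K \<Longrightarrow> T \<subseteq> S \<Longrightarrow> T \<in> K"
begin

lemma finite_K: "finite K"
  using finite_V face_subset by (meson PowI finite_Pow_iff finite_subset subsetI)

lemma chains_iff:
  "c \<in> oriented_chains K d \<longleftrightarrow>
     alternating c \<and> (\<forall>xs. c xs \<noteq> 0 \<longrightarrow> set xs \<in> K \<and> int (length xs) = d + 1)"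
proof
  assume c: "alternating c \<and> (\<forall>xs. c xs \<noteq> 0 \<longrightarrow> set xs \<in> K \<and> int (length xs) = d + 1)"
  have "{xs. c xs \<noteq> 0} \<subseteq> {xs. set xs \<subseteq> V \<and> length xs = nat (d + 1)}"
    using c face_subset by fastforce
  then have "finite {xs. c xs \<noteq> 0}"
    by (rule finite_subset) (rule finite_lists_length_eq[OF finite_V])
  then show "c \<in> oriented_chains K d"
    using c alternating_imp_distinct[of c] by (auto simp: oriented_chains_def alternating_def)
qed (auto simp: oriented_chains_def alternating_def)

lemma chain_alternating: "c \<in> oriented_chains K d \<Longrightarrow> alternating c"
  by (simp add: chains_iff)

lemma chain_support: "c \<in> oriented_chains K d \<Longrightarrow> c xs \<noteq> 0 \<Longrightarrow> set xs \<in> K \<and> int (length xs) = d + 1"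
  by (simp add: chains_iff)

lemma chain_0: "0 \<in> oriented_chains K d"
  by (simp add: chains_iff)

lemma chain_add: "c \<in> oriented_chains K d \<Longrightarrow> c' \<in> oriented_chains K d \<Longrightarrow> c + c' \<in> oriented_chains K d"
  by (auto simp: chains_iff alternating_add) (metis add_0)+

lemma chain_diff: "c \<in> oriented_chains K d \<Longrightarrow> c' \<in> oriented_chains K d \<Longrightarrow> c - c' \<in> oriented_chains K d"
  by (auto simp: chains_iff alternating_diff) (metis diff_0_right)+

lemma chain_scale: "c \<in> oriented_chains K d \<Longrightarrow> scale a c \<in> oriented_chains K d"
  by (auto simp: chains_iff alternating_scale)

lemma boundary_sum:
  assumes "c \<in> oriented_chains K d"
  shows "boundary c ys = (\<Sum>v\<in>V. c (v # ys))"
  unfolding boundary_def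
proof (rule sum.mono_neutral_left)
  show "{v. c (v # ys) \<noteq> 0} \<subseteq> V"
    using chain_support[OF assms] face_subset by fastforce
qed (use finite_V in auto)

lemma boundary_add:
  "c \<in> oriented_chains K d \<Longrightarrow> c' \<in> oriented_chains K d \<Longrightarrow> boundary (c + c') = boundary c + boundary c'"
  by (simp add: fun_eq_iff boundary_sum[of c d] boundary_sum[of c' d] boundary_sum[OF chain_add] sum.distrib)

lemma boundary_diff:
  "c \<in> oriented_chains K d \<Longrightarrow> c' \<in> oriented_chains K d \<Longrightarrow> boundary (c - c') = boundary c - boundary c'"
  by (simp add: fun_eq_iff boundary_sum[of c d] boundary_sum[of c' d] boundary_sum[OF chain_diff] sum_subtractf)

lemma boundary_scale:
  "c \<in> oriented_chains K d \<Longrightarrow> boundary (scale a c) = scale a (boundary c)"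
  by (simp add: fun_eq_iff boundary_sum[of c d] boundary_sum[OF chain_scale] sum_distrib_left)

lemma boundary_chain:
  assumes c: "c \<in> oriented_chains K d"
  shows "boundary c \<in> oriented_chains K (d - 1)"
  unfolding chains_iff
proof
  have "c (v # permute_list \<pi> xs) = of_int (sign \<pi>) * c (v # xs)" if "\<pi> permutes {..<length xs}" for v \<pi> xs
    using alternatingD[OF alternating_Cons[OF chain_alternating[OF c]] that] .
  then show "alternating (boundary c)"
    by (simp add: alternating_def boundary_sum[OF c] sum_distrib_left)
  show "\<forall>xs. boundary c xs \<noteq> 0 \<longrightarrow> set xs \<in> K \<and> int (length xs) = d - 1 + 1"
  proof (intro allI impI)
    fix xs
    assume "boundary c xs \<noteq> 0"
    then obtain v where "c (v # xs) \<noteq> 0"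
      by (metis boundary_sum[OF c] sum.neutral)
    then have "insert v (set xs) \<in> K" "int (length xs) = d"
      using chain_support[OF c] by fastforce+
    then show "set xs \<in> K \<and> int (length xs) = d - 1 + 1"
      using face_down by auto
  qed
qed

lemma boundary_boundary:
  assumes c: "c \<in> oriented_chains K d"
  shows "boundary (boundary c) = 0"
proof
  fix ys
  have swap: "c (v # w # ys) = - c (w # v # ys)" for v w
    using alternating_swap[OF chain_alternating[OF c]] .
  have "boundary (boundary c) ys = (\<Sum>v\<in>V. \<Sum>w\<in>V. c (w # v # ys))"
    by (simp add: boundary_sum[OF boundary_chain[OF c]] boundary_sum[OF c])
  also have "\<dots> = (\<Sum>w\<in>V. \<Sum>v\<in>V. c (w # v # ys))"
    by (rule sum.swap)
  also have "\<dots> = - (\<Sum>w\<in>V. \<Sum>v\<in>V. c (v # w # ys))"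
    unfolding sum_negf[symmetric] by (intro sum.cong refl) (rule swap)
  also have "\<dots> = - boundary (boundary c) ys"
    by (simp add: boundary_sum[OF boundary_chain[OF c]] boundary_sum[OF c])
  finally show "boundary (boundary c) ys = 0 ys"
    by simp
qed

end

lemma oriented_chains_mono: "L \<subseteq> K \<Longrightarrow> c \<in> oriented_chains L d \<Longrightarrow> c \<in> oriented_chains K d"
  by (auto simp: oriented_chains_def)

lemma boundary_0 [simp]: "boundary 0 = 0"
  by (simp add: boundary_def fun_eq_iff)


section \<open>Relative acyclicity by toggling a vertex\<close>

text \<open>
  A criterion for the inclusion of a subcomplex to induce isomorphisms on homology, in the spirit of
  discrete Morse theory: outside \<open>L\<close>, faces are paired by inserting or removing the vertex \<open>p S\<close>.  On the
  faces of the largest rank \<open>k\<close> that a relative cycle \<open>c\<close> meets, taking the cone of \<open>c\<close> with apex \<open>p S\<close>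
  gives a chain whose boundary is \<open>c\<close> up to faces of smaller rank, because any other vertex whose
  removal keeps the rank also keeps the apex.  Subtracting this boundary lowers the rank until only
  faces in \<open>L\<close> remain.
\<close>

lemma (in finite_complex) relative_acyclic:
  fixes L :: "'a set set" and r :: "'a set \<Rightarrow> nat" and p :: "'a set \<Rightarrow> 'a"
  assumes L: "finite_complex V L" "L \<subseteq> K"
    and insert_p: "\<And>S. S \<in> K - L \<Longrightarrow> insert (p S) S \<in> K"
    and p_insert: "\<And>S. S \<in> K - L \<Longrightarrow> p (insert (p S) S) = p S \<and> r (insert (p S) S) = r S"
    and p_remove: "\<And>S. S \<in> K - L \<Longrightarrow> S - {p S} \<notin> L \<and> p (S - {p S}) = p S \<and> r (S - {p S}) = r S"
    and remove: "\<And>S v. S \<in> K - L \<Longrightarrow> v \<in> S \<Longrightarrow> S - {v} \<notin> L \<Longrightarrow>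
       r (S - {v}) < r S \<or> r (S - {v}) = r S \<and> p (S - {v}) = p S"
    and c: "c \<in> oriented_chains K d" "boundary c \<in> oriented_chains L (d - 1)"
  shows "\<exists>u\<in>oriented_chains K (d + 1). c - boundary u \<in> oriented_chains L d"
proof -
  interpret L: finite_complex V L
    by fact
  have step: "\<exists>u\<in>oriented_chains K (d + 1). c - boundary u \<in> oriented_chains L d"
    if "c \<in> oriented_chains K d" "boundary c \<in> oriented_chains L (d - 1)"
      "\<And>xs. c xs \<noteq> 0 \<Longrightarrow> set xs \<in> L \<or> r (set xs) < k" for k c
    using that
  proof (induction k arbitrary: c)
    case 0
    then have "c - boundary 0 \<in> oriented_chains L d"
      by (simp add: chains_iff L.chains_iff)
    then show ?case
      using chain_0 by blast
  next
    case (Suc k)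
    note c = Suc.prems(1) and bc = Suc.prems(2) and rc = Suc.prems(3)
    have ac: "alternating c"
      using chain_alternating[OF c] .
    define good where "good S \<longleftrightarrow> S \<in> K - L \<and> r S = k \<and> p S \<in> S" for S
    \<comment> \<open>The cone over the part of \<open>c\<close> of rank \<open>k\<close>, as an alternating function: the coefficient of the
      simplex with apex moved to the front is that of \<open>c\<close> at the remaining vertices.\<close>
    define u where "u xs = (if good (set xs) then
        oriented_simplex (p (set xs) # enum (set xs - {p (set xs)})) xs * c (enum (set xs - {p (set xs)}))
        else 0)" for xs
    have dl: "distinct (p (set xs) # enum (set xs - {p (set xs)}))" for xs
      using enum[of "set xs - {p (set xs)}"] by simp
    have au: "alternating u"
      using oriented_simplex_alternating[OF dl] by (simp add: alternating_def u_def)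
    have u_Cons: "u (v # ys) = c ys" if "good (insert v (set ys))" "p (insert v (set ys)) = v" "v \<notin> set ys" for v ys
    proof (cases "distinct ys")
      case True
      let ?l = "enum (set ys)"
      have "u (v # ys) = oriented_simplex (v # ?l) (v # ys) * c ?l"
        using that by (simp add: u_def)
      also have "\<dots> = c ys"
        using alternating_eq_oriented_simplex[OF alternating_oriented_simplex[of "v # ys"], of "v # ?l"]
          alternating_eq_oriented_simplex[OF alternating_Cons[OF alternating_oriented_simplex[of "v # ?l"]], of ?l ys v]
          alternating_eq_oriented_simplex[OF ac, of ?l ys]
          mset_enum[OF True] enum[of "set ys"] that(3) True
        by simp
      finally show ?thesis .
    next
      case False
      then have "c ys = 0" "u (v # ys) = 0"
        using alternating_imp_distinct[OF ac, of ys] alternating_imp_distinct[OF au, of "v # ys"] by auto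
      then show ?thesis
        by simp
    qed
    have u: "u \<in> oriented_chains K (d + 1)"
      unfolding chains_iff
    proof (intro conjI au allI impI)
      fix xs
      assume nz: "u xs \<noteq> 0"
      then have good: "good (set xs)"
        by (simp add: u_def split: if_splits)
      then show "set xs \<in> K"
        by (simp add: good_def)
      let ?l = "enum (set xs - {p (set xs)})"
      have "mset xs = mset (p (set xs) # ?l)" "c ?l \<noteq> 0"
        using nz oriented_simplex_eq_0 by (force simp: u_def split: if_splits)+
      then show "int (length xs) = d + 1 + 1"
        using chain_support[OF c] by (metis add.commute length_Cons mset_eq_length of_nat_Suc)
    qed
    define c' where "c' = c - boundary u"
    have bu: "boundary u \<in> oriented_chains K d"
      using boundary_chain[OF u] by simp
    have c': "c' \<in> oriented_chains K d"
      unfolding c'_def by (rule chain_diff[OF c bu])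
    have bc': "boundary c' \<in> oriented_chains L (d - 1)"
      unfolding c'_def using bc by (simp add: boundary_diff[OF c bu] boundary_boundary[OF u])
    have rc': "set ys \<in> L \<or> r (set ys) < k" if nz: "c' ys \<noteq> 0" for ys
    proof (rule ccontr)
      assume "\<not> ?thesis"
      then have ys: "set ys \<in> K - L" "k \<le> r (set ys)"
        using chain_support[OF c' nz] by auto
      have dys: "distinct ys"
        using alternating_imp_distinct[OF chain_alternating[OF c'] nz] .
      have good_ins: "r (set ys) = k \<and> p (insert v (set ys)) = p (set ys)"
        if "good (insert v (set ys))" "v \<notin> set ys" for v
        using remove[of "insert v (set ys)" v] that ys unfolding good_def by auto
      have u0: "u (v # ys) = 0" if "\<not> good (insert v (set ys)) \<or> v \<in> set ys" for v
      proof (cases "v \<in> set ys")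
        case True
        then show ?thesis
          using alternating_imp_distinct[OF au, of "v # ys"] by force
      next
        case False
        then show ?thesis
          using that by (simp add: u_def)
      qed
      consider "r (set ys) > k" | "r (set ys) = k" "p (set ys) \<notin> set ys" | "r (set ys) = k" "p (set ys) \<in> set ys"
        using ys(2) by linarith
      then have "boundary u ys = c ys"
      proof cases
        case 1
        then have "c ys = 0"
          using rc[of ys] ys by auto
        moreover have "u (v # ys) = 0" for v
          using good_ins[of v] u0[of v] 1 by (cases "good (insert v (set ys)) \<and> v \<notin> set ys") auto
        ultimately show ?thesis
          by (simp add: boundary_sum[OF u])
      next
        case 2
        let ?p = "p (set ys)"
        have good: "good (insert ?p (set ys))"
          using insert_p[OF ys(1)] p_insert[OF ys(1)] L.face_down[of _ "set ys"] ys 2 by (auto simp: good_def)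
        have pV: "?p \<in> V"
          using face_subset[OF insert_p[OF ys(1)]] by auto
        have "u (v # ys) = 0" if "v \<noteq> ?p" for v
        proof (rule ccontr)
          assume "u (v # ys) \<noteq> 0"
          then have g: "good (insert v (set ys))" "v \<notin> set ys"
            using u0 by auto
          then have "p (insert v (set ys)) = ?p" "p (insert v (set ys)) \<in> insert v (set ys)"
            using good_ins by (auto simp: good_def)
          then show False
            using that 2 by auto
        qed
        then have "boundary u ys = (\<Sum>v\<in>{?p}. u (v # ys))"
          unfolding boundary_sum[OF u] using pV finite_V by (intro sum.mono_neutral_right) auto
        also have "\<dots> = c ys"
          using u_Cons[OF good] p_insert[OF ys(1)] 2 by simp
        finally show ?thesis .
      next
        case 3
        let ?p = "p (set ys)"
        define zs where "zs = enum (set ys - {?p})"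
        have zs: "distinct zs" "set zs = set ys - {?p}"
          using enum[of "set ys - {?p}"] by (auto simp: zs_def)
        have pV: "?p \<in> V"
          using face_subset[of "set ys"] ys 3 by auto
        have Lzs: "set zs \<notin> L" "p (set zs) = ?p" "r (set zs) = k"
          using p_remove[OF ys(1)] 3 zs by auto
        have Kzs: "set zs \<in> K"
          using face_down[of "set ys" "set zs"] ys zs by auto
        \<comment> \<open>After removing the apex, the cycle condition at \<open>zs\<close> expresses \<open>c (?p # zs)\<close> by the other cofaces.\<close>
        have eq: "u (?p # v # zs) = c (v # zs)" if v: "v \<noteq> ?p" for v
        proof (cases "good (insert v (set ys)) \<and> v \<notin> set ys")
          case True
          then have "p (insert v (set ys)) = ?p"
            using good_ins by blast
          moreover have "insert ?p (set (v # zs)) = insert v (set ys)"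
            using zs 3 by auto
          ultimately show ?thesis
            using u_Cons[of ?p "v # zs"] True v zs by auto
        next
          case False
          have "c (v # zs) = 0"
          proof (rule ccontr)
            assume nz: "c (v # zs) \<noteq> 0"
            have S: "set (v # zs) \<in> K" and dv: "distinct (v # zs)"
              using chain_support[OF c nz] alternating_imp_distinct[OF ac nz] by auto
            then have SL: "set (v # zs) \<in> K - L"
              using L.face_down[of _ "set zs"] Lzs by auto
            then have rS: "r (set (v # zs)) \<le> k"
              using rc[OF nz] by auto
            have rm: "set (v # zs) - {v} = set zs"
              using dv by auto
            have "r (set (v # zs)) = k \<and> p (set (v # zs)) = ?p"
              using remove[OF SL, of v] rS Lzs unfolding rm by auto
            then have "good (insert ?p (set (v # zs)))"
              using insert_p[OF SL] p_insert[OF SL] L.face_down[of _ "set (v # zs)"] SL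
              unfolding good_def by auto
            moreover have "insert ?p (set (v # zs)) = insert v (set ys)"
              using zs 3 by auto
            ultimately show False
              using False v dv zs by auto
          qed
          moreover have "u (?p # v # zs) = 0"
          proof (rule ccontr)
            assume nz: "u (?p # v # zs) \<noteq> 0"
            then have "distinct (?p # v # zs)"
              using alternating_imp_distinct[OF au] by blast
            moreover have "good (set (?p # v # zs))"
              using nz unfolding u_def by (rule contrapos_np) simp
            moreover have "set (?p # v # zs) = insert v (set ys)"
              using zs 3 by auto
            ultimately show False
              using False zs by auto
          qed
          ultimately show ?thesis
            by simp
        qed
        have "boundary u (?p # zs) = (\<Sum>v\<in>V - {?p}. u (v # ?p # zs))"
          unfolding boundary_sum[OF u]
          using finite_V alternating_imp_distinct[OF au, of "?p # ?p # zs"]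
          by (intro sum.mono_neutral_right) auto
        also have "\<dots> = - (\<Sum>v\<in>V - {?p}. c (v # zs))"
          unfolding sum_negf[symmetric]
          by (intro sum.cong refl, subst alternating_swap[OF au]) (simp add: eq)
        also have "\<dots> = c (?p # zs) - boundary c zs"
          unfolding boundary_sum[OF c] by (simp add: sum.remove[OF finite_V pV])
        also have "boundary c zs = 0"
          using L.chain_support[OF bc] Lzs by blast
        finally have "boundary u (?p # zs) = c (?p # zs)"
          by simp
        moreover have "mset ys = mset (?p # zs)"
          using dys zs 3 set_eq_iff_mset_eq_distinct[of ys "?p # zs"] by auto
        ultimately show ?thesis
          using alternating_eqI_mset[OF chain_alternating[OF bu] ac] by blast
      qed
      then show False
        using nz by (simp add: c'_def)
    qed
    obtain u' where u': "u' \<in> oriented_chains K (d + 1)" "c' - boundary u' \<in> oriented_chains L d"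
      using Suc.IH[OF c' bc' rc'] by blast
    have "c - boundary (u + u') = c' - boundary u'"
      by (simp add: boundary_add[OF u u'(1)] c'_def)
    then show ?case
      using chain_add[OF u u'(1)] u'(2) by metis
  qed
  obtain k where "\<forall>S\<in>K. r S < k"
    using finite_nat_set_iff_bounded[of "r ` K"] finite_K by auto
  then show ?thesis
    using step[OF c, of k] chain_support[OF c(1)] by blast
qed


section \<open>Orthogonal projection and relative harmonic chains\<close>

text \<open>
  Orthogonal projection for the Hermitian form that only sees the finite set \<open>F\<close>.  The subspace \<open>U\<close>
  may be infinite-dimensional, since the induction is on \<open>F\<close>: the functions in \<open>U\<close> that vanish at a
  new point \<open>a\<close> are handled by the induction hypothesis, and they have codimension at most one in \<open>U\<close>.
\<close>

lemma orthogonal_projection: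
  fixes U :: "('a \<Rightarrow> complex) set"
  assumes "finite F" "0 \<in> U" "\<And>a u u'. u \<in> U \<Longrightarrow> u' \<in> U \<Longrightarrow> u + scale a u' \<in> U"
  shows "\<exists>u\<in>U. \<forall>u'\<in>U. (\<Sum>x\<in>F. (f x - u x) * cnj (u' x)) = 0"
  using assms
proof (induction F arbitrary: U f rule: finite_induct)
  case empty
  then show ?case
    by auto
next
  case (insert a F)
  note U0 = insert.prems(1) and Ucl = insert.prems(2)
  define U' where "U' = {u \<in> U. u a = 0}"
  have "0 \<in> U'"
    by (simp add: U'_def U0)
  moreover have "u + scale b u' \<in> U'" if "u \<in> U'" "u' \<in> U'" for b u u'
  proof -
    have "u + scale b u' \<in> U"
      using Ucl[of u u' b] that unfolding U'_def by blast
    moreover have "(u + scale b u') a = 0"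
      using that by (simp add: U'_def)
    ultimately show ?thesis
      unfolding U'_def by blast
  qed
  ultimately have IH: "\<exists>u\<in>U'. \<forall>u'\<in>U'. (\<Sum>x\<in>F. (f x - u x) * cnj (u' x)) = 0" for f
    by (rule insert.IH)
  have ext: "(\<Sum>x\<in>insert a F. (f x - u x) * cnj (u' x)) = (\<Sum>x\<in>F. (f x - u x) * cnj (u' x))"
    if "u' \<in> U'" for f u u'
    using that insert.hyps by (simp add: U'_def)
  obtain u0 where u0: "u0 \<in> U'" and "\<forall>u'\<in>U'. (\<Sum>x\<in>F. (f x - u0 x) * cnj (u' x)) = 0"
    using IH by blast
  then have orth0: "(\<Sum>x\<in>insert a F. (f x - u0 x) * cnj (u' x)) = 0" if "u' \<in> U'" for u'
    using that ext by simp
  show ?case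
  proof (cases "U' = U")
    case True
    then show ?thesis
      using u0 orth0 by blast
  next
    case False
    then obtain u1 where u1: "u1 \<in> U" "u1 a \<noteq> 0"
      by (auto simp: U'_def)
    obtain v where v: "v \<in> U'" and "\<forall>u'\<in>U'. (\<Sum>x\<in>F. (u1 x - v x) * cnj (u' x)) = 0"
      using IH by blast
    then have orth1: "(\<Sum>x\<in>insert a F. (u1 x - v x) * cnj (u' x)) = 0" if "u' \<in> U'" for u'
      using that ext by simp
    \<comment> \<open>A vector of \<open>U\<close> orthogonal to the hyperplane \<open>U'\<close>; it spans \<open>U\<close> together with \<open>U'\<close>.\<close>
    define e where "e = u1 + scale (-1) v"
    have e: "e \<in> U"
      unfolding e_def by (rule Ucl) (use u1 v in \<open>auto simp: U'_def\<close>)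
    have e_eq: "e x = u1 x - v x" for x
      by (simp add: e_def)
    have e_a: "e a \<noteq> 0"
      using u1 v by (simp add: e_eq U'_def)
    define q where "q = (\<Sum>x\<in>insert a F. e x * cnj (e x))"
    have "q = of_real (\<Sum>x\<in>insert a F. (cmod (e x))\<^sup>2)"
      by (simp only: q_def of_real_sum complex_norm_square)
    moreover have "(\<Sum>x\<in>insert a F. (cmod (e x))\<^sup>2) > 0"
      using insert.hyps e_a by (intro sum_pos2[of _ a]) auto
    ultimately have q: "q \<noteq> 0"
      by (metis less_irrefl of_real_eq_0_iff)
    define b where "b = (\<Sum>x\<in>insert a F. (f x - u0 x) * cnj (e x)) / q"
    define u where "u = u0 + scale b e"
    have "u \<in> U"
      unfolding u_def by (rule Ucl) (use e u0 in \<open>auto simp: U'_def\<close>)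
    moreover have "(\<Sum>x\<in>insert a F. (f x - u x) * cnj (w x)) = 0" if w: "w \<in> U" for w
    proof -
      define t where "t = w a / e a"
      define w' where "w' = w + scale (- t) e"
      have w': "w' \<in> U'"
        unfolding U'_def
      proof (intro CollectI conjI)
        show "w' \<in> U"
          unfolding w'_def by (rule Ucl[OF w e])
        show "w' a = 0"
          using e_a by (simp add: w'_def t_def)
      qed
      have w_eq: "w x = w' x + t * e x" for x
        by (simp add: w'_def)
      have "(\<Sum>x\<in>insert a F. (f x - u x) * cnj (w x)) =
          (\<Sum>x\<in>insert a F. (f x - u0 x) * cnj (w' x)) - b * (\<Sum>x\<in>insert a F. (u1 x - v x) * cnj (w' x)) +
          cnj t * ((\<Sum>x\<in>insert a F. (f x - u0 x) * cnj (e x)) - b * q)"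
        unfolding q_def sum_distrib_left sum_subtractf[symmetric] sum.distrib[symmetric]
        by (intro sum.cong refl) (simp add: u_def w_eq e_eq algebra_simps)
      also have "\<dots> = 0"
        using orth0[OF w'] orth1[OF w'] q by (simp add: b_def)
      finally show ?thesis .
    qed
    ultimately show ?thesis
      by blast
  qed
qed

text \<open>
  The coboundary of a cochain on the full simplex on all vertices; restricting it to a complex means
  evaluating it only at faces.
\<close>

definition coboundary :: "('a list \<Rightarrow> complex) \<Rightarrow> 'a list \<Rightarrow> complex" where
  "coboundary c xs = (\<Sum>j<length xs. (- 1) ^ j * c (take j xs @ drop (Suc j) xs))"

lemma cnj_oriented_simplex [simp]: "cnj (oriented_simplex xs ys) = oriented_simplex xs ys"
  by (simp add: oriented_simplex_def)

lemma oriented_simplex_square: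
  assumes "distinct xs" "mset ys = mset xs"
  shows "oriented_simplex xs ys * oriented_simplex xs ys = 1"
proof -
  obtain \<pi> where \<pi>: "\<pi> permutes {..<length xs}" "permute_list \<pi> xs = ys"
    using assms(2) by (rule mset_eq_permutation)
  have "oriented_simplex xs ys = of_int (sign \<pi>)"
    using oriented_simplex_permute[OF assms(1) \<pi>(1)] \<pi>(2) by simp
  then show ?thesis
    using sign_idempotent[of \<pi>] by (metis of_int_1 of_int_mult)
qed

text \<open>
  All orderings of a simplex contribute equally to the Hermitian form, which explains the factorial.
\<close>

lemma sum_oriented_simplex:
  assumes "finite V" "alternating w" "distinct ys" "set ys \<subseteq> V" "length ys = k"
  shows "(\<Sum>xs | set xs \<subseteq> V \<and> length xs = k. w xs * oriented_simplex ys xs) = fact k * w ys"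
proof -
  have "(\<Sum>xs | set xs \<subseteq> V \<and> length xs = k. w xs * oriented_simplex ys xs) =
      (\<Sum>xs\<in>permutations_of_set (set ys). w xs * oriented_simplex ys xs)"
  proof (rule sum.mono_neutral_right)
    show "finite {xs. set xs \<subseteq> V \<and> length xs = k}"
      using assms(1) by (rule finite_lists_length_eq)
    show "permutations_of_set (set ys) \<subseteq> {xs. set xs \<subseteq> V \<and> length xs = k}"
      using assms by (auto simp: permutations_of_set_def) (metis distinct_card)
    show "\<forall>xs\<in>{xs. set xs \<subseteq> V \<and> length xs = k} - permutations_of_set (set ys).
        w xs * oriented_simplex ys xs = 0"
      using oriented_simplex_eq_0[of _ ys] assms(3)
      by (auto simp: permutations_of_set_def dest!: mset_eq_setD) (metis mset_eq_imp_distinct_iff mset_eq_setD)+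
  qed
  also have "\<dots> = (\<Sum>xs\<in>permutations_of_set (set ys). w ys)"
  proof (rule sum.cong[OF refl])
    fix xs
    assume "xs \<in> permutations_of_set (set ys)"
    then have m: "mset xs = mset ys"
      using assms(3) by (auto simp: permutations_of_set_def set_eq_iff_mset_eq_distinct[symmetric])
    show "w xs * oriented_simplex ys xs = w ys"
      using alternating_eq_oriented_simplex[OF assms(2,3) m] oriented_simplex_square[OF assms(3) m]
      by (simp add: mult.commute mult.left_commute)
  qed
  also have "\<dots> = fact k * w ys"
    using assms(3,5) by (simp add: distinct_card)
  finally show ?thesis .
qed

text \<open>
  Boundary and coboundary are adjoint, up to a positive factor.
\<close>

lemma sum_boundary_oriented_simplex:
  assumes "finite V" "alternating w" "distinct ys" "set ys \<subseteq> V" "length ys = Suc k"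
  shows "(\<Sum>xs | set xs \<subseteq> V \<and> length xs = k. w xs * cnj (boundary (oriented_simplex ys) xs)) =
    fact k * coboundary w ys"
proof -
  let ?F = "{xs. set xs \<subseteq> V \<and> length xs = k}"
  let ?del = "\<lambda>j. take j ys @ drop (Suc j) ys"
  have "(\<Sum>xs\<in>?F. w xs * cnj (boundary (oriented_simplex ys) xs)) =
      (\<Sum>xs\<in>?F. \<Sum>j<length ys. (- 1) ^ j * (w xs * oriented_simplex (?del j) xs))"
    by (simp add: boundary_oriented_simplex[OF assms(3)] sum_distrib_left mult.left_commute)
  also have "\<dots> = (\<Sum>j<length ys. (- 1) ^ j * (\<Sum>xs\<in>?F. w xs * oriented_simplex (?del j) xs))"
    by (subst sum.swap) (simp add: sum_distrib_left)
  also have "\<dots> = (\<Sum>j<length ys. (- 1) ^ j * (fact k * w (?del j)))"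
  proof (intro sum.cong refl arg_cong2[of _ _ _ _ "(*)"] sum_oriented_simplex assms(1,2))
    fix j
    assume j: "j \<in> {..<length ys}"
    show "distinct (?del j)"
      using assms(3) by (simp add: distinct_append set_take_disj_set_drop_if_distinct)
    show "set (?del j) \<subseteq> V"
      using assms(4) by (auto dest: in_set_takeD in_set_dropD)
    show "length (?del j) = k"
      using j assms(5) by auto
  qed
  also have "\<dots> = fact k * coboundary w ys"
    by (simp add: coboundary_def sum_distrib_left mult.left_commute)
  finally show ?thesis .
qed

text \<open>
  The projection of chains of a complex onto the relative chains modulo \<open>L\<close>, realised as the chains
  supported away from \<open>L\<close>.
\<close>

definition erase :: "'a set set \<Rightarrow> ('a list \<Rightarrow> complex) \<Rightarrow> 'a list \<Rightarrow> complex" where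
  "erase L c xs = (if set xs \<in> L then 0 else c xs)"

lemma alternating_erase: "alternating c \<Longrightarrow> alternating (erase L c)"
  by (simp add: alternating_def erase_def)

context finite_complex
begin

lemma erase_chain: "c \<in> oriented_chains K d \<Longrightarrow> erase L c \<in> oriented_chains K d"
  by (auto simp: chains_iff alternating_erase) (auto simp: erase_def split: if_splits)

lemma diff_erase_chain:
  assumes "finite_complex V L" "c \<in> oriented_chains K d"
  shows "c - erase L c \<in> oriented_chains L d"
proof -
  interpret L: finite_complex V L
    by fact
  show ?thesis
    using assms(2) by (auto simp: chains_iff L.chains_iff alternating_erase alternating_diff)
      (auto simp: erase_def split: if_splits)
qed

lemma simplex_chain:
  "distinct xs \<Longrightarrow> set xs \<in> K \<Longrightarrow> int (length xs) = d + 1 \<Longrightarrow> oriented_simplex xs \<in> oriented_chains K d"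
  using oriented_simplex_chain[of xs K] by simp

lemma chain_expansion:
  assumes c: "c \<in> oriented_chains K d"
  shows "c xs = (\<Sum>S | S \<in> K \<and> int (card S) = d + 1. c (enum S) * oriented_simplex (enum S) xs)"
proof -
  have fin: "finite S" if "S \<in> K" for S
    using that face_subset finite_V finite_subset by blast
  have zero: "oriented_simplex (enum S) xs = 0" if "S \<in> K" "\<not> distinct xs \<or> S \<noteq> set xs" for S
    using that oriented_simplex_eq_0[of xs "enum S"] enum[OF fin[OF that(1)]]
      mset_eq_setD[of xs "enum S"] mset_eq_imp_distinct_iff[of xs "enum S"] by auto
  show ?thesis
  proof (cases "distinct xs \<and> set xs \<in> K \<and> int (length xs) = d + 1")
    case True
    then have "(\<Sum>S | S \<in> K \<and> int (card S) = d + 1. c (enum S) * oriented_simplex (enum S) xs) =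
        (\<Sum>S\<in>{set xs}. c (enum S) * oriented_simplex (enum S) xs)"
      using finite_K zero by (intro sum.mono_neutral_right) (auto simp: distinct_card)
    also have "\<dots> = c xs"
      using alternating_eq_oriented_simplex[OF chain_alternating[OF c], of "enum (set xs)" xs]
        mset_enum[of xs] enum[of "set xs"] True by (simp add: mult.commute)
    finally show ?thesis ..
  next
    case False
    then have "c xs = 0"
      using chain_support[OF c] alternating_imp_distinct[OF chain_alternating[OF c]] by blast
    moreover have "oriented_simplex (enum S) xs = 0" if "S \<in> K" "int (card S) = d + 1" for S
    proof (rule zero[OF that(1)])
      show "\<not> distinct xs \<or> S \<noteq> set xs"
        using that False distinct_card[of xs] by auto
    qed
    ultimately show ?thesis
      by simp
  qed
qed

lemma sum_boundary_eq_0: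
  assumes c: "c \<in> oriented_chains K (d + 1)" and w: "alternating w"
    and cob: "\<And>ys. distinct ys \<Longrightarrow> set ys \<in> K \<Longrightarrow> int (length ys) = d + 2 \<Longrightarrow> coboundary w ys = 0"
  shows "(\<Sum>xs | set xs \<subseteq> V \<and> length xs = nat (d + 1). w xs * cnj (boundary c xs)) = 0"
proof (cases "d + 1 < 0")
  case True
  have "c (v # xs) = 0" for v xs
    using chain_support[OF c, of "v # xs"] True by auto
  then have "boundary c xs = 0" for xs
    by (simp add: boundary_sum[OF c])
  then show ?thesis
    by simp
next
  case False
  let ?F = "{xs. set xs \<subseteq> V \<and> length xs = nat (d + 1)}"
  let ?K = "{S. S \<in> K \<and> int (card S) = (d + 1) + 1}"
  have fin: "finite S" if "S \<in> K" for S
    using that face_subset finite_V finite_subset by blast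
  have b: "boundary c xs = (\<Sum>S\<in>?K. c (enum S) * boundary (oriented_simplex (enum S)) xs)" for xs
  proof -
    have "boundary c xs = (\<Sum>v\<in>V. \<Sum>S\<in>?K. c (enum S) * oriented_simplex (enum S) (v # xs))"
      unfolding boundary_sum[OF c] by (intro sum.cong refl chain_expansion[OF c])
    also have "\<dots> = (\<Sum>S\<in>?K. c (enum S) * (\<Sum>v\<in>V. oriented_simplex (enum S) (v # xs)))"
      by (subst sum.swap) (simp add: sum_distrib_left)
    also have "\<dots> = (\<Sum>S\<in>?K. c (enum S) * boundary (oriented_simplex (enum S)) xs)"
      using enum[OF fin] length_enum[OF fin]
      by (intro sum.cong refl arg_cong2[of _ _ _ _ "(*)"] boundary_sum[symmetric, of _ "d + 1"] simplex_chain) auto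
    finally show ?thesis .
  qed
  have "(\<Sum>xs\<in>?F. w xs * cnj (boundary c xs)) =
      (\<Sum>S\<in>?K. cnj (c (enum S)) * (\<Sum>xs\<in>?F. w xs * cnj (boundary (oriented_simplex (enum S)) xs)))"
    unfolding b cnj_sum sum_distrib_left by (subst sum.swap) (simp add: mult_ac)
  also have "\<dots> = (\<Sum>S\<in>?K. cnj (c (enum S)) * (fact (nat (d + 1)) * coboundary w (enum S)))"
    using enum[OF fin] length_enum[OF fin] face_subset False finite_V w
    by (intro sum.cong refl arg_cong2[of _ _ _ _ "(*)"] sum_boundary_oriented_simplex) auto
  also have "\<dots> = 0"
    using cob[of "enum _"] enum[OF fin] length_enum[OF fin] by (intro sum.neutral) auto
  finally show ?thesis .
qed

text \<open>
  Modulo \<open>L\<close>, every chain can be changed by a boundary so that it becomes orthogonal to all boundaries;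
  by adjointness it is then a cocycle.
\<close>

lemma relative_harmonic_representative:
  assumes c: "c \<in> oriented_chains K d"
  obtains v where "v \<in> oriented_chains K (d + 1)"
    "\<And>ys. distinct ys \<Longrightarrow> set ys \<in> K \<Longrightarrow> int (length ys) = d + 2 \<Longrightarrow> coboundary (erase L (c - boundary v)) ys = 0"
proof -
  let ?F = "{xs. set xs \<subseteq> V \<and> length xs = nat (d + 1)}"
  define U where "U = (\<lambda>v. erase L (boundary v)) ` oriented_chains K (d + 1)"
  have "finite ?F"
    using finite_V by (rule finite_lists_length_eq)
  moreover have "0 \<in> U"
    unfolding U_def using chain_0[of "d + 1"] by (intro image_eqI[of _ _ 0]) (auto simp: erase_def)
  moreover have "u + scale a u' \<in> U" if u_U: "u \<in> U" "u' \<in> U" for a u u'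
  proof -
    obtain v v' where v: "v \<in> oriented_chains K (d + 1)" "v' \<in> oriented_chains K (d + 1)"
      and u: "u = erase L (boundary v)" "u' = erase L (boundary v')"
      using u_U unfolding U_def by blast
    have "u + scale a u' = erase L (boundary (v + scale a v'))"
      unfolding u boundary_add[OF v(1) chain_scale[OF v(2)]] boundary_scale[OF v(2)]
      by (auto simp: erase_def)
    then show ?thesis
      unfolding U_def using chain_add[OF v(1) chain_scale[OF v(2)]] by blast
  qed
  ultimately have "\<exists>u\<in>U. \<forall>u'\<in>U. (\<Sum>xs\<in>?F. (erase L c xs - u xs) * cnj (u' xs)) = 0"
    by (rule orthogonal_projection)
  then obtain v where v: "v \<in> oriented_chains K (d + 1)"
    and orth: "\<And>u'. u' \<in> U \<Longrightarrow> (\<Sum>xs\<in>?F. (erase L c xs - erase L (boundary v) xs) * cnj (u' xs)) = 0"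
    by (auto simp: U_def)
  have eq: "erase L c xs - erase L (boundary v) xs = erase L (c - boundary v) xs" for xs
    by (simp add: erase_def)
  have bv: "boundary v \<in> oriented_chains K d"
    using boundary_chain[OF v] by simp
  show ?thesis
  proof (rule that[OF v])
    fix ys
    assume ys: "distinct ys" "set ys \<in> K" "int (length ys) = d + 2"
    show "coboundary (erase L (c - boundary v)) ys = 0"
    proof (cases ys)
      case Nil
      then show ?thesis
        by (simp add: coboundary_def)
    next
      case (Cons y zs)
      then have len: "length ys = Suc (nat (d + 1))"
        using ys(3) by simp
      have "oriented_simplex ys \<in> oriented_chains K (d + 1)"
        using ys by (intro simplex_chain) auto
      then have "erase L (boundary (oriented_simplex ys)) \<in> U"
        by (auto simp: U_def)
      then have "0 = (\<Sum>xs\<in>?F. erase L (c - boundary v) xs * cnj (erase L (boundary (oriented_simplex ys)) xs))"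
        using orth unfolding eq by metis
      also have "\<dots> = (\<Sum>xs\<in>?F. erase L (c - boundary v) xs * cnj (boundary (oriented_simplex ys) xs))"
        by (intro sum.cong) (auto simp: erase_def)
      also have "\<dots> = fact (nat (d + 1)) * coboundary (erase L (c - boundary v)) ys"
        using face_subset[OF ys(2)] chain_alternating[OF chain_diff[OF c bv]]
        by (intro sum_boundary_oriented_simplex finite_V alternating_erase ys len)
      finally show ?thesis
        by simp
    qed
  qed
qed

text \<open>
  A cocycle is orthogonal to boundaries, so a cocycle that is itself a boundary modulo \<open>L\<close> is
  orthogonal to itself.
\<close>

lemma relative_harmonic_unique:
  assumes w: "w \<in> oriented_chains K d" and v: "v \<in> oriented_chains K (d + 1)"
    and w_eq: "\<And>xs. set xs \<in> L \<Longrightarrow> w xs = 0" "\<And>xs. set xs \<notin> L \<Longrightarrow> w xs = boundary v xs"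
    and cob: "\<And>ys. distinct ys \<Longrightarrow> set ys \<in> K \<Longrightarrow> int (length ys) = d + 2 \<Longrightarrow> coboundary w ys = 0"
  shows "w = 0"
proof
  fix ys
  let ?F = "{xs. set xs \<subseteq> V \<and> length xs = nat (d + 1)}"
  have fF: "finite ?F"
    using finite_V by (rule finite_lists_length_eq)
  have "of_real (\<Sum>xs\<in>?F. (cmod (w xs))\<^sup>2) = (\<Sum>xs\<in>?F. w xs * cnj (w xs))"
    by (simp only: of_real_sum complex_norm_square)
  also have "\<dots> = (\<Sum>xs\<in>?F. w xs * cnj (boundary v xs))"
    using w_eq by (intro sum.cong refl) (metis mult_eq_0_iff)
  also have "\<dots> = 0"
    by (rule sum_boundary_eq_0[OF v chain_alternating[OF w] cob])
  finally have "(\<Sum>xs\<in>?F. (cmod (w xs))\<^sup>2) = 0"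
    by (metis of_real_eq_0_iff)
  then have F: "\<forall>xs\<in>?F. w xs = 0"
    using fF by (subst (asm) sum_nonneg_eq_0_iff) auto
  show "w ys = 0 ys"
  proof (rule ccontr)
    assume nz: "w ys \<noteq> 0 ys"
    then have "ys \<in> ?F"
      using chain_support[OF w, of ys] face_subset by auto
    then show False
      using F nz by auto
  qed
qed

end


section \<open>Chains transported along injective vertex maps\<close>

text \<open>
  For a bijection this is the map \<^const>\<open>chain_map\<close>; the generality covers the inclusions of the two vertex sets
  into their disjoint sum.
\<close>

definition push :: "('a \<Rightarrow> 'b) \<Rightarrow> ('a list \<Rightarrow> complex) \<Rightarrow> 'b list \<Rightarrow> complex" where
  "push f c xs = (if set xs \<subseteq> range f then c (map (inv_into UNIV f) xs) else 0)"

lemma push_eq_chain_map: "bij f \<Longrightarrow> chain_map f = push f"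
  by (auto simp: push_def chain_map_def fun_eq_iff bij_is_surj)

lemma push_map [simp]: "inj f \<Longrightarrow> push f c (map f xs) = c xs"
  by (auto simp: push_def intro!: arg_cong[of _ _ c] map_idI)

lemma list_in_range: "set xs \<subseteq> range f \<Longrightarrow> \<exists>zs. xs = map f zs"
  by (metis ex_map_conv imageE subsetD)

lemma push_support:
  assumes "inj f" "push f c xs \<noteq> 0"
  obtains zs where "xs = map f zs" "c zs \<noteq> 0"
  using assms list_in_range[of xs f] push_map[OF assms(1), of c] by (metis push_def)

lemma push_eqI:
  assumes "inj f" "\<And>zs. c' (map f zs) = c zs" "\<And>xs. c' xs \<noteq> 0 \<Longrightarrow> set xs \<subseteq> range f"
  shows "push f c = c'"
proof
  fix xs
  show "push f c xs = c' xs"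
  proof (cases "set xs \<subseteq> range f")
    case True
    then show ?thesis
      using list_in_range[OF True] assms(1,2) by auto
  next
    case False
    then show ?thesis
      using assms(3)[of xs] by (auto simp: push_def)
  qed
qed

lemma push_0 [simp]: "push f 0 = 0"
  by (auto simp: push_def fun_eq_iff)

lemma push_add: "push f (c + c') = push f c + push f c'"
  by (auto simp: push_def fun_eq_iff)

lemma push_diff: "push f (c - c') = push f c - push f c'"
  by (auto simp: push_def fun_eq_iff)

lemma push_scale: "push f (scale a c) = scale a (push f c)"
  by (auto simp: push_def fun_eq_iff)

lemma push_inject:
  assumes "inj f" "push f c = push f c'"
  shows "c = c'"
proof
  fix xs
  show "c xs = c' xs"
    using fun_cong[OF assms(2), of "map f xs"] assms(1) by simp
qed

lemma push_push:
  assumes "inj f" "inj g"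
  shows "push g (push f c) = push (g \<circ> f) c"
proof (rule push_eqI[symmetric])
  show "inj (g \<circ> f)"
    using assms by (rule inj_compose[rotated])
  show "push g (push f c) (map (g \<circ> f) zs) = c zs" for zs
    using assms by (simp flip: map_map)
  show "set xs \<subseteq> range (g \<circ> f)" if nz: "push g (push f c) xs \<noteq> 0" for xs
  proof -
    obtain ys where ys: "xs = map g ys" "push f c ys \<noteq> 0"
      using push_support[OF assms(2) nz] .
    then obtain zs where "ys = map f zs"
      using push_support[OF assms(1)] by metis
    then show ?thesis
      using ys by auto
  qed
qed

lemma push_chain:
  assumes "inj f" "c \<in> oriented_chains K d" "\<And>S. S \<in> K \<Longrightarrow> f ` S \<in> K'"
  shows "push f c \<in> oriented_chains K' d"
  unfolding oriented_chains_def mem_Collect_eq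
proof (intro conjI allI impI)
  have "{xs. push f c xs \<noteq> 0} \<subseteq> map f ` {zs. c zs \<noteq> 0}"
    using push_support[OF assms(1)] by blast
  then show "finite {xs. push f c xs \<noteq> 0}"
    using assms(2) finite_subset by (auto simp: oriented_chains_def)
  fix xs
  show "push f c (permute_list \<pi> xs) = of_int (sign \<pi>) * push f c xs" if "\<pi> permutes {..<length xs}" for \<pi>
  proof (cases "set xs \<subseteq> range f")
    case True
    then obtain zs where xs: "xs = map f zs"
      using list_in_range by blast
    have "\<pi> permutes {..<length zs}"
      using that xs by simp
    then show ?thesis
      using assms(1,2) unfolding xs by (simp add: permute_list_map oriented_chains_def)
  next
    case False
    then show ?thesis
      using that by (simp add: push_def)
  qed
  assume "push f c xs \<noteq> 0"
  then obtain zs where zs: "xs = map f zs" "c zs \<noteq> 0"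
    by (rule push_support[OF assms(1)])
  then have "distinct zs" "set zs \<in> K" "int (length zs) = d + 1"
    using assms(2) by (auto simp: oriented_chains_def)
  then show "distinct xs" "set xs \<in> K'" "int (length xs) = d + 1"
    using assms(3) zs inj_on_subset[OF assms(1) subset_UNIV] by (auto simp: distinct_map)
qed

lemma push_surj:
  assumes "inj f" "c' \<in> oriented_chains K' d" "\<And>S. S \<in> K' \<Longrightarrow> \<exists>T\<in>K. S = f ` T"
  obtains c where "c \<in> oriented_chains K d" "push f c = c'"
proof
  let ?c = "\<lambda>zs. c' (map f zs)"
  have sub: "T \<in> K" if "f ` T \<in> K'" for T
    using assms(3)[OF that] inj_image_eq_iff[OF assms(1)] by auto
  show "push f ?c = c'"
  proof (rule push_eqI[OF assms(1) refl])
    fix xs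
    assume "c' xs \<noteq> 0"
    then have "set xs \<in> K'"
      using assms(2) by (auto simp: oriented_chains_def)
    then show "set xs \<subseteq> range f"
      using assms(3) by blast
  qed
  show "?c \<in> oriented_chains K d"
    unfolding oriented_chains_def mem_Collect_eq
  proof (intro conjI allI impI)
    have "finite (map f -` {xs. c' xs \<noteq> 0})"
      using assms(1,2) by (intro finite_vimageI) (auto simp: oriented_chains_def)
    then show "finite {zs. c' (map f zs) \<noteq> 0}"
      by (simp add: vimage_def)
    fix zs
    show "c' (map f (permute_list \<pi> zs)) = of_int (sign \<pi>) * c' (map f zs)" if "\<pi> permutes {..<length zs}" for \<pi>
      using that assms(2) by (simp add: oriented_chains_def flip: permute_list_map)
    assume "c' (map f zs) \<noteq> 0"
    then have "distinct (map f zs)" "f ` set zs \<in> K'" "int (length zs) = d + 1"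
      using assms(2) by (force simp: oriented_chains_def)+
    then show "distinct zs" "set zs \<in> K" "int (length zs) = d + 1"
      using sub by (auto simp: distinct_map)
  qed
qed

lemma boundary_push:
  assumes "inj f"
  shows "boundary (push f c) = push f (boundary c)"
proof (rule push_eqI[OF assms, symmetric])
  fix zs
  have "{v. push f c (v # map f zs) \<noteq> 0} = f ` {w. c (w # zs) \<noteq> 0}"
  proof (intro equalityI subsetI)
    fix v
    assume v: "v \<in> {v. push f c (v # map f zs) \<noteq> 0}"
    then obtain ws where "v # map f zs = map f ws" "c ws \<noteq> 0"
      using push_support[OF assms] by blast
    then obtain w ws' where ws: "ws = w # ws'" "v = f w" "map f zs = map f ws'" "c (w # ws') \<noteq> 0"
      by (cases ws) auto
    then have "ws' = zs"
      using assms by (simp add: inj_map_eq_map)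
    then show "v \<in> f ` {w. c (w # zs) \<noteq> 0}"
      using ws by auto
  next
    fix v
    assume "v \<in> f ` {w. c (w # zs) \<noteq> 0}"
    then obtain w where "v = f w" "c (w # zs) \<noteq> 0"
      by auto
    then show "v \<in> {v. push f c (v # map f zs) \<noteq> 0}"
      using push_map[OF assms, of c "w # zs"] by simp
  qed
  then show "boundary (push f c) (map f zs) = boundary c zs"
    unfolding boundary_def using push_map[OF assms, of c "_ # zs"]
    by (simp add: sum.reindex[OF inj_on_subset[OF assms subset_UNIV]])
next
  fix xs
  assume "boundary (push f c) xs \<noteq> 0"
  then have "\<exists>v. push f c (v # xs) \<noteq> 0"
    unfolding boundary_def by (metis (mono_tags, lifting) empty_Collect_eq sum.empty)
  then show "set xs \<subseteq> range f"
    by (auto simp: push_def split: if_splits)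
qed


section \<open>The star operator on the simplex of all subsets\<close>

lemma alternating_append_swap:
  assumes "alternating c"
  shows "c (xs @ ys) = (- 1) ^ (length xs * length ys) * c (ys @ xs)"
  using assms
proof (induction xs arbitrary: c)
  case (Cons x xs)
  have "c (x # xs @ ys) = (- 1) ^ (length xs * length ys) * c (x # ys @ xs)"
    using Cons.IH[OF alternating_Cons[OF Cons.prems, of x]] .
  then show ?case
    using alternating_move_to_front[OF Cons.prems, of ys x xs] by (simp add: power_add)
qed simp

lemma alternating_append_left:
  assumes "alternating c"
  shows "alternating (\<lambda>xs. c (xs @ ys))"
proof -
  have "(\<lambda>xs. c (xs @ ys)) = (\<lambda>xs. (- 1) ^ (length xs * length ys) * c (ys @ xs))"
    using alternating_append_swap[OF assms] by blast
  then show ?thesis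
    using alternating_append[OF assms, of ys] by (simp add: alternating_def)
qed

text \<open>
  The orientation of the top-dimensional simplex on \<open>E\<close> given by the chosen ordering of \<open>E\<close>.
\<close>

definition vol :: "'a set \<Rightarrow> 'a list \<Rightarrow> complex" where
  "vol E = oriented_simplex (enum E)"

text \<open>
  The Hodge star: \<open>xs\<close> can be any ordering of the complement of \<open>ys\<close> (\<open>star_eq\<close>), because a
  reordering changes the two factors by the same sign.
\<close>

definition star :: "'a set \<Rightarrow> ('a list \<Rightarrow> complex) \<Rightarrow> 'a list \<Rightarrow> complex" where
  "star E c ys =
     (if distinct ys \<and> set ys \<subseteq> E then vol E (enum (E - set ys) @ ys) * c (enum (E - set ys)) else 0)"

lemma finite_complex_Pow: "finite E \<Longrightarrow> finite_complex E (Pow E)"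
  by unfold_locales auto

lemma alternating_vol: "finite E \<Longrightarrow> alternating (vol E)"
  unfolding vol_def by (intro alternating_oriented_simplex distinct_enum)

lemma vol_square:
  assumes "distinct xs" "set xs = E"
  shows "vol E xs * vol E xs = 1"
  unfolding vol_def using assms enum[of E] mset_enum[of xs] by (intro oriented_simplex_square) auto

lemma star_eq:
  assumes "alternating c" "distinct (xs @ ys)" "set (xs @ ys) = E"
  shows "star E c ys = vol E (xs @ ys) * c xs"
proof -
  have fin: "finite E"
    using assms(3) by auto
  let ?l = "enum (E - set ys)"
  have "E - set ys = set xs"
    using assms by auto
  then have l: "mset ?l = mset xs"
    using mset_enum[of xs] assms(2) by simp
  have dx: "distinct xs"
    using assms(2) by simp
  have "vol E (?l @ ys) = oriented_simplex xs ?l * vol E (xs @ ys)"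
    using alternating_eq_oriented_simplex[OF alternating_append_left[OF alternating_vol[OF fin]] dx l] .
  moreover have "c ?l = oriented_simplex xs ?l * c xs"
    using alternating_eq_oriented_simplex[OF assms(1) dx l] .
  ultimately have "vol E (?l @ ys) * c ?l =
      (oriented_simplex xs ?l * oriented_simplex xs ?l) * (vol E (xs @ ys) * c xs)"
    by (simp add: mult_ac)
  then show ?thesis
    using assms(2,3) oriented_simplex_square[OF dx l] by (auto simp: star_def)
qed

lemma star_support:
  assumes "finite E" "star E c ys \<noteq> 0"
  obtains xs where "distinct (xs @ ys)" "set (xs @ ys) = E" "c xs \<noteq> 0"
proof (rule that[of "enum (E - set ys)"])
  have "distinct ys" "set ys \<subseteq> E" "c (enum (E - set ys)) \<noteq> 0"
    using assms(2) by (auto simp: star_def split: if_splits)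
  then show "distinct (enum (E - set ys) @ ys)" "set (enum (E - set ys) @ ys) = E" "c (enum (E - set ys)) \<noteq> 0"
    using enum[of "E - set ys"] assms(1) by auto
qed

lemma star_add: "star E (c + c') = star E c + star E c'"
  by (auto simp: star_def fun_eq_iff algebra_simps)

lemma star_scale: "star E (scale a c) = scale a (star E c)"
  by (auto simp: star_def fun_eq_iff algebra_simps)

lemma star_0 [simp]: "star E 0 = 0"
  by (auto simp: star_def fun_eq_iff)

lemma alternating_star:
  assumes "finite E" "alternating c"
  shows "alternating (star E c)"
  unfolding alternating_def
proof (intro allI impI)
  fix ys :: "'a list" and \<pi>
  assume \<pi>: "\<pi> permutes {..<length ys}"
  show "star E c (permute_list \<pi> ys) = of_int (sign \<pi>) * star E c ys"
    using alternatingD[OF alternating_append[OF alternating_vol[OF assms(1)]] \<pi>] \<pi>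
    by (simp add: star_def)
qed

lemma star_chain:
  assumes "finite E" "c \<in> oriented_chains (Pow E) d"
  shows "star E c \<in> oriented_chains (Pow E) (int (card E) - 2 - d)"
proof -
  interpret P: finite_complex E "Pow E"
    using assms(1) by (rule finite_complex_Pow)
  show ?thesis
    unfolding P.chains_iff
  proof (intro conjI allI impI)
    show "alternating (star E c)"
      using alternating_star[OF assms(1) P.chain_alternating[OF assms(2)]] .
    fix ys
    assume "star E c ys \<noteq> 0"
    then obtain xs where xs: "distinct (xs @ ys)" "set (xs @ ys) = E" "c xs \<noteq> 0"
      by (rule star_support[OF assms(1)])
    show "set ys \<in> Pow E"
      using xs(2) by auto
    show "int (length ys) = int (card E) - 2 - d + 1"
      using P.chain_support[OF assms(2) xs(3)] distinct_card[OF xs(1)] xs(2) by simp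
  qed
qed

text \<open>
  Exchanging a block of length \<open>nat (d + 1)\<close> with the complementary block costs the displayed sign.
\<close>

lemma star_star:
  assumes "finite E" "c \<in> oriented_chains (Pow E) d"
  shows "star E (star E c) = scale ((- 1) ^ (nat (d + 1) * (card E - nat (d + 1)))) c"
proof
  fix zs
  interpret P: finite_complex E "Pow E"
    using assms(1) by (rule finite_complex_Pow)
  have ac: "alternating c"
    using P.chain_alternating[OF assms(2)] .
  show "star E (star E c) zs = scale ((- 1) ^ (nat (d + 1) * (card E - nat (d + 1)))) c zs"
  proof (cases "distinct zs \<and> set zs \<subseteq> E")
    case True
    define ys where "ys = enum (E - set zs)"
    have ys: "distinct (ys @ zs)" "set (ys @ zs) = E"
      using enum[of "E - set zs"] assms(1) True by (auto simp: ys_def)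
    then have ys': "distinct (zs @ ys)" "set (zs @ ys) = E"
      by auto
    have "star E (star E c) zs = vol E (ys @ zs) * vol E (zs @ ys) * c zs"
      using star_eq[OF alternating_star[OF assms(1) ac] ys] star_eq[OF ac ys'] by simp
    also have "vol E (ys @ zs) = (- 1) ^ (length zs * length ys) * vol E (zs @ ys)"
      using alternating_append_swap[OF alternating_vol[OF assms(1)], of ys zs] by (simp add: mult.commute)
    finally have eq: "star E (star E c) zs = (- 1) ^ (length zs * length ys) * c zs"
      using vol_square[OF ys'] by simp
    show ?thesis
    proof (cases "c zs = 0")
      case False
      then have "length zs = nat (d + 1)"
        using P.chain_support[OF assms(2)] by fastforce
      moreover have "length ys = card E - length zs"
        using distinct_card[OF ys(1)] ys(2) by simp
      ultimately show ?thesis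
        using eq by simp
    qed (simp add: eq)
  next
    case False
    then have "c zs = 0"
      using P.chain_support[OF assms(2)] alternating_imp_distinct[OF ac] by blast
    then show ?thesis
      using False by (auto simp: star_def)
  qed
qed

text \<open>
  A vertex \<open>v\<close> that can be added to \<open>ys\<close> is a vertex that can be removed from its complement \<open>xs\<close>, so
  the terms of the boundary at \<open>ys\<close> match those of the coboundary at \<open>xs\<close>.
\<close>

lemma boundary_star:
  assumes "finite E" "c \<in> oriented_chains (Pow E) d" "distinct (xs @ ys)" "set (xs @ ys) = E"
  shows "boundary (star E c) ys = (- 1) ^ (length xs - 1) * vol E (xs @ ys) * coboundary c xs"
proof -
  interpret P: finite_complex E "Pow E"
    using assms(1) by (rule finite_complex_Pow)
  have ac: "alternating c"
    using P.chain_alternating[OF assms(2)] .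
  have dx: "distinct xs"
    using assms(3) by simp
  let ?del = "\<lambda>j. take j xs @ drop (Suc j) xs"
  have "boundary (star E c) ys = (\<Sum>v\<in>E. star E c (v # ys))"
    by (rule P.boundary_sum[OF star_chain[OF assms(1,2)]])
  also have "\<dots> = (\<Sum>v\<in>set xs. star E c (v # ys))"
    using assms(1,3,4) by (intro sum.mono_neutral_right) (auto simp: star_def)
  also have "\<dots> = (\<Sum>j<length xs. star E c (xs ! j # ys))"
    using bij_betw_nth[OF dx, of "{..<length xs}" "set xs"]
    by (intro sum.reindex_bij_betw[symmetric]) auto
  also have "\<dots> = (\<Sum>j<length xs. (- 1) ^ (length xs - 1) * vol E (xs @ ys) * ((- 1) ^ j * c (?del j)))"
  proof (rule sum.cong[OF refl])
    fix j
    assume "j \<in> {..<length xs}"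
    then have j: "j < length xs"
      by simp
    have split: "xs = take j xs @ xs ! j # drop (Suc j) xs"
      using id_take_nth_drop[OF j] .
    have m: "mset (?del j @ xs ! j # ys) = mset (xs @ ys)"
      by (subst (4) split) simp
    have "vol E (?del j @ xs ! j # ys) = (- 1) ^ (length xs - 1) * vol E (xs ! j # ?del j @ ys)"
      using alternating_move_to_front[OF alternating_vol[OF assms(1)], of "?del j" "xs ! j" ys] j
      by simp
    moreover have "vol E (xs @ ys) = (- 1) ^ j * vol E (xs ! j # ?del j @ ys)"
      using alternating_move_to_front[OF alternating_vol[OF assms(1)], of "take j xs" "xs ! j" "drop (Suc j) xs @ ys"] j
      by (subst split) simp
    ultimately have "vol E (?del j @ xs ! j # ys) = (- 1) ^ (length xs - 1) * ((- 1) ^ j * vol E (xs @ ys))"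
      by (simp flip: mult.assoc power_add)
    moreover have "star E c (xs ! j # ys) = vol E (?del j @ xs ! j # ys) * c (?del j)"
      using m assms(3,4) by (intro star_eq[OF ac]) (metis mset_eq_imp_distinct_iff, metis mset_eq_setD)
    ultimately show "star E c (xs ! j # ys) = (- 1) ^ (length xs - 1) * vol E (xs @ ys) * ((- 1) ^ j * c (?del j))"
      by (simp add: mult_ac)
  qed
  also have "\<dots> = (- 1) ^ (length xs - 1) * vol E (xs @ ys) * coboundary c xs"
    by (simp add: coboundary_def sum_distrib_left)
  finally show ?thesis .
qed

lemma boundary_star_eq_0_iff:
  assumes "finite E" "c \<in> oriented_chains (Pow E) d" "distinct (xs @ ys)" "set (xs @ ys) = E"
  shows "boundary (star E c) ys = 0 \<longleftrightarrow> coboundary c xs = 0"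
  using boundary_star[OF assms] vol_square[OF assms(3,4)] by auto

text \<open>
  This is where the sign of the induced permutation of the edges enters.
\<close>

lemma vol_map:
  assumes "finite E" "inj g" "g ` E = E"
  shows "vol E (map g xs) = of_int (sign_on E g) * vol E xs"
proof (cases "mset xs = mset (enum E)")
  case True
  let ?l = "enum E" and ?r = "restrict_id g E"
  have l: "distinct ?l" "set ?l = E"
    using enum[OF assms(1)] by auto
  have xs: "distinct xs" "set xs = E"
    using True l by (metis mset_eq_imp_distinct_iff, metis mset_eq_setD)
  have r: "?r permutes E"
    using assms(2,3) by (intro permutes_restrict_id) (auto simp: bij_betw_def intro: inj_on_subset)
  have nth: "bij_betw ((!) xs) {..<length xs} E"
    using bij_betw_nth[OF xs(1)] xs(2) by auto
  \<comment> \<open>The permutation of positions that corresponds to \<open>g\<close> under the ordering \<open>xs\<close> of \<open>E\<close>.\<close>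
  define p where "p = map_permutation E (inv_into {..<length xs} ((!) xs)) ?r"
  have inj: "inj_on (inv_into {..<length xs} ((!) xs)) E"
    using bij_betw_inv_into[OF nth] by (simp add: bij_betw_def)
  have p: "p permutes {..<length xs}"
    unfolding p_def by (rule map_permutation_permutes[OF bij_betw_inv_into[OF nth] r])
  have "map g xs = permute_list p xs"
  proof (rule nth_equalityI)
    fix i
    assume "i < length (map g xs)"
    then have i: "i < length xs"
      by simp
    then have "xs ! i \<in> E"
      using xs by auto
    then have "p (inv_into {..<length xs} ((!) xs) (xs ! i)) = inv_into {..<length xs} ((!) xs) (g (xs ! i))"
      unfolding p_def by (subst map_permutation_apply[OF inj]) auto
    moreover have "inv_into {..<length xs} ((!) xs) (xs ! i) = i"
      using nth i by (intro inv_into_f_f) (auto simp: bij_betw_def)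
    moreover have "xs ! inv_into {..<length xs} ((!) xs) (g (xs ! i)) = g (xs ! i)"
      using nth \<open>xs ! i \<in> E\<close> assms(3) by (intro f_inv_into_f) (auto simp: bij_betw_def)
    ultimately show "map g xs ! i = permute_list p xs ! i"
      using i p by (simp add: permute_list_nth)
  qed simp
  moreover have "sign p = sign_on E g"
    unfolding p_def sign_on_def by (rule sign_map_permutation[OF inj r assms(1)])
  ultimately show ?thesis
    using alternatingD[OF alternating_vol[OF assms(1)] p] by simp
next
  case False
  have l: "distinct (enum E)" "set (enum E) = E"
    using enum[OF assms(1)] by auto
  have "mset (map g xs) \<noteq> mset (enum E)"
  proof
    assume m: "mset (map g xs) = mset (enum E)"
    then have "distinct (map g xs)" "g ` set xs = E"
      using l by (metis mset_eq_imp_distinct_iff, metis mset_eq_setD list.set_map)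
    then have "distinct xs" "set xs = E"
      using assms(2,3) by (simp add: distinct_map, metis inj_image_eq_iff)
    then show False
      using False l by (metis set_eq_iff_mset_eq_distinct)
  qed
  then show ?thesis
    using False by (simp add: vol_def oriented_simplex_eq_0)
qed

lemma star_push:
  assumes "finite E" "inj g" "g ` E = E" "alternating c"
  shows "star E (push g c) = scale (of_int (sign_on E g)) (push g (star E c))"
proof -
  have ap: "alternating (push g c)"
    unfolding alternating_def
  proof (intro allI impI)
    fix xs :: "'a list" and \<pi>
    assume \<pi>: "\<pi> permutes {..<length xs}"
    have "map (inv_into UNIV g) (permute_list \<pi> xs) = permute_list \<pi> (map (inv_into UNIV g) xs)"
      using \<pi> by (simp add: permute_list_map)
    then show "push g c (permute_list \<pi> xs) = of_int (sign \<pi>) * push g c xs"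
      using \<pi> alternatingD[OF assms(4), of \<pi> "map (inv_into UNIV g) xs"] by (simp add: push_def)
  qed
  have "push g (scale (of_int (sign_on E g)) (star E c)) = star E (push g c)"
  proof (rule push_eqI[OF assms(2)])
    fix zs
    show "star E (push g c) (map g zs) = scale (of_int (sign_on E g)) (star E c) zs"
    proof (cases "distinct zs \<and> set zs \<subseteq> E")
      case True
      define ys where "ys = enum (E - set zs)"
      have ys: "distinct (ys @ zs)" "set (ys @ zs) = E"
        using enum[of "E - set zs"] assms(1) True by (auto simp: ys_def)
      have "distinct (map g ys @ map g zs)"
        using ys(1) assms(2) by (metis distinct_map inj_on_subset map_append subset_UNIV)
      moreover have "set (map g ys @ map g zs) = E"
        using ys(2) assms(3) by (metis list.set_map map_append)
      ultimately have "star E (push g c) (map g zs) = vol E (map g ys @ map g zs) * push g c (map g ys)"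
        by (rule star_eq[OF ap])
      also have "\<dots> = of_int (sign_on E g) * vol E (ys @ zs) * c ys"
        using vol_map[OF assms(1-3), of "ys @ zs"] assms(2) by simp
      also have "\<dots> = scale (of_int (sign_on E g)) (star E c) zs"
        using star_eq[OF assms(4) ys] by simp
      finally show ?thesis .
    next
      case False
      then have "\<not> (distinct (map g zs) \<and> set (map g zs) \<subseteq> E)"
        using assms(2,3) inj_image_subset_iff[OF assms(2), of "set zs" E] by (auto simp: distinct_map)
      then show ?thesis
        using False by (auto simp: star_def)
    qed
  next
    fix xs
    assume "star E (push g c) xs \<noteq> 0"
    then have "set xs \<subseteq> E"
      by (auto simp: star_def split: if_splits)
    then show "set xs \<subseteq> range g"
      using assms(3) by blast
  qed
  then show ?thesis
    by (simp add: push_scale)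
qed


section \<open>Isomorphisms of homology representations from linear relations\<close>

definition cycles :: "'a set set \<Rightarrow> int \<Rightarrow> ('a list \<Rightarrow> complex) set" where
  "cycles K d = {c \<in> oriented_chains K d. boundary c = 0}"

definition boundaries :: "'a set set \<Rightarrow> int \<Rightarrow> ('a list \<Rightarrow> complex) set" where
  "boundaries K d = boundary ` oriented_chains K (d + 1)"

text \<open>
  The class of \<open>x\<close> modulo \<open>B\<close>; the elements of a homology module are these sets.
\<close>

definition coset :: "('a \<Rightarrow> complex) set \<Rightarrow> ('a \<Rightarrow> complex) \<Rightarrow> ('a \<Rightarrow> complex) set" where
  "coset B x = (\<lambda>b. b + x) ` B"

lemma carrier_cycle_module: "carrier (cycle_module K d) = cycles K d"
  by (simp add: cycle_module_def cycles_def zero_fun_def)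

lemma r_coset_cycle_module: "B +>\<^bsub>cycle_module K d\<^esub> x = coset B x"
  by (auto simp: a_r_coset_def r_coset_def cycle_module_def coset_def plus_fun_def)

lemma carrier_reduced_homology:
  "carrier (reduced_homology K d) = coset (boundaries K d) ` cycles K d"
  unfolding reduced_homology_def quotient_module_def
  by (auto simp: A_RCOSETS_def' carrier_cycle_module r_coset_cycle_module boundaries_def)

lemma add_reduced_homology:
  "X \<oplus>\<^bsub>reduced_homology K d\<^esub> Y = {x + y | x y. x \<in> X \<and> y \<in> Y}"
  by (auto simp: reduced_homology_def quotient_module_def set_add_def set_mult_def cycle_module_def plus_fun_def)

lemma smult_reduced_homology:
  "a \<odot>\<^bsub>reduced_homology K d\<^esub> X = (\<Union>x\<in>X. coset (boundaries K d) (scale a x))"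
  by (simp add: reduced_homology_def quotient_module_def r_coset_cycle_module boundaries_def[symmetric])
    (simp add: cycle_module_def scale_def)

context finite_complex
begin

lemma boundaries_subset: "boundaries K d \<subseteq> cycles K d"
  using boundary_chain[of _ "d + 1"] boundary_boundary[of _ "d + 1"]
  by (auto simp: boundaries_def cycles_def)

lemma boundaries_0: "0 \<in> boundaries K d"
  unfolding boundaries_def using chain_0 by (intro image_eqI[of _ _ 0]) auto

lemma boundaries_add: "b \<in> boundaries K d \<Longrightarrow> b' \<in> boundaries K d \<Longrightarrow> b + b' \<in> boundaries K d"
  unfolding boundaries_def
  by (elim imageE) (simp only: boundary_add[symmetric] chain_add imageI)

lemma boundaries_diff: "b \<in> boundaries K d \<Longrightarrow> b' \<in> boundaries K d \<Longrightarrow> b - b' \<in> boundaries K d"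
  unfolding boundaries_def
  by (elim imageE) (simp only: boundary_diff[symmetric] chain_diff imageI)

lemma boundaries_scale: "b \<in> boundaries K d \<Longrightarrow> scale a b \<in> boundaries K d"
  unfolding boundaries_def
  by (elim imageE) (simp only: boundary_scale[symmetric] chain_scale imageI)

lemma cycles_add: "c \<in> cycles K d \<Longrightarrow> c' \<in> cycles K d \<Longrightarrow> c + c' \<in> cycles K d"
  by (simp add: cycles_def chain_add boundary_add[of _ d])

lemma cycles_diff: "c \<in> cycles K d \<Longrightarrow> c' \<in> cycles K d \<Longrightarrow> c - c' \<in> cycles K d"
  by (simp add: cycles_def chain_diff boundary_diff[of _ d])

lemma cycles_scale: "c \<in> cycles K d \<Longrightarrow> scale a c \<in> cycles K d"
  by (simp add: cycles_def chain_scale boundary_scale[of _ d])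

lemma coset_iff: "y \<in> coset (boundaries K d) x \<longleftrightarrow> y - x \<in> boundaries K d"
  by (force simp: coset_def)

lemma coset_eqI:
  assumes "x - y \<in> boundaries K d"
  shows "coset (boundaries K d) x = coset (boundaries K d) y"
proof (intro Set.set_eqI)
  fix z
  have "z - y = (z - x) + (x - y)" "z - x = (z - y) - (x - y)"
    by (simp_all add: algebra_simps)
  then show "z \<in> coset (boundaries K d) x \<longleftrightarrow> z \<in> coset (boundaries K d) y"
    unfolding coset_iff using assms boundaries_add boundaries_diff by metis
qed

lemma coset_self: "x \<in> coset (boundaries K d) x"
  using boundaries_0 by (simp add: coset_iff)

lemma add_coset:
  "coset (boundaries K d) x \<oplus>\<^bsub>reduced_homology K d\<^esub> coset (boundaries K d) y =
   coset (boundaries K d) (x + y)"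
proof (intro equalityI subsetI)
  fix z
  assume "z \<in> coset (boundaries K d) x \<oplus>\<^bsub>reduced_homology K d\<^esub> coset (boundaries K d) y"
  then obtain x' y' where z: "z = x' + y'" "x' - x \<in> boundaries K d" "y' - y \<in> boundaries K d"
    by (auto simp: add_reduced_homology coset_iff)
  have "z - (x + y) = (x' - x) + (y' - y)"
    by (simp add: z)
  then show "z \<in> coset (boundaries K d) (x + y)"
    using boundaries_add[OF z(2,3)] by (simp only: coset_iff)
next
  fix z
  assume "z \<in> coset (boundaries K d) (x + y)"
  then have "z - y \<in> coset (boundaries K d) x"
    by (simp add: coset_iff algebra_simps)
  moreover have "z = (z - y) + y"
    by simp
  ultimately show "z \<in> coset (boundaries K d) x \<oplus>\<^bsub>reduced_homology K d\<^esub> coset (boundaries K d) y"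
    unfolding add_reduced_homology using coset_self by blast
qed

lemma smult_coset:
  "a \<odot>\<^bsub>reduced_homology K d\<^esub> coset (boundaries K d) x = coset (boundaries K d) (scale a x)"
proof -
  have "coset (boundaries K d) (scale a x') = coset (boundaries K d) (scale a x)"
    if "x' \<in> coset (boundaries K d) x" for x'
    using that boundaries_scale[of "x' - x" d a]
    by (intro coset_eqI) (simp add: coset_iff scale_diff_right)
  then show ?thesis
    unfolding smult_reduced_homology using coset_self by blast
qed

lemma chains_push:
  assumes "bij \<phi>" "(`) \<phi> ` K = K"
  shows "push \<phi> ` oriented_chains K d = oriented_chains K d"
proof (intro equalityI subsetI)
  fix c
  assume "c \<in> push \<phi> ` oriented_chains K d"
  then show "c \<in> oriented_chains K d"
    using push_chain[OF bij_is_inj[OF assms(1)], of _ K d K] assms(2) by blast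
next
  fix c
  assume "c \<in> oriented_chains K d"
  moreover have "\<exists>T\<in>K. S = \<phi> ` T" if "S \<in> K" for S
    using that assms(2) by blast
  ultimately show "c \<in> push \<phi> ` oriented_chains K d"
    using push_surj[OF bij_is_inj[OF assms(1)], of c K d K] by (metis imageI)
qed

lemma boundaries_push:
  assumes "bij \<phi>" "(`) \<phi> ` K = K"
  shows "push \<phi> ` boundaries K d = boundaries K d"
proof -
  have "push \<phi> ` boundaries K d = boundary ` push \<phi> ` oriented_chains K (d + 1)"
    by (simp add: boundaries_def image_image boundary_push[OF bij_is_inj[OF assms(1)]])
  then show ?thesis
    by (simp add: chains_push[OF assms] boundaries_def)
qed

lemma action_coset:
  assumes "bij (act g)" "(`) (act g) ` K = K"
  shows "homology_action act g (coset (boundaries K d) x) = coset (boundaries K d) (push (act g) x)"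
proof -
  have "homology_action act g (coset (boundaries K d) x) =
      (\<lambda>b. b + push (act g) x) ` push (act g) ` boundaries K d"
    unfolding homology_action_def push_eq_chain_map[OF assms(1)]
    by (simp add: coset_def image_image push_add)
  then show ?thesis
    by (simp add: boundaries_push[OF assms] coset_def)
qed

end

text \<open>
  A linear relation between cycles that is total, surjective and respects boundaries in both directions
  is the graph of an isomorphism on homology, which sends a class to the set of all cycles related to
  one of its members.  Working with a relation avoids choosing representatives, so that equivariance
  of the isomorphism is inherited from the relation.
\<close>

lemma rep_isomorphic_relation:
  fixes R :: "('a list \<Rightarrow> complex) \<Rightarrow> ('b list \<Rightarrow> complex) \<Rightarrow> bool"
  assumes "finite_complex V K" "finite_complex V' K'"
    and act: "\<And>g. g \<in> carrier G \<Longrightarrow> bij (act g) \<and> (`) (act g) ` K = K"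
    and act': "\<And>g. g \<in> carrier G \<Longrightarrow> bij (act' g) \<and> (`) (act' g) ` K' = K'"
    and R_cycles: "\<And>x y. R x y \<Longrightarrow> x \<in> cycles K d \<and> y \<in> cycles K' d'"
    and R_add: "\<And>x y x' y'. R x y \<Longrightarrow> R x' y' \<Longrightarrow> R (x + x') (y + y')"
    and R_scale: "\<And>a x y. R x y \<Longrightarrow> R (scale a x) (scale a y)"
    and R_total: "\<And>x. x \<in> cycles K d \<Longrightarrow> \<exists>y. R x y"
    and R_surj: "\<And>y. y \<in> cycles K' d' \<Longrightarrow> \<exists>x. R x y"
    and R_boundaries: "\<And>x y. x \<in> boundaries K d \<Longrightarrow> y \<in> boundaries K' d' \<Longrightarrow> R x y"
    and R_kernel: "\<And>x y. R x y \<Longrightarrow> x \<in> boundaries K d \<longleftrightarrow> y \<in> boundaries K' d'"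
    and R_act: "\<And>g x y. g \<in> carrier G \<Longrightarrow> R x y \<Longrightarrow> R (push (act g) x) (scale (\<chi> g) (push (act' g) y))"
  shows "rep_isomorphic G (reduced_homology K d) (homology_action act) (reduced_homology K' d')
    (tensor_character (reduced_homology K' d') (homology_action act') \<chi>)"
proof -
  interpret K: finite_complex V K by fact
  interpret K': finite_complex V' K' by fact
  let ?t = "coset (boundaries K d)" and ?t' = "coset (boundaries K' d')"
  define f where "f X = {y. \<exists>x\<in>X. R x y}" for X
  have R_diff: "R (x - x') (y - y')" if "R x y" "R x' y'" for x y x' y'
    using R_add[OF that(1) R_scale[OF that(2), of "- 1"]]
    by (simp add: scale_def plus_fun_def fun_diff_def)
  have f: "f (?t x) = ?t' y" if xy: "R x y" for x y
  proof (intro equalityI subsetI)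
    fix y'
    assume "y' \<in> f (?t x)"
    then obtain x' where x': "x' - x \<in> boundaries K d" "R x' y'"
      by (auto simp: f_def K.coset_iff)
    then show "y' \<in> ?t' y"
      using R_kernel[OF R_diff[OF x'(2) xy]] by (simp add: K'.coset_iff)
  next
    fix y'
    assume "y' \<in> ?t' y"
    then have "R 0 (y' - y)"
      using R_boundaries[OF K.boundaries_0] by (simp add: K'.coset_iff)
    then have "R x y'"
      using R_add[OF _ xy] by fastforce
    then show "y' \<in> f (?t x)"
      using K.coset_self by (auto simp: f_def)
  qed
  have rep: "\<exists>x y. X = ?t x \<and> R x y" if "X \<in> carrier (reduced_homology K d)" for X
    using that R_total unfolding carrier_reduced_homology by blast
  have rep': "\<exists>x y. Y = ?t' y \<and> R x y" if "Y \<in> carrier (reduced_homology K' d')" for Y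
    using that R_surj unfolding carrier_reduced_homology by blast
  have simps: "carrier (add_monoid (reduced_homology K d)) = carrier (reduced_homology K d)"
    "carrier (add_monoid (reduced_homology K' d')) = carrier (reduced_homology K' d')"
    by simp_all
  have "f \<in> iso (add_monoid (reduced_homology K d)) (add_monoid (reduced_homology K' d'))"
    unfolding iso_def mem_Collect_eq
  proof
    show "f \<in> hom (add_monoid (reduced_homology K d)) (add_monoid (reduced_homology K' d'))"
    proof (rule homI)
      fix X
      assume "X \<in> carrier (add_monoid (reduced_homology K d))"
      then obtain x y where "X = ?t x" "R x y"
        using rep unfolding simps by blast
      then show "f X \<in> carrier (add_monoid (reduced_homology K' d'))"
        using f R_cycles by (auto simp: carrier_reduced_homology)
    next
      fix X X'
      assume "X \<in> carrier (add_monoid (reduced_homology K d))" "X' \<in> carrier (add_monoid (reduced_homology K d))"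
      then obtain x y x' y' where "X = ?t x" "R x y" "X' = ?t x'" "R x' y'"
        using rep[of X] rep[of X'] unfolding simps by blast
      then show "f (X \<otimes>\<^bsub>add_monoid (reduced_homology K d)\<^esub> X') =
          f X \<otimes>\<^bsub>add_monoid (reduced_homology K' d')\<^esub> f X'"
        using f[of x y] f[of x' y'] f[OF R_add[of x y x' y']] by (simp add: K.add_coset K'.add_coset)
    qed
    show "bij_betw f (carrier (add_monoid (reduced_homology K d))) (carrier (add_monoid (reduced_homology K' d')))"
      unfolding bij_betw_def
    proof
      show "inj_on f (carrier (add_monoid (reduced_homology K d)))"
      proof (rule inj_onI)
        fix X X'
        assume "X \<in> carrier (add_monoid (reduced_homology K d))" "X' \<in> carrier (add_monoid (reduced_homology K d))"
          and eq: "f X = f X'"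
        then obtain x y x' y' where x: "X = ?t x" "R x y" "X' = ?t x'" "R x' y'"
          using rep[of X] rep[of X'] unfolding simps by blast
        then have "?t' y = ?t' y'"
          using f eq by metis
        then have "y - y' \<in> boundaries K' d'"
          using K'.coset_self[of y] K'.coset_iff by blast
        then have "x - x' \<in> boundaries K d"
          using R_kernel[OF R_diff[OF x(2,4)]] by simp
        then show "X = X'"
          unfolding x by (rule K.coset_eqI)
      qed
      show "f ` carrier (add_monoid (reduced_homology K d)) = carrier (add_monoid (reduced_homology K' d'))"
      proof (intro equalityI subsetI)
        fix Y
        assume "Y \<in> f ` carrier (add_monoid (reduced_homology K d))"
        then obtain x y where "Y = f (?t x)" "R x y"
          using rep unfolding simps by blast
        then show "Y \<in> carrier (add_monoid (reduced_homology K' d'))"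
          unfolding simps unfolding carrier_reduced_homology using f[of x y] R_cycles[of x y] by blast
      next
        fix Y
        assume "Y \<in> carrier (add_monoid (reduced_homology K' d'))"
        then obtain x y where "Y = ?t' y" "R x y"
          using rep'[of Y] unfolding simps by blast
        then show "Y \<in> f ` carrier (add_monoid (reduced_homology K d))"
          unfolding simps unfolding carrier_reduced_homology using f[of x y] R_cycles[of x y] by blast
      qed
    qed
  qed
  moreover have "f (a \<odot>\<^bsub>reduced_homology K d\<^esub> X) = a \<odot>\<^bsub>reduced_homology K' d'\<^esub> f X"
    if X: "X \<in> carrier (reduced_homology K d)" for a X
  proof -
    obtain x y where "X = ?t x" "R x y"
      using rep[OF X] by blast
    then show ?thesis
      using f[of x y] f[OF R_scale[of x y a]] by (simp add: K.smult_coset K'.smult_coset)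
  qed
  moreover have "f (homology_action act g X) =
      tensor_character (reduced_homology K' d') (homology_action act') \<chi> g (f X)"
    if g: "g \<in> carrier G" and X: "X \<in> carrier (reduced_homology K d)" for g X
  proof -
    obtain x y where "X = ?t x" "R x y"
      using rep[OF X] by blast
    then show ?thesis
      using f[of x y] f[OF R_act[OF g, of x y]] act[OF g] act'[OF g]
      by (simp add: K.action_coset K'.action_coset K'.smult_coset tensor_character_def)
  qed
  ultimately show ?thesis
    unfolding rep_isomorphic_def by (intro bexI[of _ f] conjI allI ballI)
qed


section \<open>Harmonic chains and combinatorial Alexander duality\<close>

definition alexander_dual :: "'a set \<Rightarrow> 'a set set \<Rightarrow> 'a set set" where
  "alexander_dual E D = {A. A \<subseteq> E \<and> E - A \<notin> D}"

locale alexander_pair = finite_complex E D for E :: "'a set" and D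
begin

abbreviation "N \<equiv> alexander_dual E D"

lemma finite_complex_N: "finite_complex E N"
proof
  show "T \<in> N" if "S \<in> N" "T \<subseteq> S" for S T
    using that face_down[of "E - T" "E - S"] by (auto simp: alexander_dual_def)
qed (auto simp: alexander_dual_def finite_V)

end

sublocale alexander_pair \<subseteq> P: finite_complex E "Pow E"
  using finite_V by (rule finite_complex_Pow)

sublocale alexander_pair \<subseteq> N: finite_complex E N
  by (rule finite_complex_N)

context alexander_pair
begin

lemma chain_Pow: "c \<in> oriented_chains D d \<Longrightarrow> c \<in> oriented_chains (Pow E) d"
  by (rule oriented_chains_mono) (auto dest: face_subset)

lemma dual_chain_Pow: "c \<in> oriented_chains N d \<Longrightarrow> c \<in> oriented_chains (Pow E) d"
  by (rule oriented_chains_mono) (auto simp: alexander_dual_def)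

lemma complement_list:
  assumes "distinct ys" "set ys \<subseteq> E"
  obtains xs where "distinct (xs @ ys)" "set (xs @ ys) = E" "set xs = E - set ys"
    "int (length xs) = int (card E) - int (length ys)"
proof -
  let ?xs = "enum (E - set ys)"
  have xs: "distinct (?xs @ ys)" "set (?xs @ ys) = E" "set ?xs = E - set ys"
    using enum[of "E - set ys"] finite_V assms by auto
  moreover have "length ?xs + length ys = card E"
    using distinct_card[OF xs(1)] xs(2) by simp
  ultimately show ?thesis
    using that by fastforce
qed

text \<open>
  A cycle that is orthogonal to all boundaries of \<open>D\<close>.  By adjointness the orthogonality says that the
  coboundary vanishes on \<open>D\<close>, and by \<open>boundary_star_eq_0_iff\<close> this means that the boundary of the star
  vanishes outside \<open>N\<close>.  In this form invariance under symmetries is immediate.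
\<close>

definition harmonic :: "int \<Rightarrow> ('a list \<Rightarrow> complex) \<Rightarrow> bool" where
  "harmonic d h \<longleftrightarrow> h \<in> cycles D d \<and> boundary (star E h) \<in> oriented_chains N (int (card E) - 3 - d)"

lemma harmonic_representative:
  assumes c: "c \<in> cycles D d"
  obtains h where "harmonic d h" "c - h \<in> boundaries D d"
proof -
  have c': "c \<in> oriented_chains D d" "boundary c = 0"
    using c by (auto simp: cycles_def)
  obtain v where v: "v \<in> oriented_chains D (d + 1)"
    and cob: "\<And>ys. distinct ys \<Longrightarrow> set ys \<in> D \<Longrightarrow> int (length ys) = d + 2 \<Longrightarrow>
      coboundary (erase {} (c - boundary v)) ys = 0"
    using relative_harmonic_representative[OF c'(1), of "{}"] by blast
  define h where "h = c - boundary v"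
  have bv: "boundary v \<in> boundaries D d"
    using v by (auto simp: boundaries_def)
  have h: "h \<in> cycles D d"
    unfolding h_def using c bv boundaries_subset by (intro cycles_diff) auto
  then have hP: "h \<in> oriented_chains (Pow E) d"
    by (simp add: cycles_def chain_Pow)
  have bs: "boundary (star E h) \<in> oriented_chains (Pow E) (int (card E) - 3 - d)"
    using P.boundary_chain[OF star_chain[OF finite_V hP]] by (simp add: algebra_simps)
  have "set ys \<in> N" if nz: "boundary (star E h) ys \<noteq> 0" for ys
  proof -
    have ys: "distinct ys" "set ys \<subseteq> E" "int (length ys) = int (card E) - 3 - d + 1"
      using P.chain_support[OF bs nz] alternating_imp_distinct[OF P.chain_alternating[OF bs] nz] by auto
    obtain xs where xs: "distinct (xs @ ys)" "set (xs @ ys) = E" "set xs = E - set ys"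
      "int (length xs) = int (card E) - int (length ys)"
      using complement_list[OF ys(1,2)] .
    have "coboundary h xs \<noteq> 0"
      using boundary_star_eq_0_iff[OF finite_V hP xs(1,2)] nz by simp
    moreover have "erase {} h = h"
      by (simp add: erase_def fun_eq_iff)
    ultimately have "set xs \<notin> D"
      using cob[of xs] xs ys(3) by (auto simp: h_def)
    then show ?thesis
      using xs ys by (simp add: alexander_dual_def)
  qed
  then have "boundary (star E h) \<in> oriented_chains N (int (card E) - 3 - d)"
    using bs by (auto simp: N.chains_iff P.chains_iff)
  then show ?thesis
    using that[of h] h bv by (simp add: harmonic_def h_def)
qed

lemma harmonic_boundary_eq_0:
  assumes "harmonic d h" "h \<in> boundaries D d"
  shows "h = 0"
proof -
  have h: "h \<in> oriented_chains D d" and bs: "boundary (star E h) \<in> oriented_chains N (int (card E) - 3 - d)"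
    using assms(1) by (auto simp: harmonic_def cycles_def)
  obtain v where v: "v \<in> oriented_chains D (d + 1)" "h = boundary v"
    using assms(2) by (auto simp: boundaries_def)
  show ?thesis
  proof (rule relative_harmonic_unique[OF h v(1), of "{}"])
    fix ys
    assume ys: "distinct ys" "set ys \<in> D" "int (length ys) = d + 2"
    obtain xs where xs: "distinct (xs @ ys)" "set (xs @ ys) = E" "set xs = E - set ys"
      using complement_list[OF ys(1) face_subset[OF ys(2)]] by metis
    have "E - set xs = set ys"
      using xs face_subset[OF ys(2)] by auto
    then have "set xs \<notin> N"
      using ys by (simp add: alexander_dual_def)
    then have "boundary (star E h) xs = 0"
      using N.chain_support[OF bs] by blast
    moreover have "distinct (ys @ xs)" "set (ys @ xs) = E"
      using xs by auto
    ultimately show "coboundary h ys = 0"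
      using boundary_star_eq_0_iff[OF finite_V chain_Pow[OF h]] by blast
  qed (use v in auto)
qed

text \<open>
  The star operator turns harmonic chains of \<open>D\<close> into harmonic chains of the full simplex relative to
  \<open>N\<close>, and each relative cycle is homologous to one of these.
\<close>

lemma harmonic_representative_dual:
  assumes w: "w \<in> oriented_chains (Pow E) (int (card E) - 2 - d)"
    and bw: "boundary w \<in> oriented_chains N (int (card E) - 3 - d)"
  obtains h v where "harmonic d h" "v \<in> oriented_chains (Pow E) (int (card E) - 1 - d)"
    "w - boundary v - star E h \<in> oriented_chains N (int (card E) - 2 - d)"
proof -
  define k where "k = int (card E) - 2 - d"
  have deg: "int (card E) - 3 - d = k - 1" "int (card E) - 1 - d = k + 1" "int (card E) - 2 - k = d"
    by (simp_all add: k_def)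
  have wk: "w \<in> oriented_chains (Pow E) k"
    using w by (simp add: k_def)
  obtain v where v: "v \<in> oriented_chains (Pow E) (k + 1)"
    and cob: "\<And>ys. distinct ys \<Longrightarrow> set ys \<in> Pow E \<Longrightarrow> int (length ys) = k + 2 \<Longrightarrow>
      coboundary (erase N (w - boundary v)) ys = 0"
    using P.relative_harmonic_representative[OF wk, of N] by blast
  define w' where "w' = erase N (w - boundary v)"
  have bv: "boundary v \<in> oriented_chains (Pow E) k"
    using P.boundary_chain[OF v] by simp
  have w': "w' \<in> oriented_chains (Pow E) k"
    unfolding w'_def by (intro P.erase_chain P.chain_diff wk bv)
  have diff: "w - boundary v - w' \<in> oriented_chains N k"
    unfolding w'_def by (intro P.diff_erase_chain finite_complex_N P.chain_diff wk bv)
  \<comment> \<open>The star operator is its own inverse up to this sign.\<close>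
  define e :: complex where "e = (- 1) ^ (nat (k + 1) * (card E - nat (k + 1)))"
  have ee: "e * e = 1"
    by (simp add: e_def flip: power_mult_distrib)
  define h where "h = scale e (star E w')"
  have star_h: "star E h = w'"
    unfolding h_def star_scale star_star[OF finite_V w'] using ee by (simp add: e_def)
  have sw': "star E w' \<in> oriented_chains (Pow E) d"
    using star_chain[OF finite_V w'] deg by simp
  have "set xs \<in> D" if nz: "star E w' xs \<noteq> 0" for xs
  proof -
    obtain zs where zs: "distinct (zs @ xs)" "set (zs @ xs) = E" "w' zs \<noteq> 0"
      by (rule star_support[OF finite_V nz])
    then have "set zs \<notin> N"
      by (auto simp: w'_def erase_def)
    moreover have "set zs \<subseteq> E" "E - set zs = set xs"
      using zs(1,2) by auto
    ultimately show ?thesis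
      by (simp add: alexander_dual_def)
  qed
  then have sw'D: "star E w' \<in> oriented_chains D d"
    using sw' by (auto simp: chains_iff P.chains_iff)
  have "boundary (star E w') xs = 0" for xs
  proof (rule ccontr)
    assume nz: "boundary (star E w') xs \<noteq> 0"
    note bsw' = P.boundary_chain[OF sw']
    have xs: "distinct xs" "set xs \<subseteq> E" "int (length xs) = d - 1 + 1"
      using P.chain_support[OF bsw' nz] alternating_imp_distinct[OF P.chain_alternating[OF bsw'] nz] by auto
    obtain ys where ys: "distinct (ys @ xs)" "set (ys @ xs) = E" "set ys = E - set xs"
      "int (length ys) = int (card E) - int (length xs)"
      using complement_list[OF xs(1,2)] .
    have "coboundary w' ys = 0"
      unfolding w'_def using ys xs by (intro cob) (auto simp: k_def)
    then show False
      using nz boundary_star_eq_0_iff[OF finite_V w' ys(1,2)] by simp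
  qed
  then have "h \<in> cycles D d"
    unfolding h_def by (intro cycles_scale) (auto simp: cycles_def sw'D)
  moreover have "boundary w' = boundary w - boundary (w - boundary v - w')"
    using P.boundary_boundary[OF v]
    by (simp add: P.boundary_diff[OF P.chain_diff[OF wk bv] w'] P.boundary_diff[OF wk bv])
  then have "boundary w' \<in> oriented_chains N (k - 1)"
    using N.chain_diff N.boundary_chain[OF diff] bw deg by metis
  ultimately have "harmonic d h"
    by (simp add: harmonic_def star_h deg)
  then show ?thesis
    using that v diff star_h deg by (simp add: k_def)
qed

text \<open>
  If the star of \<open>h\<close> is a boundary modulo \<open>N\<close>, then it vanishes, since it is also a cocycle.
\<close>

lemma harmonic_dual_boundary_eq_0:
  assumes "harmonic d h" "v \<in> oriented_chains (Pow E) (int (card E) - 1 - d)"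
    "star E h - boundary v \<in> oriented_chains N (int (card E) - 2 - d)"
  shows "h = 0"
proof -
  define k where "k = int (card E) - 2 - d"
  have h: "h \<in> oriented_chains D d" "boundary h = 0"
    using assms(1) by (auto simp: harmonic_def cycles_def)
  have hP: "h \<in> oriented_chains (Pow E) d"
    by (rule chain_Pow[OF h(1)])
  have sh: "star E h \<in> oriented_chains (Pow E) k"
    using star_chain[OF finite_V hP] by (simp add: k_def)
  have ss: "star E (star E h) = scale ((- 1) ^ (nat (d + 1) * (card E - nat (d + 1)))) h"
    by (rule star_star[OF finite_V hP])
  have "star E h = 0"
  proof (rule P.relative_harmonic_unique[OF sh, of v N])
    show "v \<in> oriented_chains (Pow E) (k + 1)"
      using assms(2) by (simp add: k_def algebra_simps)
    show "star E h xs = 0" if N: "set xs \<in> N" for xs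
    proof (rule ccontr)
      assume "star E h xs \<noteq> 0"
      then obtain zs where zs: "distinct (zs @ xs)" "set (zs @ xs) = E" "h zs \<noteq> 0"
        by (rule star_support[OF finite_V])
      then have "set zs \<in> D" "E - set xs = set zs"
        using chain_support[OF h(1)] by auto
      then show False
        using N by (simp add: alexander_dual_def)
    qed
    show "star E h xs = boundary v xs" if "set xs \<notin> N" for xs
      using N.chain_support[OF assms(3), of xs] that by auto
    show "coboundary (star E h) ys = 0"
      if ys: "distinct ys" "set ys \<in> Pow E" "int (length ys) = k + 2" for ys
    proof -
      obtain xs where xs: "distinct (xs @ ys)" "set (xs @ ys) = E"
        using complement_list[OF ys(1)] ys(2) by (metis Pow_iff)
      then have xs': "distinct (ys @ xs)" "set (ys @ xs) = E"
        by auto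
      have "boundary (star E (star E h)) = 0"
        unfolding ss P.boundary_scale[OF hP] h(2) by simp
      then show ?thesis
        using boundary_star_eq_0_iff[OF finite_V sh xs'] by simp
    qed
  qed
  then have "scale ((- 1) ^ (nat (d + 1) * (card E - nat (d + 1)))) h = 0"
    using ss by simp
  then show ?thesis
    by (auto simp: fun_eq_iff)
qed

text \<open>
  The full simplex is a cone with apex any of its vertices.
\<close>

lemma Pow_acyclic:
  assumes "E \<noteq> {}" "c \<in> oriented_chains (Pow E) d" "boundary c = 0"
  obtains u where "u \<in> oriented_chains (Pow E) (d + 1)" "c = boundary u"
proof -
  obtain e where e: "e \<in> E"
    using assms(1) by blast
  have empty: "finite_complex E {}"
    by unfold_locales (auto simp: finite_V)
  interpret L: finite_complex E "{}"
    by (rule empty)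
  have "\<exists>u\<in>oriented_chains (Pow E) (d + 1). c - boundary u \<in> oriented_chains {} d"
    by (rule P.relative_acyclic[OF empty, of "\<lambda>_. e" "\<lambda>_. 0"]) (use assms e L.chain_0 in auto)
  then obtain u where u: "u \<in> oriented_chains (Pow E) (d + 1)" "c - boundary u \<in> oriented_chains {} d"
    by blast
  have "c - boundary u = 0"
    using L.chain_support[OF u(2)] by (auto simp: fun_eq_iff)
  then show ?thesis
    using that u(1) by simp
qed

end


section \<open>Duality through a common overcomplex\<close>

text \<open>
  Alexander duality combined with a comparison of the dual complex \<open>N\<close> with another complex \<open>Q\<close>, given
  by a complex \<open>J\<close> on the disjoint sum of the vertex sets that contains both and is acyclic relative to
  each of them.  A harmonic chain \<open>h\<close> of \<open>D\<close> corresponds to the cycles \<open>z\<close> of \<open>Q\<close> that are homologous in \<open>J\<close>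
  to the boundary of the star of \<open>h\<close>.  Acyclicity relative to \<open>Q\<close> makes \<open>z\<close> exist and be unique up to boundaries,
  and acyclicity relative to \<open>N\<close> together with that of the full simplex does the same for \<open>h\<close>.
\<close>

theorem homology_duality:
  fixes E :: "'a set" and D :: "'a set set" and Q :: "'b set set" and J :: "('a + 'b) set set"
    and G :: "'g monoid" and act :: "'g \<Rightarrow> 'a \<Rightarrow> 'a" and act' :: "'g \<Rightarrow> 'b \<Rightarrow> 'b"
  assumes "finite_complex E D" "E \<noteq> {}" "finite_complex W Q" "finite_complex V J"
    and sub_N: "(`) Inl ` alexander_dual E D \<subseteq> J" and sub_Q: "(`) Inr ` Q \<subseteq> J"
    and acyclic_N: "\<And>d c. c \<in> oriented_chains J d \<Longrightarrow> boundary c \<in> oriented_chains ((`) Inl ` alexander_dual E D) (d - 1) \<Longrightarrow>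
      \<exists>u\<in>oriented_chains J (d + 1). c - boundary u \<in> oriented_chains ((`) Inl ` alexander_dual E D) d"
    and acyclic_Q: "\<And>d c. c \<in> oriented_chains J d \<Longrightarrow> boundary c \<in> oriented_chains ((`) Inr ` Q) (d - 1) \<Longrightarrow>
      \<exists>u\<in>oriented_chains J (d + 1). c - boundary u \<in> oriented_chains ((`) Inr ` Q) d"
    and act: "\<And>g. g \<in> carrier G \<Longrightarrow> bij (act g) \<and> act g ` E = E \<and> (`) (act g) ` D = D"
    and act': "\<And>g. g \<in> carrier G \<Longrightarrow> bij (act' g) \<and> (`) (act' g) ` Q = Q"
    and act_J: "\<And>g S. g \<in> carrier G \<Longrightarrow> S \<in> J \<Longrightarrow> map_sum (act g) (act' g) ` S \<in> J"
  shows "rep_isomorphic G (reduced_homology D (int (card E) - 3 - i)) (homology_action act)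
    (reduced_homology Q i)
    (tensor_character (reduced_homology Q i) (homology_action act') (\<lambda>g. of_int (sign_on E (act g))))"
proof -
  interpret D: alexander_pair E D
    unfolding alexander_pair_def by fact
  interpret Q: finite_complex W Q by fact
  interpret J: finite_complex V J by fact
  define d where "d = int (card E) - 3 - i"
  have deg: "int (card E) - 3 - d = i" "int (card E) - 2 - d = i + 1" "int (card E) - 1 - d = i + 2"
    by (simp_all add: d_def)
  let ?N = "alexander_dual E D"
  let ?i = "push Inl :: ('a list \<Rightarrow> complex) \<Rightarrow> ('a + 'b) list \<Rightarrow> complex"
  let ?j = "push Inr :: ('b list \<Rightarrow> complex) \<Rightarrow> ('a + 'b) list \<Rightarrow> complex"
  let ?x = "\<lambda>h. boundary (star E h)"
  have inl: "inj (Inl :: 'a \<Rightarrow> 'a + 'b)" and inr: "inj (Inr :: 'b \<Rightarrow> 'a + 'b)"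
    by auto
  have i_chain: "?i c \<in> oriented_chains ((`) Inl ` ?N) k" "?i c \<in> oriented_chains J k"
    if "c \<in> oriented_chains ?N k" for c k
    using push_chain[OF inl that, of "(`) Inl ` ?N"] oriented_chains_mono[OF sub_N] by auto
  have j_chain: "?j c \<in> oriented_chains ((`) Inr ` Q) k" "?j c \<in> oriented_chains J k"
    if "c \<in> oriented_chains Q k" for c k
    using push_chain[OF inr that, of "(`) Inr ` Q"] oriented_chains_mono[OF sub_Q] by auto
  have i_surj: "\<exists>x\<in>oriented_chains ?N k. ?i x = c" if "c \<in> oriented_chains ((`) Inl ` ?N) k" for c k
    using push_surj[OF inl that, of ?N] by blast
  have j_surj: "\<exists>x\<in>oriented_chains Q k. ?j x = c" if "c \<in> oriented_chains ((`) Inr ` Q) k" for c k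
    using push_surj[OF inr that, of Q] by blast
  have zero_N: "(0 :: ('a + 'b) list \<Rightarrow> complex) \<in> oriented_chains ((`) Inl ` ?N) k" for k
    using i_chain(1)[OF D.N.chain_0] by simp
  have zero_Q: "(0 :: ('a + 'b) list \<Rightarrow> complex) \<in> oriented_chains ((`) Inr ` Q) k" for k
    using j_chain(1)[OF Q.chain_0] by simp
  have harm: "h \<in> oriented_chains D d" "boundary h = 0" "h \<in> cycles D d"
    "star E h \<in> oriented_chains (Pow E) (i + 1)" "?x h \<in> oriented_chains ?N i" "boundary (?x h) = 0"
    if h: "D.harmonic d h" for h
  proof -
    show "h \<in> oriented_chains D d" "boundary h = 0" "h \<in> cycles D d"
      using h by (auto simp: D.harmonic_def cycles_def)
    then show sh: "star E h \<in> oriented_chains (Pow E) (i + 1)"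
      using star_chain[OF D.finite_V D.chain_Pow, of h d] deg by simp
    show "?x h \<in> oriented_chains ?N i"
      using h deg by (simp add: D.harmonic_def)
    show "boundary (?x h) = 0"
      by (rule D.P.boundary_boundary[OF sh])
  qed
  define R where "R c z \<longleftrightarrow> c \<in> cycles D d \<and> z \<in> cycles Q i \<and>
    (\<exists>h. D.harmonic d h \<and> c - h \<in> boundaries D d \<and> ?i (?x h) - ?j z \<in> boundaries J i)" for c z
  have "rep_isomorphic G (reduced_homology D d) (homology_action act) (reduced_homology Q i)
    (tensor_character (reduced_homology Q i) (homology_action act') (\<lambda>g. of_int (sign_on E (act g))))"
  proof (rule rep_isomorphic_relation[of E D W Q G act act' R])
    show "finite_complex E D" "finite_complex W Q"
      by fact+
    show "bij (act g) \<and> (`) (act g) ` D = D" "bij (act' g) \<and> (`) (act' g) ` Q = Q" if "g \<in> carrier G" for g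
      using act[OF that] act'[OF that] by auto
    show "c \<in> cycles D d \<and> z \<in> cycles Q i" if "R c z" for c z
      using that by (simp add: R_def)
    show "R (c + c') (z + z')" if cz: "R c z" "R c' z'" for c z c' z'
    proof -
      obtain h h' where h: "D.harmonic d h" "c - h \<in> boundaries D d" "?i (?x h) - ?j z \<in> boundaries J i"
        and h': "D.harmonic d h'" "c' - h' \<in> boundaries D d" "?i (?x h') - ?j z' \<in> boundaries J i"
        using cz unfolding R_def by blast
      have x: "?x (h + h') = ?x h + ?x h'"
        unfolding star_add by (rule D.P.boundary_add[OF harm(4)[OF h(1)] harm(4)[OF h'(1)]])
      have "D.harmonic d (h + h')"
        unfolding D.harmonic_def x deg(1)
        using D.cycles_add[OF harm(3)[OF h(1)] harm(3)[OF h'(1)]]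
          D.N.chain_add[OF harm(5)[OF h(1)] harm(5)[OF h'(1)]] by blast
      moreover have "c + c' - (h + h') \<in> boundaries D d"
        using D.boundaries_add[OF h(2) h'(2)] by (simp add: algebra_simps)
      moreover have "?i (?x (h + h')) - ?j (z + z') \<in> boundaries J i"
        using J.boundaries_add[OF h(3) h'(3)] unfolding x push_add by (simp add: algebra_simps)
      ultimately show ?thesis
        using cz D.cycles_add Q.cycles_add unfolding R_def by blast
    qed
    show "R (scale a c) (scale a z)" if cz: "R c z" for a c z
    proof -
      obtain h where h: "D.harmonic d h" "c - h \<in> boundaries D d" "?i (?x h) - ?j z \<in> boundaries J i"
        using cz unfolding R_def by blast
      have x: "?x (scale a h) = scale a (?x h)"
        unfolding star_scale by (rule D.P.boundary_scale[OF harm(4)[OF h(1)]])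
      have "D.harmonic d (scale a h)"
        unfolding D.harmonic_def x deg(1)
        using D.cycles_scale[OF harm(3)[OF h(1)]] D.N.chain_scale[OF harm(5)[OF h(1)]] by blast
      moreover have "scale a c - scale a h \<in> boundaries D d"
        using D.boundaries_scale[OF h(2)] by (simp add: scale_diff_right)
      moreover have "?i (?x (scale a h)) - ?j (scale a z) \<in> boundaries J i"
        using J.boundaries_scale[OF h(3)] unfolding x push_scale by (simp add: scale_diff_right)
      ultimately show ?thesis
        using cz D.cycles_scale Q.cycles_scale unfolding R_def by blast
    qed
    show "\<exists>z. R c z" if c: "c \<in> cycles D d" for c
    proof -
      obtain h where h: "D.harmonic d h" "c - h \<in> boundaries D d"
        using D.harmonic_representative[OF c] .
      have "boundary (?i (?x h)) = 0"
        unfolding boundary_push[OF inl] harm(6)[OF h(1)] by simp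
      then obtain u where u: "u \<in> oriented_chains J (i + 1)"
        "?i (?x h) - boundary u \<in> oriented_chains ((`) Inr ` Q) i"
        using acyclic_Q[OF i_chain(2)[OF harm(5)[OF h(1)]]] zero_Q by auto
      then obtain z where z: "z \<in> oriented_chains Q i" "?j z = ?i (?x h) - boundary u"
        using j_surj by blast
      have bu: "boundary u \<in> oriented_chains J i"
        using J.boundary_chain[OF u(1)] unfolding add_diff_cancel_right' .
      have "?j (boundary z) = boundary (?i (?x h) - boundary u)"
        by (simp add: z(2) flip: boundary_push[OF inr])
      also have "\<dots> = ?j 0"
        using J.boundary_diff[OF i_chain(2)[OF harm(5)[OF h(1)]] bu] J.boundary_boundary[OF u(1)]
          \<open>boundary (?i (?x h)) = 0\<close> by simp
      finally have "boundary z = 0"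
        by (rule push_inject[OF inr])
      then have "z \<in> cycles Q i"
        using z by (simp add: cycles_def)
      moreover have "?i (?x h) - ?j z = boundary u"
        using z(2) by simp
      then have "?i (?x h) - ?j z \<in> boundaries J i"
        using u(1) by (simp add: boundaries_def)
      ultimately show ?thesis
        using c h unfolding R_def by blast
    qed
    show "\<exists>c. R c z" if z: "z \<in> cycles Q i" for z
    proof -
      have z': "z \<in> oriented_chains Q i" "boundary z = 0"
        using z by (auto simp: cycles_def)
      have bz: "boundary (?j z) = 0"
        unfolding boundary_push[OF inr] z'(2) by simp
      then obtain u where u: "u \<in> oriented_chains J (i + 1)"
        "?j z - boundary u \<in> oriented_chains ((`) Inl ` ?N) i"
        using acyclic_N[OF j_chain(2)[OF z'(1)]] zero_N by auto
      then obtain x where x: "x \<in> oriented_chains ?N i" "?i x = ?j z - boundary u"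
        using i_surj by blast
      have bu: "boundary u \<in> oriented_chains J i"
        using J.boundary_chain[OF u(1)] unfolding add_diff_cancel_right' .
      have "?i (boundary x) = boundary (?j z - boundary u)"
        by (simp add: x(2) flip: boundary_push[OF inl])
      also have "\<dots> = ?i 0"
        using J.boundary_diff[OF j_chain(2)[OF z'(1)] bu] J.boundary_boundary[OF u(1)] bz by simp
      finally have "boundary x = 0"
        by (rule push_inject[OF inl])
      then obtain w where w: "w \<in> oriented_chains (Pow E) (i + 1)" "x = boundary w"
        using D.Pow_acyclic[OF \<open>E \<noteq> {}\<close> D.dual_chain_Pow[OF x(1)]] by blast
      obtain h v where h: "D.harmonic d h" and v: "v \<in> oriented_chains (Pow E) (i + 1 + 1)"
        and y: "w - boundary v - star E h \<in> oriented_chains ?N (i + 1)"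
        using D.harmonic_representative_dual[of w d] w x(1) deg by (auto simp: add.assoc)
      define y where "y = w - boundary v - star E h"
      have bv: "boundary v \<in> oriented_chains (Pow E) (i + 1)"
        using D.P.boundary_chain[OF v] unfolding add_diff_cancel_right' .
      have bd_y: "boundary y = x - ?x h"
        unfolding y_def D.P.boundary_diff[OF D.P.chain_diff[OF w(1) bv] harm(4)[OF h]]
          D.P.boundary_diff[OF w(1) bv] D.P.boundary_boundary[OF v] w(2) by simp
      have iy: "?i y \<in> oriented_chains J (i + 1)"
        using i_chain(2)[OF y] by (simp add: y_def)
      have "?i (?x h) = ?i x - ?i (boundary y)"
        by (simp add: bd_y flip: push_diff)
      then have "?i (?x h) - ?j z = boundary (0 - u - ?i y)"
        using J.boundary_diff[OF J.chain_diff[OF J.chain_0 u(1)] iy] J.boundary_diff[OF J.chain_0 u(1)]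
        by (simp add: x(2) boundary_push[OF inl])
      then have "?i (?x h) - ?j z \<in> boundaries J i"
        unfolding boundaries_def using J.chain_diff[OF J.chain_diff[OF J.chain_0 u(1)] iy] by blast
      then have "R h z"
        unfolding R_def using h z harm(3)[OF h] D.boundaries_0 by (metis diff_self)
      then show ?thesis
        by blast
    qed
    show "R c z" if c: "c \<in> boundaries D d" and z: "z \<in> boundaries Q i" for c z
    proof -
      obtain t where t: "t \<in> oriented_chains Q (i + 1)" "z = boundary t"
        using z by (auto simp: boundaries_def)
      have "D.harmonic d 0"
        using D.chain_0 D.N.chain_0 by (simp add: D.harmonic_def cycles_def)
      moreover have "?i (?x 0) - ?j z = boundary (0 - ?j t)"
        using J.boundary_diff[OF J.chain_0 j_chain(2)[OF t(1)]] by (simp add: t(2) boundary_push[OF inr])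
      then have "?i (?x 0) - ?j z \<in> boundaries J i"
        unfolding boundaries_def using J.chain_diff[OF J.chain_0 j_chain(2)[OF t(1)]] by blast
      ultimately show ?thesis
        unfolding R_def using c z D.boundaries_subset Q.boundaries_subset
        by (metis diff_zero subsetD)
    qed
    show "c \<in> boundaries D d \<longleftrightarrow> z \<in> boundaries Q i" if cz: "R c z" for c z
    proof -
      obtain h u where h: "D.harmonic d h" "c - h \<in> boundaries D d"
        and u: "u \<in> oriented_chains J (i + 1)" "?i (?x h) - ?j z = boundary u"
        using cz unfolding R_def boundaries_def by blast
      have z: "z \<in> oriented_chains Q i" "boundary z = 0"
        using cz by (auto simp: R_def cycles_def)
      show ?thesis
      proof
        assume "c \<in> boundaries D d"
        then have "c - (c - h) \<in> boundaries D d"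
          using h(2) by (rule D.boundaries_diff)
        then have "h = 0"
          using D.harmonic_boundary_eq_0[OF h(1)] by simp
        then have bu: "boundary u = ?j (0 - z)"
          using u(2) by (simp only: push_diff boundary_0 star_0 push_0)
        then have "boundary u \<in> oriented_chains ((`) Inr ` Q) (i + 1 - 1)"
          using j_chain(1)[OF Q.chain_diff[OF Q.chain_0 z(1)]] by simp
        then obtain u' where u': "u' \<in> oriented_chains J (i + 1 + 1)"
          "u - boundary u' \<in> oriented_chains ((`) Inr ` Q) (i + 1)"
          using acyclic_Q[OF u(1)] by blast
        then obtain t where t: "t \<in> oriented_chains Q (i + 1)" "?j t = u - boundary u'"
          using j_surj by blast
        have bu': "boundary u' \<in> oriented_chains J (i + 1)"
          using J.boundary_chain[OF u'(1)] unfolding add_diff_cancel_right' .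
        have "?j (boundary (0 - t)) = ?j 0 - boundary (?j t)"
          by (simp only: Q.boundary_diff[OF Q.chain_0 t(1)] push_diff boundary_push[OF inr] boundary_0)
        also have "\<dots> = ?j z"
          unfolding t(2) J.boundary_diff[OF u(1) bu'] J.boundary_boundary[OF u'(1)] bu push_diff by simp
        finally have "z = boundary (0 - t)"
          using push_inject[OF inr] by metis
        then show "z \<in> boundaries Q i"
          unfolding boundaries_def using Q.chain_diff[OF Q.chain_0 t(1)] by blast
      next
        assume "z \<in> boundaries Q i"
        then obtain t where t: "t \<in> oriented_chains Q (i + 1)" "z = boundary t"
          by (auto simp: boundaries_def)
        note jt = j_chain(2)[OF t(1)]
        define u2 where "u2 = u + ?j t"
        have u2: "u2 \<in> oriented_chains J (i + 1)"
          unfolding u2_def by (rule J.chain_add[OF u(1) jt])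
        have bu2: "boundary u2 = ?i (?x h)"
          unfolding u2_def J.boundary_add[OF u(1) jt] boundary_push[OF inr] t(2)[symmetric] u(2)[symmetric]
          by simp
        then have "boundary u2 \<in> oriented_chains ((`) Inl ` ?N) (i + 1 - 1)"
          using i_chain(1)[OF harm(5)[OF h(1)]] by simp
        then obtain u' where u': "u' \<in> oriented_chains J (i + 1 + 1)"
          "u2 - boundary u' \<in> oriented_chains ((`) Inl ` ?N) (i + 1)"
          using acyclic_N[OF u2] by blast
        then obtain y where y: "y \<in> oriented_chains ?N (i + 1)" "?i y = u2 - boundary u'"
          using i_surj by blast
        have bu': "boundary u' \<in> oriented_chains J (i + 1)"
          using J.boundary_chain[OF u'(1)] unfolding add_diff_cancel_right' .
        have "?i (boundary y) = boundary (?i y)"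
          by (simp add: boundary_push[OF inl])
        also have "\<dots> = ?i (?x h)"
          unfolding y(2) J.boundary_diff[OF u2 bu'] J.boundary_boundary[OF u'(1)] bu2 by simp
        finally have "boundary y = ?x h"
          by (rule push_inject[OF inl])
        then have "boundary (star E h - y) = 0"
          by (simp add: D.P.boundary_diff[OF harm(4)[OF h(1)] D.dual_chain_Pow[OF y(1)]])
        then obtain v where v: "v \<in> oriented_chains (Pow E) (i + 1 + 1)" "star E h - y = boundary v"
          using D.Pow_acyclic[OF \<open>E \<noteq> {}\<close> D.P.chain_diff[OF harm(4)[OF h(1)] D.dual_chain_Pow[OF y(1)]]]
          by blast
        have "star E h - boundary v = y"
          by (simp flip: v(2))
        then have "h = 0"
          using D.harmonic_dual_boundary_eq_0[OF h(1), of v] v(1) y(1) deg by (simp add: add.assoc)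
        then show "c \<in> boundaries D d"
          using h(2) by simp
      qed
    qed
    show "R (push (act g) c) (scale (of_int (sign_on E (act g))) (push (act' g) z))"
      if g: "g \<in> carrier G" and cz: "R c z" for g c z
    proof -
      \<comment> \<open>The relation scales \<open>z\<close> by the sign because the star operator commutes with \<open>g\<close> only up to sign.\<close>
      let ?a = "act g" and ?b = "act' g" and ?s = "of_int (sign_on E (act g)) :: complex"
      let ?ab = "map_sum ?a ?b"
      have a: "bij ?a" "?a ` E = E" "(`) ?a ` D = D" and b: "bij ?b" "(`) ?b ` Q = Q"
        using act[OF g] act'[OF g] by auto
      have ia: "inj ?a" and ib: "inj ?b"
        using a b by (auto simp: bij_is_inj)
      then have iab: "inj ?ab"
        by (simp add: sum.inj_map)
      have fN: "?a ` S \<in> ?N" if S: "S \<in> ?N" for S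
      proof -
        have "E - ?a ` S = ?a ` (E - S)"
          using a(2) image_set_diff[OF ia, of E S] by simp
        moreover have "?a ` (E - S) \<in> D \<Longrightarrow> E - S \<in> D"
          using a(3) inj_image_eq_iff[OF ia] by (metis imageE)
        ultimately show ?thesis
          using S a(2) image_mono[of S E ?a] by (auto simp: alexander_dual_def)
      qed
      have push_cycles: "push f c \<in> cycles K k"
        if "inj f" "c \<in> cycles K k" "\<And>S. S \<in> K \<Longrightarrow> f ` S \<in> K" for f :: "'c \<Rightarrow> 'c" and c K k
        using that push_chain[OF that(1)] by (auto simp: cycles_def boundary_push)
      obtain h u where h: "D.harmonic d h" "c - h \<in> boundaries D d"
        and u: "u \<in> oriented_chains J (i + 1)" "?i (?x h) - ?j z = boundary u"
        using cz unfolding R_def boundaries_def by blast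
      have cyc: "c \<in> cycles D d" "z \<in> cycles Q i"
        using cz by (auto simp: R_def)
      have x: "?x (push ?a h) = scale ?s (push ?a (?x h))"
      proof -
        have "push ?a (star E h) \<in> oriented_chains (Pow E) (i + 1)"
          using harm(4)[OF h(1)] a(2) by (intro push_chain[OF ia]) auto
        then show ?thesis
          unfolding star_push[OF D.finite_V ia a(2) D.chain_alternating[OF harm(1)[OF h(1)]]]
          by (simp add: D.P.boundary_scale boundary_push[OF ia])
      qed
      have harm': "D.harmonic d (push ?a h)"
        unfolding D.harmonic_def x deg
        using push_cycles[OF ia harm(3)[OF h(1)]] a(3)
          D.N.chain_scale[OF push_chain[OF ia harm(5)[OF h(1)] fN]] by blast
      have "push ?a c - push ?a h = push ?a (c - h)"
        by (simp add: push_diff)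
      then have c': "push ?a c - push ?a h \<in> boundaries D d"
        using D.boundaries_push[OF a(1,3)] h(2) by auto
      have comp: "?ab \<circ> Inl = Inl \<circ> ?a" "?ab \<circ> Inr = Inr \<circ> ?b"
        by auto
      have pu: "push ?ab u \<in> oriented_chains J (i + 1)"
        by (rule push_chain[OF iab u(1) act_J[OF g]])
      have "?i (?x (push ?a h)) - ?j (scale ?s (push ?b z)) =
          scale ?s (?i (push ?a (?x h)) - ?j (push ?b z))"
        by (simp add: x push_scale scale_diff_right)
      also have "\<dots> = scale ?s (push ?ab (?i (?x h) - ?j z))"
        by (simp add: push_diff push_push[OF inl iab] push_push[OF inr iab] push_push[OF ia inl]
            push_push[OF ib inr] comp)
      also have "\<dots> = boundary (scale ?s (push ?ab u))"
        by (simp add: u(2) J.boundary_scale[OF pu] boundary_push[OF iab])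
      finally have "?i (?x (push ?a h)) - ?j (scale ?s (push ?b z)) \<in> boundaries J i"
        unfolding boundaries_def using J.chain_scale[OF pu] by blast
      moreover have "push ?a c \<in> cycles D d"
        using push_cycles[OF ia cyc(1)] a(3) by blast
      moreover have "scale ?s (push ?b z) \<in> cycles Q i"
        using Q.cycles_scale[OF push_cycles[OF ib cyc(2)]] b(2) by blast
      ultimately show ?thesis
        unfolding R_def using harm' c' by blast
    qed
  qed
  then show ?thesis
    by (simp add: d_def)
qed


section \<open>Connected edge sets and their partitions into components\<close>

definition adj :: "'v set set \<Rightarrow> 'v \<Rightarrow> 'v \<Rightarrow> bool" where
  "adj A u v \<longleftrightarrow> {u, v} \<in> A"

abbreviation reach :: "'v set set \<Rightarrow> 'v \<Rightarrow> 'v \<Rightarrow> bool" where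
  "reach A \<equiv> (adj A)\<^sup>*\<^sup>*"

lemma reach_sym:
  assumes "reach A u v"
  shows "reach A v u"
proof -
  have "(adj A)\<inverse>\<inverse> = adj A"
    by (simp add: fun_eq_iff adj_def insert_commute)
  then show ?thesis
    using rtranclp_converseI[OF assms] by simp
qed

lemma reach_mono:
  assumes "A \<subseteq> B" "reach A u v"
  shows "reach B u v"
proof -
  have "adj A x y \<longrightarrow> adj B x y" for x y
    using assms(1) by (auto simp: adj_def)
  then show ?thesis
    by (rule mono_rtranclp[THEN mp, OF _ assms(2)])
qed

text \<open>
  The rest of a cycle through the edge \<open>{a, b}\<close> is a path between its endpoints.
\<close>

lemma cycle_imp_reach:
  assumes "3 \<le> length vs" "distinct vs" "cycle_edges vs \<subseteq> insert {a, b} A" "{a, b} \<in> cycle_edges vs"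
  shows "reach A a b"
proof -
  let ?n = "length vs"
  let ?v = "\<lambda>k. vs ! (k mod ?n)"
  obtain i where i: "i < ?n" and ab: "{a, b} = {vs ! i, vs ! (Suc i mod ?n)}"
    using assms(4) by (auto simp: cycle_edges_def)
  have n: "0 < ?n"
    using assms(1) by linarith
  have inj: "?v j = ?v k \<longleftrightarrow> j mod ?n = k mod ?n" for j k
    using assms(2) n by (simp add: nth_eq_iff_index_eq)
  \<comment> \<open>Walk around the cycle, starting right after the edge \<open>{a, b}\<close>; length at least three ensures that no
    other edge of the cycle has the same endpoints.\<close>
  have step: "adj A (?v (Suc i + k)) (?v (Suc i + Suc k))" if k: "Suc k < ?n" for k
  proof -
    have "{?v (Suc i + k), ?v (Suc i + Suc k)} \<in> cycle_edges vs"
      unfolding cycle_edges_def using n by (auto intro!: exI[of _ "(Suc i + k) mod ?n"] simp: mod_Suc_eq)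
    moreover have "{?v (Suc i + k), ?v (Suc i + Suc k)} \<noteq> {a, b}"
    proof
      assume "{?v (Suc i + k), ?v (Suc i + Suc k)} = {a, b}"
      then have eq: "{?v (Suc i + k), ?v (Suc i + Suc k)} = {?v i, ?v (Suc i)}"
        using ab i by simp
      have md: "j mod ?n = (if j < ?n then j else j - ?n)" if "j < 2 * ?n" for j
        using that by (simp add: mod_if)
      have md': "(Suc i + k) mod ?n = (if Suc i + k < ?n then Suc i + k else Suc i + k - ?n)"
        "(Suc i + Suc k) mod ?n = (if Suc i + Suc k < ?n then Suc i + Suc k else Suc i + Suc k - ?n)"
        "Suc i mod ?n = (if Suc i < ?n then Suc i else Suc i - ?n)" "i mod ?n = i"
        using k i md[of "Suc i + k"] md[of "Suc i + Suc k"] md[of "Suc i"] by simp_all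
      have 1: "(Suc i + k) mod ?n \<noteq> i mod ?n"
        unfolding md' using k i by (simp split: if_split; linarith)
      have 2: "(Suc i + Suc k) mod ?n \<noteq> Suc i mod ?n"
        unfolding md' using k i by (simp split: if_split; linarith)
      have 3: "(Suc i + k) mod ?n = Suc i mod ?n \<Longrightarrow> (Suc i + Suc k) mod ?n \<noteq> i mod ?n"
        unfolding md' using k i assms(1) by (simp split: if_splits; linarith)
      show False
        using eq 1 2 3 inj by (metis doubleton_eq_iff)
    qed
    ultimately show ?thesis
      using assms(3) by (auto simp: adj_def)
  qed
  have "reach A (?v (Suc i)) (?v (Suc i + k))" if "k < ?n" for k
    using that
  proof (induction k)
    case (Suc k)
    then show ?case
      using step[of k] by (metis Suc_lessD rtranclp.rtrancl_into_rtrancl)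
  qed simp
  from this[of "?n - 1"] have "reach A (?v (Suc i)) (?v i)"
    using n i by (simp add: Suc_diff_Suc)
  then show ?thesis
    using ab i reach_sym by (auto simp: doubleton_eq_iff)
qed

text \<open>
  A path without repeated vertices, closed up by the edge \<open>{a, b}\<close>; it has at least three vertices since
  \<open>{a, b}\<close> is not itself in \<open>A\<close>.
\<close>

lemma reach_imp_cycle:
  assumes "reach A a b" "a \<noteq> b" "{a, b} \<notin> A"
  obtains vs where "3 \<le> length vs" "distinct vs" "cycle_edges vs \<subseteq> insert {a, b} A"
proof -
  obtain xs where xs: "rtrancl_path (adj A) a xs b" "distinct (a # xs)"
    using assms(1) rtranclp_eq_rtrancl_path[of "adj A"] rtrancl_path_distinct[of "adj A"] by metis
  have ne: "xs \<noteq> []"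
    using xs(1) assms(2) by (auto elim: rtrancl_path.cases)
  then have last: "last xs = b"
    using rtrancl_path_last[OF xs(1)] by simp
  have len: "length xs \<noteq> Suc 0"
  proof
    assume "length xs = Suc 0"
    then have "xs = [b]"
      using last by (cases xs) auto
    then show False
      using rtrancl_path_nth[OF xs(1), of 0] assms(3) by (simp add: adj_def)
  qed
  have "cycle_edges (a # xs) \<subseteq> insert {a, b} A"
  proof
    fix e
    assume "e \<in> cycle_edges (a # xs)"
    then obtain i where i: "i < Suc (length xs)" and e: "e = {(a # xs) ! i, (a # xs) ! (Suc i mod Suc (length xs))}"
      by (auto simp: cycle_edges_def)
    show "e \<in> insert {a, b} A"
    proof (cases "i < length xs")
      case True
      then show ?thesis
        using rtrancl_path_nth[OF xs(1) True] e by (simp add: adj_def)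
    next
      case False
      then have "i = length xs"
        using i by simp
      then have "e = {last xs, a}"
        using e ne by (simp add: last_conv_nth nth_Cons')
      then show ?thesis
        using last by (simp add: insert_commute)
    qed
  qed
  moreover have "3 \<le> length (a # xs)"
    using len ne by (cases xs; cases "tl xs") auto
  ultimately show ?thesis
    using that[of "a # xs"] xs(2) by blast
qed

definition connected_on :: "'v set \<Rightarrow> 'v set set \<Rightarrow> bool" where
  "connected_on V A \<longleftrightarrow> (\<forall>u\<in>V. \<forall>v\<in>V. reach A u v)"

lemma connected_on_mono: "A \<subseteq> B \<Longrightarrow> connected_on V A \<Longrightarrow> connected_on V B"
  unfolding connected_on_def by (intro ballI reach_mono[of A B]) simp_all

lemma edge_cases:
  assumes "e \<in> complete_graph_edges m"
  obtains a b where "e = {a, b}" "a \<noteq> b" "a \<in> {1..m}" "b \<in> {1..m}"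
proof -
  have "e \<subseteq> {1..m}" "card e = 2"
    using assms by (simp_all add: complete_graph_edges_def)
  then show ?thesis
    using that unfolding card_2_iff by auto
qed

lemma finite_edges: "finite (complete_graph_edges m)"
  by (rule finite_subset[of _ "Pow {1..m}"]) (auto simp: complete_graph_edges_def)

text \<open>
  Joining two components by an edge creates no cycle, so a maximal forest has only one component.
\<close>

lemma basis_connected:
  assumes "B \<in> matroid_bases (cycle_matroid_indep (complete_graph_edges m))"
  shows "connected_on {1..m} B"
  unfolding connected_on_def
proof (intro ballI, rule ccontr)
  let ?E = "complete_graph_edges m"
  fix u v
  assume uv: "u \<in> {1..m}" "v \<in> {1..m}" and nr: "\<not> reach B u v"
  then have "u \<noteq> v" "{u, v} \<notin> B"
    by (auto simp: adj_def)
  have B: "B \<subseteq> ?E" "\<And>vs. 3 \<le> length vs \<Longrightarrow> distinct vs \<Longrightarrow> \<not> cycle_edges vs \<subseteq> B"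
    and max: "\<And>B'. B' \<in> cycle_matroid_indep ?E \<Longrightarrow> B \<subseteq> B' \<Longrightarrow> B' = B"
    using assms by (auto simp: matroid_bases_def cycle_matroid_indep_def)
  have "\<not> cycle_edges vs \<subseteq> insert {u, v} B" if "3 \<le> length vs" "distinct vs" for vs
    using cycle_imp_reach[OF that, of u v B] nr B(2)[OF that] by blast
  moreover have "{u, v} \<in> ?E"
    using uv \<open>u \<noteq> v\<close> by (auto simp: complete_graph_edges_def)
  ultimately have "insert {u, v} B \<in> cycle_matroid_indep ?E"
    using B(1) by (auto simp: cycle_matroid_indep_def)
  then show False
    using max \<open>{u, v} \<notin> B\<close> by blast
qed

text \<open>
  A maximal forest \<open>B\<close> inside \<open>A\<close> connects whatever \<open>A\<close> connects.  As \<open>A\<close> is connected, any further edge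
  closes a cycle, so \<open>B\<close> is maximal among all forests of the complete graph.
\<close>

lemma connected_contains_basis:
  assumes "A \<subseteq> complete_graph_edges m" "connected_on {1..m} A"
  obtains B where "B \<in> matroid_bases (cycle_matroid_indep (complete_graph_edges m))" "B \<subseteq> A"
proof -
  let ?E = "complete_graph_edges m"
  let ?F = "{B. B \<subseteq> A \<and> B \<in> cycle_matroid_indep ?E}"
  have "finite A"
    using assms(1) finite_edges finite_subset by blast
  then have "finite ?F"
    by simp
  moreover have "{} \<in> ?F"
  proof -
    have "\<not> cycle_edges vs \<subseteq> {}" if "3 \<le> length vs" for vs :: "nat list"
      using that unfolding cycle_edges_def by (cases vs) auto
    then show ?thesis
      by (auto simp: cycle_matroid_indep_def)
  qed
  ultimately obtain B where B: "B \<in> ?F" and "\<forall>B'\<in>?F. B \<subseteq> B' \<longrightarrow> B = B'"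
    using finite_has_maximal[of ?F] by blast
  then have max: "\<And>B'. B' \<in> ?F \<Longrightarrow> B \<subseteq> B' \<Longrightarrow> B' = B"
    by blast
  have acyclic: "\<And>vs. 3 \<le> length vs \<Longrightarrow> distinct vs \<Longrightarrow> \<not> cycle_edges vs \<subseteq> B"
    using B by (auto simp: cycle_matroid_indep_def)
  have adj: "reach B a b" if ab: "adj A a b" for a b
  proof (cases "{a, b} \<in> B")
    case True
    then show ?thesis
      by (auto simp: adj_def)
  next
    case False
    have "insert {a, b} B \<notin> cycle_matroid_indep ?E"
      using max[of "insert {a, b} B"] B ab False by (auto simp: adj_def)
    moreover have "insert {a, b} B \<subseteq> ?E"
      using B ab assms(1) by (auto simp: adj_def)
    ultimately obtain vs where vs: "3 \<le> length vs" "distinct vs" "cycle_edges vs \<subseteq> insert {a, b} B"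
      unfolding cycle_matroid_indep_def by blast
    then have "{a, b} \<in> cycle_edges vs"
      using acyclic[OF vs(1,2)] by blast
    then show ?thesis
      by (rule cycle_imp_reach[OF vs])
  qed
  have reach: "reach B u v" if "reach A u v" for u v
    using that by (induction rule: rtranclp_induct) (use adj in \<open>auto intro: rtranclp_trans\<close>)
  have "B \<in> matroid_bases (cycle_matroid_indep ?E)"
    unfolding matroid_bases_def
  proof (intro CollectI conjI ballI impI)
    show "B \<in> cycle_matroid_indep ?E"
      using B by blast
    fix B'
    assume B': "B' \<in> cycle_matroid_indep ?E" "B \<subseteq> B'"
    show "B' = B"
    proof (rule ccontr)
      assume "B' \<noteq> B"
      then obtain e where e: "e \<in> B'" "e \<notin> B"
        using B'(2) by blast
      then have "e \<in> ?E"
        using B'(1) by (auto simp: cycle_matroid_indep_def)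
      then obtain a b where ab: "e = {a, b}" "a \<noteq> b" "a \<in> {1..m}" "b \<in> {1..m}"
        by (rule edge_cases)
      then have "reach B a b"
        using assms(2) reach by (auto simp: connected_on_def)
      then obtain vs where "3 \<le> length vs" "distinct vs" "cycle_edges vs \<subseteq> insert {a, b} B"
        using reach_imp_cycle[of B a b] ab e by metis
      moreover have "insert {a, b} B \<subseteq> B'"
        using B'(2) e ab by auto
      ultimately show False
        using B'(1) unfolding cycle_matroid_indep_def by blast
    qed
  qed
  then show ?thesis
    using that B by blast
qed

lemma IN_dual_complete_iff:
  "A \<in> IN_dual_complete m \<longleftrightarrow>
     A \<subseteq> complete_graph_edges m \<and> connected_on {1..m} (complete_graph_edges m - A)"
proof
  let ?E = "complete_graph_edges m"
  assume "A \<in> IN_dual_complete m"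
  then obtain B where B: "B \<in> matroid_bases (cycle_matroid_indep ?E)" "A \<subseteq> ?E - B"
    by (auto simp: IN_dual_complete_def dual_matroid_indep_def)
  moreover have "B \<subseteq> ?E"
    using B(1) by (auto simp: matroid_bases_def cycle_matroid_indep_def)
  ultimately have "B \<subseteq> ?E - A"
    by blast
  then show "A \<subseteq> ?E \<and> connected_on {1..m} (?E - A)"
    using B basis_connected[OF B(1)] connected_on_mono[of B "?E - A"] by blast
next
  let ?E = "complete_graph_edges m"
  assume A: "A \<subseteq> ?E \<and> connected_on {1..m} (?E - A)"
  then obtain B where "B \<in> matroid_bases (cycle_matroid_indep ?E)" "B \<subseteq> ?E - A"
    using connected_contains_basis[of "?E - A" m] by blast
  then show "A \<in> IN_dual_complete m"
    using A by (auto simp: IN_dual_complete_def dual_matroid_indep_def)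
qed

lemma finite_complex_IN_dual: "finite_complex (complete_graph_edges m) (IN_dual_complete m)"
proof
  show "T \<in> IN_dual_complete m" if "S \<in> IN_dual_complete m" "T \<subseteq> S" for S T
    using that connected_on_mono[of "complete_graph_edges m - S" "complete_graph_edges m - T"]
    by (auto simp: IN_dual_complete_iff)
qed (auto simp: IN_dual_complete_iff finite_edges)

lemma alexander_dual_IN:
  "alexander_dual (complete_graph_edges m) (IN_dual_complete m) =
     {A. A \<subseteq> complete_graph_edges m \<and> \<not> connected_on {1..m} A}"
proof -
  have "connected_on {1..m} (complete_graph_edges m - (complete_graph_edges m - A)) \<longleftrightarrow> connected_on {1..m} A"
    if "A \<subseteq> complete_graph_edges m" for A
    using double_diff[OF that subset_refl] by simp
  then show ?thesis
    unfolding alexander_dual_def IN_dual_complete_iff by blast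
qed

definition components :: "'v set \<Rightarrow> 'v set set \<Rightarrow> 'v set set" where
  "components V A = (\<lambda>u. {v \<in> V. reach A u v}) ` V"

lemma partition_on_components: "partition_on V (components V A)"
proof (rule partition_onI)
  show "\<Union> (components V A) = V"
    by (auto simp: components_def)
  show "disjnt p q" if "p \<in> components V A" "q \<in> components V A" "p \<noteq> q" for p q
  proof (rule ccontr)
    assume "\<not> disjnt p q"
    then obtain w where w: "w \<in> p" "w \<in> q"
      by (auto simp: disjnt_def)
    have eq: "reach A u v \<longleftrightarrow> reach A w v" if "reach A u w" for u v
      using rtranclp_trans[of "adj A" w u v] rtranclp_trans[of "adj A" u w v] that reach_sym[OF that] by blast
    have eq_class: "r = {v \<in> V. reach A w v}" if r: "r \<in> components V A" "w \<in> r" for r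
    proof -
      obtain u where u: "r = {v \<in> V. reach A u v}"
        using r(1) by (auto simp: components_def)
      then have "reach A u w"
        using r(2) by simp
      then show ?thesis
        unfolding u using eq by blast
    qed
    show False
      using eq_class[OF that(1) w(1)] eq_class[OF that(2) w(2)] that(3) by simp
  qed
  show "{} \<notin> components V A"
    by (auto simp: components_def)
qed

definition edges_within :: "'v set set \<Rightarrow> 'v set set \<Rightarrow> bool" where
  "edges_within A P \<longleftrightarrow> (\<forall>e\<in>A. \<exists>b\<in>P. e \<subseteq> b)"

lemma within_components:
  assumes "A \<subseteq> complete_graph_edges m"
  shows "edges_within A (components {1..m} A)"
  unfolding edges_within_def
proof
  fix e
  assume e: "e \<in> A"
  then obtain a b where ab: "e = {a, b}" "a \<in> {1..m}" "b \<in> {1..m}"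
    using assms by (meson edge_cases subsetD)
  then have "e \<subseteq> {v \<in> {1..m}. reach A a v}"
    using e by (auto simp: adj_def)
  then show "\<exists>c\<in>components {1..m} A. e \<subseteq> c"
    using ab by (auto simp: components_def)
qed

text \<open>
  The partition into components is the closure of \<open>A\<close> in the lattice of flats: the finest partition
  whose blocks contain all edges of \<open>A\<close>.
\<close>

lemma components_refines:
  assumes "partition_on V P" "edges_within A P"
  shows "refines V (components V A) P"
  unfolding refines_def
proof (intro conjI ballI partition_on_components assms(1))
  fix X
  assume "X \<in> components V A"
  then obtain u where u: "u \<in> V" and X: "X = {v \<in> V. reach A u v}"
    by (auto simp: components_def)
  obtain b where b: "b \<in> P" "u \<in> b"
    using u partition_onD1[OF assms(1)] by blast
  have "v \<in> b" if "reach A u v" for v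
    using that
  proof (induction rule: rtranclp_induct)
    case (step v w)
    then obtain b' where "b' \<in> P" "{v, w} \<subseteq> b'"
      using assms(2) by (auto simp: edges_within_def adj_def)
    then show ?case
      using step b partition_onD2[OF assms(1)] by (metis disjointD disjoint_iff insert_subset)
  qed (rule b)
  then show "\<exists>Y\<in>P. X \<subseteq> Y"
    using b X by blast
qed

lemma components_eq_top_iff:
  assumes "m \<ge> 1"
  shows "components {1..m} A = partition_top m \<longleftrightarrow> connected_on {1..m} A"
proof
  assume top: "components {1..m} A = partition_top m"
  have "reach A u v" if "u \<in> {1..m}" "v \<in> {1..m}" for u v
  proof -
    have "{v \<in> {1..m}. reach A u v} \<in> partition_top m"
      using that unfolding top[symmetric] components_def by blast
    then have "{v \<in> {1..m}. reach A u v} = {1..m}"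
      by (simp only: partition_top_def singleton_iff)
    then show ?thesis
      using that(2) by blast
  qed
  then show "connected_on {1..m} A"
    by (auto simp: connected_on_def)
next
  assume "connected_on {1..m} A"
  then have "{v \<in> {1..m}. reach A u v} = {1..m}" if "u \<in> {1..m}" for u
    using that unfolding connected_on_def by blast
  then have "components {1..m} A = (\<lambda>u. {1..m}) ` {1..m}"
    unfolding components_def by (intro image_cong refl)
  then show "components {1..m} A = partition_top m"
    using assms by (simp add: partition_top_def image_constant_conv)
qed

lemma components_neq_bot:
  assumes "A \<subseteq> complete_graph_edges m" "A \<noteq> {}"
  shows "components {1..m} A \<noteq> partition_bot m"
proof
  assume bot: "components {1..m} A = partition_bot m"
  obtain e where e: "e \<in> A"
    using assms(2) by blast
  then obtain a b where ab: "e = {a, b}" "a \<noteq> b"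
    using assms(1) by (meson edge_cases subsetD)
  obtain c where "c \<in> components {1..m} A" "e \<subseteq> c"
    using within_components[OF assms(1)] e by (auto simp: edges_within_def)
  then show False
    using ab unfolding bot partition_bot_def by auto
qed

text \<open>
  This guarantees that inserting an edge inside the blocks of a proper partition keeps the edge set
  disconnected.
\<close>

lemma within_proper_disconnected:
  assumes "m \<ge> 1" "P \<in> partition_lattice m" "P \<noteq> partition_top m" "edges_within A P"
  shows "\<not> connected_on {1..m} A"
proof
  assume "connected_on {1..m} A"
  then have "refines {1..m} (partition_top m) P"
    using components_refines[of "{1..m}" P A] components_eq_top_iff[OF assms(1), of A] assms
    by (simp add: partition_lattice_def)
  then show False
    using refines_asym partition_top_greatest(2)[OF assms(1,2)] assms(3) by metis
qed

lemma within_refines: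
  assumes "edges_within A P" "refines V P Q"
  shows "edges_within A Q"
  unfolding edges_within_def
proof
  fix e
  assume "e \<in> A"
  then obtain b where "b \<in> P" "e \<subseteq> b"
    using assms(1) by (auto simp: edges_within_def)
  then show "\<exists>b\<in>Q. e \<subseteq> b"
    using assms(2) by (metis refines_def order_trans)
qed

lemma non_discrete_edge:
  assumes "P \<in> partition_lattice m" "P \<noteq> partition_bot m"
  obtains e where "e \<in> complete_graph_edges m" "edges_within {e} P"
proof -
  have "\<exists>b\<in>P. \<exists>u\<in>b. \<exists>v\<in>b. u \<noteq> v"
  proof (rule ccontr)
    assume "\<not> ?thesis"
    then have single: "b = {u}" if "b \<in> P" "u \<in> b" for b u
      using that by blast
    have P: "\<Union> P = {1..m}" "{} \<notin> P"
      using assms(1) by (auto simp: partition_lattice_def partition_on_def)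
    have "P = partition_bot m"
    proof (intro equalityI subsetI)
      fix b
      assume b: "b \<in> P"
      then obtain u where "u \<in> b"
        using P(2) by (metis ex_in_conv)
      then have "b = {u}" "u \<in> {1..m}"
        using single[OF b] b P(1) by blast+
      then show "b \<in> partition_bot m"
        unfolding partition_bot_def by blast
    next
      fix b
      assume "b \<in> partition_bot m"
      then obtain u where u: "b = {u}" "u \<in> {1..m}"
        by (auto simp: partition_bot_def)
      then obtain b' where "b' \<in> P" "u \<in> b'"
        using P(1) by blast
      then show "b \<in> P"
        using single u by metis
    qed
    then show False
      using assms(2) by blast
  qed
  then obtain b u v where b: "b \<in> P" "u \<in> b" "v \<in> b" "u \<noteq> v"
    by blast
  then have "{u, v} \<in> complete_graph_edges m"
    using assms(1) by (auto simp: complete_graph_edges_def partition_lattice_def partition_on_def)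
  then show ?thesis
    using that[of "{u, v}"] b by (auto simp: edges_within_def)
qed


section \<open>The complex of edge sets below chains of partitions\<close>

definition proper_partitions :: "nat \<Rightarrow> nat set set set" where
  "proper_partitions m = partition_lattice m - {partition_bot m, partition_top m}"

lemma partition_complex_iff:
  "C \<in> partition_complex m \<longleftrightarrow>
     finite C \<and> C \<subseteq> proper_partitions m \<and> (\<forall>P\<in>C. \<forall>Q\<in>C. refines {1..m} P Q \<or> refines {1..m} Q P)"
  by (simp add: partition_complex_def order_complex_def proper_partitions_def)

lemma finite_complex_partition: "finite_complex (proper_partitions m) (partition_complex m)"
proof
  have "finite (partition_lattice m)"
    by (simp add: partition_lattice_def finitely_many_partition_on)
  then show "finite (proper_partitions m)"
    by (simp add: proper_partitions_def)
  show "S \<subseteq> proper_partitions m" if "S \<in> partition_complex m" for S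
    using that by (simp add: partition_complex_iff)
  show "T \<in> partition_complex m" if "S \<in> partition_complex m" "T \<subseteq> S" for S T
    using that finite_subset[OF that(2)] unfolding partition_complex_iff by blast
qed

definition disconnected_complex :: "nat \<Rightarrow> nat set set set" where
  "disconnected_complex m = {A. A \<subseteq> complete_graph_edges m \<and> \<not> connected_on {1..m} A}"

text \<open>
  The faces are the sets \<open>A \<union> C\<close> where the edge set \<open>A\<close> lies below the chain \<open>C\<close> in the lattice of flats;
  the sum type keeps the two kinds of vertices apart.
\<close>

definition mixed_complex :: "nat \<Rightarrow> (nat set + nat set set) set set" where
  "mixed_complex m = {S. Inl -` S \<in> disconnected_complex m \<and> Inr -` S \<in> partition_complex m \<and>
     (\<forall>P\<in>Inr -` S. edges_within (Inl -` S) P)}"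

lemma disconnected_down: "A \<in> disconnected_complex m \<Longrightarrow> B \<subseteq> A \<Longrightarrow> B \<in> disconnected_complex m"
  using connected_on_mono[of B A] by (auto simp: disconnected_complex_def)

lemma finite_complex_mixed:
  "finite_complex (Inl ` complete_graph_edges m \<union> Inr ` proper_partitions m) (mixed_complex m)"
proof
  interpret Q: finite_complex "proper_partitions m" "partition_complex m"
    by (rule finite_complex_partition)
  show "finite (Inl ` complete_graph_edges m \<union> Inr ` proper_partitions m)"
    using finite_edges Q.finite_V by blast
  show "S \<subseteq> Inl ` complete_graph_edges m \<union> Inr ` proper_partitions m" if "S \<in> mixed_complex m" for S
  proof
    fix x
    assume "x \<in> S"
    then show "x \<in> Inl ` complete_graph_edges m \<union> Inr ` proper_partitions m"
    proof (cases x)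
      case (Inl e)
      then have "e \<in> Inl -` S" "Inl -` S \<subseteq> complete_graph_edges m"
        using that \<open>x \<in> S\<close> by (simp_all add: mixed_complex_def disconnected_complex_def)
      then show ?thesis
        using Inl by blast
    next
      case (Inr P)
      then have "P \<in> Inr -` S" "Inr -` S \<subseteq> proper_partitions m"
        using that \<open>x \<in> S\<close> Q.face_subset[of "Inr -` S"] by (simp_all add: mixed_complex_def)
      then show ?thesis
        using Inr by blast
    qed
  qed
  show "T \<in> mixed_complex m" if "S \<in> mixed_complex m" "T \<subseteq> S" for S T
  proof -
    have sub: "Inl -` T \<subseteq> Inl -` S" "Inr -` T \<subseteq> Inr -` S"
      using that(2) by auto
    have S: "Inl -` S \<in> disconnected_complex m" "Inr -` S \<in> partition_complex m"
      "\<forall>P\<in>Inr -` S. edges_within (Inl -` S) P"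
      using that(1) by (simp_all add: mixed_complex_def)
    have "\<forall>P\<in>Inr -` T. edges_within (Inl -` T) P"
      using S(3) sub unfolding edges_within_def by blast
    then show ?thesis
      using disconnected_down[OF S(1) sub(1)] Q.face_down[OF S(2) sub(2)] by (simp add: mixed_complex_def)
  qed
qed

lemma finite_complex_restrict:
  assumes "finite_complex V K"
  shows "finite_complex V {S \<in> K. f -` S = {}}"
proof -
  interpret finite_complex V K by fact
  show ?thesis
  proof
    fix S T
    assume S: "S \<in> {S \<in> K. f -` S = {}}" and "T \<subseteq> S"
    then have "f -` T \<subseteq> f -` S"
      by (intro vimage_mono)
    then show "T \<in> {S \<in> K. f -` S = {}}"
      using S face_down[OF _ \<open>T \<subseteq> S\<close>] by simp
  qed (simp_all add: finite_V face_subset)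
qed

lemma disconnected_in_mixed:
  "(`) Inl ` disconnected_complex m = {S \<in> mixed_complex m. Inr -` S = {}}"
proof (intro equalityI subsetI)
  fix S :: "(nat set + nat set set) set"
  assume "S \<in> (`) Inl ` disconnected_complex m"
  then obtain A where "A \<in> disconnected_complex m" "S = Inl ` A"
    by blast
  moreover have "Inl -` (Inl ` A :: (nat set + nat set set) set) = A" "Inr -` (Inl ` A :: (nat set + nat set set) set) = {}"
    by auto
  ultimately show "S \<in> {S \<in> mixed_complex m. Inr -` S = {}}"
    by (simp add: mixed_complex_def partition_complex_iff)
next
  fix S :: "(nat set + nat set set) set"
  assume S: "S \<in> {S \<in> mixed_complex m. Inr -` S = {}}"
  have "S = Inl ` (Inl -` S)"
  proof (intro equalityI subsetI)
    fix x
    assume "x \<in> S"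
    then show "x \<in> Inl ` (Inl -` S)"
      using S by (cases x) auto
  qed auto
  moreover have "Inl -` S \<in> disconnected_complex m"
    using S by (simp add: mixed_complex_def)
  ultimately show "S \<in> (`) Inl ` disconnected_complex m"
    by (rule image_eqI)
qed

text \<open>
  For \<open>m = 1\<close> the empty edge set is connected, so that the mixed complex has no faces at all, not even
  the empty one.
\<close>

lemma partitions_in_mixed:
  assumes "m \<ge> 2"
  shows "(`) Inr ` partition_complex m = {S \<in> mixed_complex m. Inl -` S = {}}"
proof (intro equalityI subsetI)
  have "reach {} u v \<Longrightarrow> u = v" for u v :: nat
    by (induction rule: rtranclp_induct) (auto simp: adj_def)
  then have "\<not> reach {} 1 (2 :: nat)"
    by force
  moreover have "1 \<in> {1..m}" "2 \<in> {1..m}"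
    using assms by auto
  ultimately have "\<not> connected_on {1..m} {}"
    unfolding connected_on_def by blast
  then have empty: "{} \<in> disconnected_complex m"
    by (simp add: disconnected_complex_def)
  fix S :: "(nat set + nat set set) set"
  assume "S \<in> (`) Inr ` partition_complex m"
  then obtain C where "C \<in> partition_complex m" "S = Inr ` C"
    by blast
  moreover have "Inr -` (Inr ` C :: (nat set + nat set set) set) = C" "Inl -` (Inr ` C :: (nat set + nat set set) set) = {}"
    by auto
  ultimately show "S \<in> {S \<in> mixed_complex m. Inl -` S = {}}"
    using empty by (simp add: mixed_complex_def edges_within_def)
next
  fix S :: "(nat set + nat set set) set"
  assume S: "S \<in> {S \<in> mixed_complex m. Inl -` S = {}}"
  have "S = Inr ` (Inr -` S)"
  proof (intro equalityI subsetI)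
    fix x
    assume "x \<in> S"
    then show "x \<in> Inr ` (Inr -` S)"
      using S by (cases x) auto
  qed auto
  moreover have "Inr -` S \<in> partition_complex m"
    using S by (simp add: mixed_complex_def)
  ultimately show "S \<in> (`) Inr ` partition_complex m"
    by (rule image_eqI)
qed

lemma vimage_sum_insert:
  "Inl -` insert (Inl x) S = insert x (Inl -` S)" "Inr -` insert (Inl x) S = Inr -` S"
  "Inl -` insert (Inr y) S = Inl -` S" "Inr -` insert (Inr y) S = insert y (Inr -` S)"
  "Inl -` (S - {Inl x}) = Inl -` S - {x}" "Inr -` (S - {Inl x}) = Inr -` S"
  "Inl -` (S - {Inr y}) = Inl -` S" "Inr -` (S - {Inr y}) = Inr -` S - {y}"
  by auto

lemma chain_least:
  assumes "C \<in> partition_complex m" "C \<noteq> {}"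
  shows "\<exists>P\<in>C. \<forall>Q\<in>C. refines {1..m} P Q"
proof -
  have "finite C" "C \<subseteq> partition_lattice m"
    and total: "\<And>P Q. P \<in> C \<Longrightarrow> Q \<in> C \<Longrightarrow> refines {1..m} P Q \<or> refines {1..m} Q P"
    using assms(1) by (auto simp: partition_complex_iff proper_partitions_def)
  have "\<exists>P\<in>D. \<forall>Q\<in>D. refines {1..m} P Q" if D: "D \<subseteq> C" "D \<noteq> {}" "finite D" for D
    using D(3,1,2)
  proof (induction D rule: finite_induct)
    case (insert P D)
    have refl: "refines {1..m} P P"
      using total[of P P] insert.prems by blast
    show ?case
    proof (cases "D = {}")
      case True
      then show ?thesis
        using refl by simp
    next
      case False
      then obtain P0 where P0: "P0 \<in> D" "\<forall>Q\<in>D. refines {1..m} P0 Q"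
        using insert by auto
      then consider "refines {1..m} P P0" | "refines {1..m} P0 P"
        using total[of P P0] insert.prems by blast
      then show ?thesis
        using P0 refl refines_trans[of "{1..m}" P P0] by cases blast+
    qed
  qed simp
  then show ?thesis
    using \<open>finite C\<close> assms(2) by blast
qed

text \<open>
  The toggled vertex is an edge inside a block of the least partition of the chain, which exists since
  that partition is not discrete.  The rank is the length of the chain.
\<close>

lemma mixed_acyclic_disconnected:
  assumes "m \<ge> 1" "c \<in> oriented_chains (mixed_complex m) d"
    "boundary c \<in> oriented_chains ((`) Inl ` disconnected_complex m) (d - 1)"
  shows "\<exists>u\<in>oriented_chains (mixed_complex m) (d + 1).
    c - boundary u \<in> oriented_chains ((`) Inl ` disconnected_complex m) d"
proof -
  let ?V = "Inl ` complete_graph_edges m \<union> Inr ` proper_partitions m"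
  let ?L = "{S \<in> mixed_complex m. Inr -` S = {}}"
  interpret J: finite_complex ?V "mixed_complex m"
    by (rule finite_complex_mixed)
  define edge :: "nat set set set \<Rightarrow> nat set" where
    "edge C = (SOME e. e \<in> complete_graph_edges m \<and> (\<forall>P\<in>C. edges_within {e} P))" for C
  have edge: "edge C \<in> complete_graph_edges m \<and> (\<forall>P\<in>C. edges_within {edge C} P)"
    if C: "C \<in> partition_complex m" "C \<noteq> {}" for C
  proof -
    obtain P where P: "P \<in> C" "\<forall>Q\<in>C. refines {1..m} P Q"
      using chain_least[OF C] by blast
    have "P \<in> partition_lattice m" "P \<noteq> partition_bot m"
      using P(1) C(1) by (auto simp: partition_complex_iff proper_partitions_def)
    then obtain e where "e \<in> complete_graph_edges m" "edges_within {e} P"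
      by (rule non_discrete_edge)
    then have "\<exists>e. e \<in> complete_graph_edges m \<and> (\<forall>P\<in>C. edges_within {e} P)"
      using P within_refines by blast
    then show ?thesis
      unfolding edge_def by (rule someI_ex)
  qed
  have "\<exists>u\<in>oriented_chains (mixed_complex m) (d + 1). c - boundary u \<in> oriented_chains ?L d"
  proof (rule J.relative_acyclic[of ?L "\<lambda>S. Inl (edge (Inr -` S))" "\<lambda>S. card (Inr -` S)" c d])
    show "finite_complex ?V ?L"
      by (rule finite_complex_restrict[OF finite_complex_mixed])
    show "c \<in> oriented_chains (mixed_complex m) d" "boundary c \<in> oriented_chains ?L (d - 1)"
      using assms disconnected_in_mixed[of m] by auto
  next
    fix S
    assume S: "S \<in> mixed_complex m - ?L"
    then have C: "Inr -` S \<in> partition_complex m" "Inr -` S \<noteq> {}" and A: "Inl -` S \<in> disconnected_complex m"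
      and w: "\<And>P. P \<in> Inr -` S \<Longrightarrow> edges_within (Inl -` S) P"
      by (auto simp: mixed_complex_def)
    let ?e = "edge (Inr -` S)"
    have w': "edges_within (insert ?e (Inl -` S)) P" if "P \<in> Inr -` S" for P
      using edge[OF C] w that by (auto simp: edges_within_def)
    obtain P where P: "P \<in> Inr -` S"
      using C(2) by blast
    then have "P \<in> partition_lattice m" "P \<noteq> partition_top m"
      using C(1) by (auto simp: partition_complex_iff proper_partitions_def)
    then have "insert ?e (Inl -` S) \<in> disconnected_complex m"
      using within_proper_disconnected[OF assms(1) _ _ w'[OF P]] edge[OF C] A
      by (auto simp: disconnected_complex_def)
    then show "insert (Inl ?e) S \<in> mixed_complex m"
      using C w' by (simp add: mixed_complex_def vimage_sum_insert del: vimage_insert)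
    show "Inl (edge (Inr -` insert (Inl ?e) S)) = (Inl ?e :: nat set + nat set set) \<and>
        card (Inr -` insert (Inl ?e) S) = card (Inr -` S)"
      by (simp only: vimage_sum_insert)
    show "S - {Inl ?e} \<notin> ?L \<and> Inl (edge (Inr -` (S - {Inl ?e}))) = (Inl ?e :: nat set + nat set set) \<and>
        card (Inr -` (S - {Inl ?e})) = card (Inr -` S)"
      using C(2) by (simp add: vimage_sum_insert)
    fix v
    assume v: "v \<in> S"
    show "card (Inr -` (S - {v})) < card (Inr -` S) \<or>
        card (Inr -` (S - {v})) = card (Inr -` S) \<and> (Inl (edge (Inr -` (S - {v}))) :: nat set + nat set set) = Inl ?e"
    proof (cases v)
      case (Inr P)
      then show ?thesis
        using v C(1) unfolding Inr vimage_sum_insert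
        by (intro disjI1 card_Diff1_less) (auto simp: partition_complex_iff)
    qed (simp add: vimage_sum_insert)
  qed (auto)
  then show ?thesis
    by (simp add: disconnected_in_mixed)
qed

text \<open>
  The toggled vertex is the partition into components of the edge set \<open>A\<close>, which lies below all
  partitions that \<open>A\<close> lies below.  It is proper since \<open>A\<close> is nonempty and disconnected.  The rank is the
  number of edges.
\<close>

lemma mixed_acyclic_partitions:
  assumes "m \<ge> 2" "c \<in> oriented_chains (mixed_complex m) d"
    "boundary c \<in> oriented_chains ((`) Inr ` partition_complex m) (d - 1)"
  shows "\<exists>u\<in>oriented_chains (mixed_complex m) (d + 1).
    c - boundary u \<in> oriented_chains ((`) Inr ` partition_complex m) d"
proof -
  let ?V = "Inl ` complete_graph_edges m \<union> Inr ` proper_partitions m"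
  let ?L = "{S \<in> mixed_complex m. Inl -` S = {}}"
  interpret J: finite_complex ?V "mixed_complex m"
    by (rule finite_complex_mixed)
  have "\<exists>u\<in>oriented_chains (mixed_complex m) (d + 1). c - boundary u \<in> oriented_chains ?L d"
  proof (rule J.relative_acyclic[of ?L "\<lambda>S. Inr (components {1..m} (Inl -` S))" "\<lambda>S. card (Inl -` S)" c d])
    show "finite_complex ?V ?L"
      by (rule finite_complex_restrict[OF finite_complex_mixed])
    show "c \<in> oriented_chains (mixed_complex m) d" "boundary c \<in> oriented_chains ?L (d - 1)"
      using assms partitions_in_mixed[OF assms(1)] by auto
  next
    fix S
    assume S: "S \<in> mixed_complex m - ?L"
    then have C: "Inr -` S \<in> partition_complex m" and A: "Inl -` S \<in> disconnected_complex m" "Inl -` S \<noteq> {}"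
      and w: "\<And>P. P \<in> Inr -` S \<Longrightarrow> edges_within (Inl -` S) P"
      by (auto simp: mixed_complex_def)
    let ?P = "components {1..m} (Inl -` S)"
    have AE: "Inl -` S \<subseteq> complete_graph_edges m" "\<not> connected_on {1..m} (Inl -` S)"
      using A(1) by (auto simp: disconnected_complex_def)
    have "?P \<in> proper_partitions m"
      using components_neq_bot[OF AE(1) A(2)] components_eq_top_iff[of m "Inl -` S"] AE(2) assms(1)
        partition_on_components[of "{1..m}" "Inl -` S"]
      by (simp add: proper_partitions_def partition_lattice_def)
    moreover have "refines {1..m} ?P Q" if "Q \<in> Inr -` S" for Q
      using that C w[OF that] by (intro components_refines)
        (auto simp: partition_complex_iff proper_partitions_def partition_lattice_def)
    ultimately have "insert ?P (Inr -` S) \<in> partition_complex m"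
      using C refines_refl[OF partition_on_components] by (simp add: partition_complex_iff)
    then show "insert (Inr ?P) S \<in> mixed_complex m"
      using A w within_components[OF AE(1)] by (simp add: mixed_complex_def vimage_sum_insert del: vimage_insert)
    show "Inr (components {1..m} (Inl -` insert (Inr ?P) S)) = (Inr ?P :: nat set + nat set set) \<and>
        card (Inl -` insert (Inr ?P) S) = card (Inl -` S)"
      by (simp only: vimage_sum_insert)
    show "S - {Inr ?P} \<notin> ?L \<and> Inr (components {1..m} (Inl -` (S - {Inr ?P}))) = (Inr ?P :: nat set + nat set set) \<and>
        card (Inl -` (S - {Inr ?P})) = card (Inl -` S)"
      using A(2) by (simp add: vimage_sum_insert)
    fix v
    assume v: "v \<in> S"
    show "card (Inl -` (S - {v})) < card (Inl -` S) \<or>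
        card (Inl -` (S - {v})) = card (Inl -` S) \<and>
        (Inr (components {1..m} (Inl -` (S - {v}))) :: nat set + nat set set) = Inr ?P"
    proof (cases v)
      case (Inl e)
      then show ?thesis
        using v finite_subset[OF AE(1) finite_edges] unfolding Inl vimage_sum_insert
        by (intro disjI1 card_Diff1_less) auto
    qed (simp add: vimage_sum_insert)
  qed (auto)
  then show ?thesis
    by (simp add: partitions_in_mixed[OF assms(1)])
qed


section \<open>The action of the symmetric group\<close>

lemma bij_image: "bij f \<Longrightarrow> bij ((`) f)"
  using bij_betw_Pow[of f UNIV UNIV] by simp

lemma image_image_eq:
  assumes "bij f" "finite K" "\<And>S. S \<in> K \<Longrightarrow> f ` S \<in> K"
  shows "(`) f ` K = K"
  using assms(2,3) bij_is_inj[OF bij_image[OF assms(1)]]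
  by (intro endo_inj_surj) (auto intro: inj_on_subset)

lemma bij_edge_action: "bij g \<Longrightarrow> bij (edge_action g)"
  using bij_image by (simp add: edge_action_def[abs_def])

lemma bij_partition_action: "bij g \<Longrightarrow> bij (partition_action g)"
  using bij_image[OF bij_image] by (simp add: partition_action_def[abs_def])

context
  fixes g :: "nat \<Rightarrow> nat" and m :: nat
  assumes g: "g permutes {1..m}"
begin

lemma inj_g: "inj g"
  using permutes_inj[OF g] .

lemma edge_action_edges: "edge_action g ` complete_graph_edges m = complete_graph_edges m"
proof (rule endo_inj_surj[OF finite_edges])
  show "edge_action g ` complete_graph_edges m \<subseteq> complete_graph_edges m"
    using permutes_image[OF g] card_image[OF inj_on_subset[OF inj_g subset_UNIV]]
    by (auto simp: complete_graph_edges_def edge_action_def)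
  show "inj_on (edge_action g) (complete_graph_edges m)"
    using bij_is_inj[OF bij_edge_action[OF permutes_bij[OF g]]] by (rule inj_on_subset) simp
qed

lemma connected_edge_action:
  assumes "connected_on {1..m} A"
  shows "connected_on {1..m} (edge_action g ` A)"
  unfolding connected_on_def
proof (intro ballI)
  have step: "reach (edge_action g ` A) (g u) (g v)" if "reach A u v" for u v
    using that
  proof (induction rule: rtranclp_induct)
    case (step v w)
    then have "edge_action g {v, w} \<in> edge_action g ` A"
      by (intro imageI) (simp add: adj_def)
    then have "adj (edge_action g ` A) (g v) (g w)"
      by (simp add: adj_def edge_action_def)
    then show ?case
      using step by (simp add: rtranclp.rtrancl_into_rtrancl)
  qed simp
  fix u v
  assume "u \<in> {1..m}" "v \<in> {1..m}"
  then have "u \<in> g ` {1..m}" "v \<in> g ` {1..m}"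
    by (simp_all only: permutes_image[OF g])
  then show "reach (edge_action g ` A) u v"
    using assms step by (auto simp: connected_on_def)
qed

lemma IN_dual_edge_action:
  assumes "A \<in> IN_dual_complete m"
  shows "edge_action g ` A \<in> IN_dual_complete m"
proof -
  let ?E = "complete_graph_edges m"
  have A: "A \<subseteq> ?E" "connected_on {1..m} (?E - A)"
    using assms by (auto simp: IN_dual_complete_iff)
  have "?E - edge_action g ` A = edge_action g ` (?E - A)"
    using image_set_diff[OF bij_is_inj[OF bij_edge_action[OF permutes_bij[OF g]]], of ?E A]
    by (simp add: edge_action_edges)
  then have "connected_on {1..m} (?E - edge_action g ` A)"
    using connected_edge_action[OF A(2)] by (simp only:)
  moreover have "edge_action g ` A \<subseteq> ?E"
    using image_mono[OF A(1), of "edge_action g"] by (simp add: edge_action_edges)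
  ultimately show ?thesis
    unfolding IN_dual_complete_iff by blast
qed

lemma partition_on_action:
  assumes "partition_on {1..m} P"
  shows "partition_on {1..m} (partition_action g P)"
proof -
  have "(`) g ` P - {{}} = (`) g ` P"
    using partition_onD3[OF assms] by auto
  then show ?thesis
    using partition_on_inj_image[OF assms inj_on_subset[OF inj_g subset_UNIV]]
    by (simp only: permutes_image[OF g] partition_action_def)
qed

lemma proper_partition_action:
  assumes "P \<in> proper_partitions m"
  shows "partition_action g P \<in> proper_partitions m"
proof -
  have bot: "partition_action g (partition_bot m) = partition_bot m"
  proof -
    have "partition_action g (partition_bot m) = (\<lambda>x. {x}) ` (g ` {1..m})"
      unfolding partition_action_def partition_bot_def image_image by simp
    then show ?thesis
      by (simp only: permutes_image[OF g] partition_bot_def)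
  qed
  have top: "partition_action g (partition_top m) = partition_top m"
    unfolding partition_action_def partition_top_def by (simp only: image_insert image_empty permutes_image[OF g])
  have "inj (partition_action g)"
    using bij_is_inj[OF bij_partition_action[OF permutes_bij[OF g]]] .
  then have "partition_action g P \<noteq> partition_bot m" "partition_action g P \<noteq> partition_top m"
    using assms bot top by (metis DiffE insertCI injD proper_partitions_def)+
  then show ?thesis
    using assms partition_on_action by (auto simp: proper_partitions_def partition_lattice_def)
qed

lemma refines_action: "refines {1..m} P Q \<Longrightarrow> refines {1..m} (partition_action g P) (partition_action g Q)"
  unfolding refines_def
proof (elim conjE, intro conjI ballI)
  fix X
  assume sub: "\<forall>X\<in>P. \<exists>Y\<in>Q. X \<subseteq> Y" and "X \<in> partition_action g P"
  then obtain X' where X': "X' \<in> P" "X = g ` X'"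
    by (auto simp: partition_action_def)
  then obtain Y where "Y \<in> Q" "X' \<subseteq> Y"
    using sub by blast
  then show "\<exists>Y\<in>partition_action g Q. X \<subseteq> Y"
    using X' by (auto simp: partition_action_def)
qed (rule partition_on_action, assumption)+

lemma partition_complex_action:
  assumes "C \<in> partition_complex m"
  shows "partition_action g ` C \<in> partition_complex m"
  unfolding partition_complex_iff
proof (intro conjI ballI)
  have C: "finite C" "C \<subseteq> proper_partitions m" "\<forall>P\<in>C. \<forall>Q\<in>C. refines {1..m} P Q \<or> refines {1..m} Q P"
    using assms by (simp_all add: partition_complex_iff)
  show "finite (partition_action g ` C)"
    using C(1) by simp
  show "partition_action g ` C \<subseteq> proper_partitions m"
    using C(2) proper_partition_action by blast
  show "refines {1..m} P Q \<or> refines {1..m} Q P"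
    if "P \<in> partition_action g ` C" "Q \<in> partition_action g ` C" for P Q
    using that C(3) refines_action by blast
qed

lemma disconnected_edge_action:
  assumes "A \<in> disconnected_complex m"
  shows "edge_action g ` A \<in> disconnected_complex m"
proof -
  have "(`) (edge_action g) ` IN_dual_complete m = IN_dual_complete m"
    using finite_complex_IN_dual[of m] finite_edges[of m]
    by (intro image_image_eq bij_edge_action permutes_bij[OF g] IN_dual_edge_action)
      (auto simp: finite_complex_def intro: finite_subset[of _ "Pow (complete_graph_edges m)"])
  have inj: "inj (edge_action g)"
    using bij_is_inj[OF bij_edge_action[OF permutes_bij[OF g]]] .
  let ?E = "complete_graph_edges m"
  have A: "A \<subseteq> ?E" "?E - A \<notin> IN_dual_complete m"
    using assms by (auto simp: disconnected_complex_def IN_dual_complete_iff double_diff)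
  have "?E - edge_action g ` A = edge_action g ` (?E - A)"
    using image_set_diff[OF inj, of ?E A] by (simp add: edge_action_edges)
  moreover have "edge_action g ` (?E - A) \<notin> IN_dual_complete m"
    using A(2) inj_image_eq_iff[OF inj] \<open>(`) (edge_action g) ` IN_dual_complete m = IN_dual_complete m\<close>
    by (metis imageE)
  ultimately have notin: "?E - edge_action g ` A \<notin> IN_dual_complete m"
    by simp
  have gA: "edge_action g ` A \<subseteq> ?E"
    using image_mono[OF A(1), of "edge_action g"] by (simp add: edge_action_edges)
  then have "edge_action g ` A \<in> alexander_dual ?E (IN_dual_complete m)"
    using notin by (simp add: alexander_dual_def)
  then show ?thesis
    by (simp add: alexander_dual_IN disconnected_complex_def)
qed

lemma mixed_complex_action:
  assumes "S \<in> mixed_complex m"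
  shows "map_sum (edge_action g) (partition_action g) ` S \<in> mixed_complex m"
proof -
  let ?S = "map_sum (edge_action g) (partition_action g) ` S"
  have "Inl -` ?S = edge_action g ` (Inl -` S)"
  proof (intro equalityI subsetI)
    fix e
    assume "e \<in> Inl -` ?S"
    then obtain x where "x \<in> S" "Inl e = map_sum (edge_action g) (partition_action g) x"
      by blast
    then show "e \<in> edge_action g ` (Inl -` S)"
      by (cases x) auto
  qed force
  moreover have "Inr -` ?S = partition_action g ` (Inr -` S)"
  proof (intro equalityI subsetI)
    fix P
    assume "P \<in> Inr -` ?S"
    then obtain x where "x \<in> S" "Inr P = map_sum (edge_action g) (partition_action g) x"
      by blast
    then show "P \<in> partition_action g ` (Inr -` S)"
      by (cases x) auto
  qed force
  moreover have "edges_within (edge_action g ` A) (partition_action g P)" if "edges_within A P" for A P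
    using that by (auto simp: edges_within_def edge_action_def partition_action_def) (meson image_mono)
  ultimately show ?thesis
    using assms disconnected_edge_action partition_complex_action by (auto simp: mixed_complex_def)
qed

end


section \<open>The isomorphism\<close>

theorem theorem25:
  fixes m n :: nat and i :: int
  assumes "m \<ge> 1" and "n = m choose 2" and "i \<ge> 0"
  shows "rep_isomorphic (sym_group m)
           (reduced_homology (IN_dual_complete m) (int n - 3 - i))
           (homology_action edge_action)
           (reduced_homology (partition_complex m) i)
           (tensor_character (reduced_homology (partition_complex m) i)
             (homology_action partition_action) (edge_sgn m))"
proof -
  let ?E = "complete_graph_edges m" and ?D = "IN_dual_complete m" and ?Q = "partition_complex m"
  interpret D: finite_complex ?E ?D
    by (rule finite_complex_IN_dual)
  interpret Q: finite_complex "proper_partitions m" ?Q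
    by (rule finite_complex_partition)
  have n: "card ?E = n"
    using n_subsets[of "{1..m}" 2] by (simp add: complete_graph_edges_def assms(2))
  have act: "bij (edge_action g) \<and> edge_action g ` ?E = ?E \<and> (`) (edge_action g) ` ?D = ?D"
    "bij (partition_action g) \<and> (`) (partition_action g) ` ?Q = ?Q"
    "S \<in> mixed_complex m \<Longrightarrow> map_sum (edge_action g) (partition_action g) ` S \<in> mixed_complex m"
    if "g \<in> carrier (sym_group m)" for g S
  proof -
    have g: "g permutes {1..m}"
      using that by (simp add: sym_group_def)
    have "bij g"
      by (rule permutes_bij[OF g])
    then show "bij (edge_action g) \<and> edge_action g ` ?E = ?E \<and> (`) (edge_action g) ` ?D = ?D"
      using IN_dual_edge_action[OF g] edge_action_edges[OF g]
      by (intro conjI image_image_eq bij_edge_action D.finite_K) auto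
    show "bij (partition_action g) \<and> (`) (partition_action g) ` ?Q = ?Q"
      using partition_complex_action[OF g] \<open>bij g\<close>
      by (intro conjI image_image_eq bij_partition_action Q.finite_K) auto
    show "S \<in> mixed_complex m \<Longrightarrow> map_sum (edge_action g) (partition_action g) ` S \<in> mixed_complex m"
      by (rule mixed_complex_action[OF g])
  qed
  show ?thesis
  proof (cases "m = 1")
    case True
    \<comment> \<open>Here the lattice has one element and the edge set is empty, so both homology groups vanish in the
      given degrees.\<close>
    have "partition_lattice 1 \<subseteq> {partition_top 1}"
    proof
      fix P
      assume "P \<in> partition_lattice 1"
      then have P: "\<Union> P = {1}" "{} \<notin> P"
        by (auto simp: partition_lattice_def partition_on_def)
      then have "b = {1}" if "b \<in> P" for b
        using that by (metis Union_upper subset_singletonD)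
      then have "P = {{1}}"
        using P by auto
      then show "P \<in> {partition_top 1}"
        by (simp add: partition_top_def)
    qed
    then have Q1: "C = {}" if "C \<in> ?Q" for C
      using that by (auto simp: partition_complex_iff proper_partitions_def True)
    have n0: "n = 0"
      using assms(2) True by simp
    have D0: "c = 0" if "c \<in> oriented_chains ?D (int n - 3 - i)" for c
      using D.chain_support[OF that] assms(3) n0 by (fastforce simp: fun_eq_iff)
    have Q0: "c = 0" if "c \<in> oriented_chains ?Q i" for c
      using Q.chain_support[OF that] Q1 assms(3) by (fastforce simp: fun_eq_iff)
    have D_cyc: "c \<in> cycles ?D (int n - 3 - i) \<longleftrightarrow> c = 0" and Q_cyc: "z \<in> cycles ?Q i \<longleftrightarrow> z = 0" for c z
      using D0 Q0 D.chain_0 Q.chain_0 by (auto simp: cycles_def)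
    have D_bd: "c \<in> boundaries ?D (int n - 3 - i) \<longleftrightarrow> c = 0" and Q_bd: "z \<in> boundaries ?Q i \<longleftrightarrow> z = 0" for c z
      using D_cyc Q_cyc D.boundaries_subset Q.boundaries_subset D.boundaries_0 Q.boundaries_0 by blast+
    show ?thesis
      by (rule rep_isomorphic_relation[OF finite_complex_IN_dual finite_complex_partition,
            where R = "\<lambda>x y. x = 0 \<and> y = 0"])
        (use act in \<open>auto simp: D_cyc Q_cyc D_bd Q_bd\<close>)
  next
    case False
    then have m: "m \<ge> 2"
      using assms(1) by simp
    have "{1, 2} \<in> ?E"
      using m by (simp add: complete_graph_edges_def)
    then have E: "?E \<noteq> {}"
      by blast
    have N: "alexander_dual ?E ?D = disconnected_complex m"
      by (simp add: alexander_dual_IN disconnected_complex_def)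
    have "rep_isomorphic (sym_group m)
        (reduced_homology ?D (int (card ?E) - 3 - i)) (homology_action edge_action)
        (reduced_homology ?Q i)
        (tensor_character (reduced_homology ?Q i) (homology_action partition_action)
          (\<lambda>g. of_int (sign_on ?E (edge_action g))))"
      by (rule homology_duality[OF finite_complex_IN_dual E finite_complex_partition finite_complex_mixed])
        (use act mixed_acyclic_disconnected[OF assms(1)] mixed_acyclic_partitions[OF m]
          disconnected_in_mixed[of m] partitions_in_mixed[OF m] in \<open>auto simp: N\<close>)
    then show ?thesis
      by (simp add: n edge_sgn_def[abs_def])
  qed
qed

end
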